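(* Assume $\|X\|/p\le\lambda\le 2\bar\lambda$ with $\bar\lambda=2\|X\|\sqrt{\log p}$, and that there are constants $A_1,A_2,A_3,A_4>0$ (not depending on $p$) such that $A_1p^{-A_3}\pi_p(s-1)\le\pi_p(s)\le A_2p^{-A_4}\pi_p(s-1)$ for $s=1,\dots,p$. Then for sufficiently large $M$, as $n,p\to\infty$, with $S_0=S_{\beta^0}$: \begin{align*} &\sup_{\beta^0}\mathbb E_{\beta^0}\Pi\Big(\beta:\|X(\beta-\beta^0)\|_2>\frac{M}{\bar\psi(S_0)}\frac{\sqrt{|S_0|\log p}}{\phi(S_0)}\ \Big|\ Y\Big)\to0,\\ &\sup_{\beta^0}\mathbb E_{\beta^0}\Pi\Big(\beta:\|\beta-\beta^0\|_1>\frac{M}{\bar\psi(S_0)^2}\frac{|S_0|\sqrt{\log p}}{\|X\|\phi(S_0)^2}\ \Big|\ Y\Big)\to0,\\ &\sup_{\beta^0}\mathbb E_{\beta^0}\Pi\Big(\beta:\|\beta-\beta^0\|_2>\frac{M}{\tilde\psi(S_0)^2}\frac{\sqrt{|S_0|\log p}}{\|X\|\phi(S_0)}\ \Big|\ Y\Big)\to0. \end{align*} Furthermore, for every $c_0>0$, any $d_0<c_0^2(1+2/A_4)^{-1}/8$, and any sequence $s_n$ with $\lambda s_n\sqrt{\log p}/\|X\|\to0$, for sufficiently large $M$, \[ \sup\ \mathbb E_{\beta^0}\Pi\Big(\beta:\|\beta-\beta^0\|_\infty>M\frac{\sqrt{\log p}}{\|X\|}\ \Big|\ Y\Big)\to0,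 \] where the supremum is over all $\beta^0$ with $\phi(S_0)\ge c_0$, $\tilde\psi(S_0)\ge c_0$, $|S_0|\le s_n$ and $|S_0|\le d_0\,\mathrm{mc}(X)^{-1}$.
   Context: Observations follow $Y=X\beta+\varepsilon$ with $X$ a deterministic real $n\times p$ matrix and $\varepsilon\sim N_n(0,I_n)$. For $\beta^0\in\mathbb R^p$, $\mathbb E_{\beta^0}$ denotes expectation when $Y\sim N_n(X\beta^0,I_n)$. For $\beta\in\mathbb R^p$, $S_\beta=\{i:\beta_i\neq0\}$; for $S\subset\{1,\dots,p\}$, $\beta_S=(\beta_i)_{i\in S}$. $X_{\cdot,i}$ is the $i$th column of $X$ and $\|X\|=\max_i\|X_{\cdot,i}\|_2$. The prior $\Pi$ on $\mathbb R^p$: draw $s$ from a probability $\pi_p$ on $\{0,\dots,p\}$, then $S$ uniformly among subsets of size $s$, then $\beta_i$, $i\in S$, i.i.d. with density $x\mapsto\frac{\lambda}{2}e^{-\lambda|x|}$, and $\beta_i=0$ for $i\notin S$. Posterior: $\Pi(B\mid Y)=\int_Be^{-\|Y-X\beta\|_2^2/2}d\Pi(\beta)/\int e^{-\|Y-X\beta\|_2^2/2}d\Pi(\beta)$. Definitions: $\phi(S)=\inf\{\|X\beta\|_2|S|^{1/2}/(\|X\|\|\beta_S\|_1):\|\beta_{S^c}\|_1\le7\|\beta_S\|_1,\beta_S\ne0\}$; for $s>0$, $\bar\phi(s)=\inf\{\|X\beta\|_2|S_\beta|^{1/2}/(\|X\|\|\beta\|_1):0\neq|S_\beta|\le s\}$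 and $\tilde\phi(s)=\inf\{\|X\beta\|_2/(\|X\|\|\beta\|_2):0\ne|S_\beta|\le s\}$; $\bar\psi(S)=\bar\phi\big((2+\frac{3}{A_4}+\frac{33}{\phi(S)^2}\frac{\lambda}{\bar\lambda})|S|\big)$ and $\tilde\psi(S)=\tilde\phi\big((2+\frac{3}{A_4}+\frac{33}{\phi(S)^2}\frac{\lambda}{\bar\lambda})|S|\big)$; the mutual coherence is $\mathrm{mc}(X)=\max_{i\ne j}|\langle X_{\cdot,i},X_{\cdot,j}\rangle|/(\|X_{\cdot,i}\|_2\|X_{\cdot,j}\|_2)$. Asymptotics: $n,p\to\infty$ with $X,\lambda,\pi_p$ allowed to depend on $n,p$ subject to the assumptions (constants $A_i$ fixed). *)

theory Defs
  imports "HOL-Probability.Probability"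
begin

text \<open>Design matrix X: n x p, entries X i j (i < n row, j < p column).
  Vectors in R^p are functions nat => real, only indices below p matter.\<close>

definition mat_vec :: "nat \<Rightarrow> (nat \<Rightarrow> nat \<Rightarrow> real) \<Rightarrow> (nat \<Rightarrow> real) \<Rightarrow> nat \<Rightarrow> real" where
  "mat_vec p X \<beta> = (\<lambda>i. \<Sum>j<p. X i j * \<beta> j)"

definition norm2 :: "nat \<Rightarrow> (nat \<Rightarrow> real) \<Rightarrow> real" where
  "norm2 m v = sqrt (\<Sum>i<m. (v i)^2)"

definition norm1 :: "nat \<Rightarrow> (nat \<Rightarrow> real) \<Rightarrow> real" where
  "norm1 m v = (\<Sum>i<m. \<bar>v i\<bar>)"

definition normInf :: "nat \<Rightarrow> (nat \<Rightarrow> real) \<Rightarrow> real" where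
  "normInf m v = Max (insert 0 ((\<lambda>i. \<bar>v i\<bar>) ` {..<m}))"

definition supp :: "nat \<Rightarrow> (nat \<Rightarrow> real) \<Rightarrow> nat set" where
  "supp p \<beta> = {i. i < p \<and> \<beta> i \<noteq> 0}"

definition colnorm :: "nat \<Rightarrow> (nat \<Rightarrow> nat \<Rightarrow> real) \<Rightarrow> nat \<Rightarrow> real" where
  "colnorm n X j = norm2 n (\<lambda>i. X i j)"

definition Xnorm :: "nat \<Rightarrow> nat \<Rightarrow> (nat \<Rightarrow> nat \<Rightarrow> real) \<Rightarrow> real" where
  "Xnorm n p X = Max (insert 0 (colnorm n X ` {..<p}))"

definition compat :: "nat \<Rightarrow> nat \<Rightarrow> (nat \<Rightarrow> nat \<Rightarrow> real) \<Rightarrow> nat set \<Rightarrow> real" where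
  "compat n p X S = Inf {norm2 n (mat_vec p X \<beta>) * sqrt (real (card S)) /
        (Xnorm n p X * (\<Sum>i\<in>S. \<bar>\<beta> i\<bar>)) | \<beta>.
        (\<Sum>i\<in>{..<p} - S. \<bar>\<beta> i\<bar>) \<le> 7 * (\<Sum>i\<in>S. \<bar>\<beta> i\<bar>) \<and> (\<exists>i\<in>S. \<beta> i \<noteq> 0)}"

definition phibar :: "nat \<Rightarrow> nat \<Rightarrow> (nat \<Rightarrow> nat \<Rightarrow> real) \<Rightarrow> real \<Rightarrow> real" where
  "phibar n p X s = Inf {norm2 n (mat_vec p X \<beta>) * sqrt (real (card (supp p \<beta>))) /
        (Xnorm n p X * norm1 p \<beta>) | \<beta>. card (supp p \<beta>) \<noteq> 0 \<and> real (card (supp p \<beta>)) \<le> s}"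

definition phitil :: "nat \<Rightarrow> nat \<Rightarrow> (nat \<Rightarrow> nat \<Rightarrow> real) \<Rightarrow> real \<Rightarrow> real" where
  "phitil n p X s = Inf {norm2 n (mat_vec p X \<beta>) / (Xnorm n p X * norm2 p \<beta>) | \<beta>.
        card (supp p \<beta>) \<noteq> 0 \<and> real (card (supp p \<beta>)) \<le> s}"

definition lbar :: "nat \<Rightarrow> nat \<Rightarrow> (nat \<Rightarrow> nat \<Rightarrow> real) \<Rightarrow> real" where
  "lbar n p X = 2 * Xnorm n p X * sqrt (ln (real p))"

definition psi_arg :: "nat \<Rightarrow> nat \<Rightarrow> (nat \<Rightarrow> nat \<Rightarrow> real) \<Rightarrow> real \<Rightarrow> real \<Rightarrow> nat set \<Rightarrow> real" where
  "psi_arg n p X l A4 S = (2 + 3 / A4 + 33 / (compat n p X S)^2 * (l / lbar n p X)) * real (card S)"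

definition psibar :: "nat \<Rightarrow> nat \<Rightarrow> (nat \<Rightarrow> nat \<Rightarrow> real) \<Rightarrow> real \<Rightarrow> real \<Rightarrow> nat set \<Rightarrow> real" where
  "psibar n p X l A4 S = phibar n p X (psi_arg n p X l A4 S)"

definition psitil :: "nat \<Rightarrow> nat \<Rightarrow> (nat \<Rightarrow> nat \<Rightarrow> real) \<Rightarrow> real \<Rightarrow> real \<Rightarrow> nat set \<Rightarrow> real" where
  "psitil n p X l A4 S = phitil n p X (psi_arg n p X l A4 S)"

definition mcoh :: "nat \<Rightarrow> nat \<Rightarrow> (nat \<Rightarrow> nat \<Rightarrow> real) \<Rightarrow> real" where
  "mcoh n p X = Max (insert 0 {\<bar>\<Sum>k<n. X k i * X k j\<bar> / (colnorm n X i * colnorm n X j) | i j.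
        i < p \<and> j < p \<and> i \<noteq> j})"

definition laplace :: "real \<Rightarrow> real measure" where
  "laplace l = density lborel (\<lambda>x. ennreal (l / 2 * exp (- l * \<bar>x\<bar>)))"

definition subset_pmf :: "nat \<Rightarrow> nat pmf \<Rightarrow> nat set pmf" where
  "subset_pmf p \<pi> = bind_pmf \<pi> (\<lambda>s. pmf_of_set {S. S \<subseteq> {..<p} \<and> card S = s})"

definition prior :: "nat \<Rightarrow> real \<Rightarrow> nat pmf \<Rightarrow> (nat \<Rightarrow> real) measure" where
  "prior p l \<pi> = measure_pmf (subset_pmf p \<pi>) \<bind>
      (\<lambda>S. PiM {..<p} (\<lambda>i. if i \<in> S then laplace l else return lborel 0))"

definition lik :: "nat \<Rightarrow> nat \<Rightarrow> (nat \<Rightarrow> nat \<Rightarrow> real) \<Rightarrow> (nat \<Rightarrow> real) \<Rightarrow> (nat \<Rightarrow> real) \<Rightarrow> real" where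
  "lik n p X Y \<beta> = exp (- ((norm2 n (\<lambda>i. Y i - mat_vec p X \<beta> i))^2) / 2)"

definition posterior :: "nat \<Rightarrow> nat \<Rightarrow> (nat \<Rightarrow> nat \<Rightarrow> real) \<Rightarrow> real \<Rightarrow> nat pmf \<Rightarrow>
    (nat \<Rightarrow> real) \<Rightarrow> (nat \<Rightarrow> real) set \<Rightarrow> real" where
  "posterior n p X l \<pi> Y B =
     (\<integral>\<beta>. indicator B \<beta> * lik n p X Y \<beta> \<partial>prior p l \<pi>) / (\<integral>\<beta>. lik n p X Y \<beta> \<partial>prior p l \<pi>)"

definition data_law :: "nat \<Rightarrow> nat \<Rightarrow> (nat \<Rightarrow> nat \<Rightarrow> real) \<Rightarrow> (nat \<Rightarrow> real) \<Rightarrow> (nat \<Rightarrow> real) measure" where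
  "data_law n p X \<beta>0 = PiM {..<n} (\<lambda>i. density lborel (normal_density (mat_vec p X \<beta>0 i) 1))"

definition post_risk :: "nat \<Rightarrow> nat \<Rightarrow> (nat \<Rightarrow> nat \<Rightarrow> real) \<Rightarrow> real \<Rightarrow> nat pmf \<Rightarrow>
    (nat \<Rightarrow> real) \<Rightarrow> (nat \<Rightarrow> real) set \<Rightarrow> real" where
  "post_risk n p X l \<pi> \<beta>0 B = (\<integral>Y. posterior n p X l \<pi> Y B \<partial>data_law n p X \<beta>0)"

end

theory Submission
  imports Defs "HOL-Real_Asymp.Real_Asymp"
begin

text \<open>Write \<open>b = \<beta> - \<beta>0\<close>, \<open>z = Y - X \<beta>0\<close> and \<open>x = \<lambda> / lbar\<close>. The posterior probability of a set is a ratio of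
  integrals of \<open>exp (\<langle>z, X b\<rangle> - \<parallel>X b\<parallel>\<^sup>2 / 2)\<close>. The evidence is bounded below on a small box around \<open>\<beta>0\<close>. For the
  numerator, a chi-square bound with a union bound over all supports gives
  \<open>\<langle>z, X b\<rangle>\<^sup>2 \<le> 16 \<bar>S\<bar> ln p \<parallel>X b\<parallel>\<^sup>2\<close>; replacing \<open>\<langle>z, X b\<rangle>\<close> by \<open>(1 - \<delta>) \<langle>z, X b\<rangle>\<close> with \<open>\<delta>\<close> a small multiple of \<open>A4\<close> then costs
  only \<open>p\<close> to the power \<open>16 \<delta> \<bar>S\<bar>\<close>, which the prior on the model size absorbs, and leaves a factor
  \<open>exp (- \<delta> \<parallel>X b\<parallel>\<^sup>2 / 4)\<close> in expectation. This absorbs the \<open>\<ell>\<^sub>1\<close> bias up to an exponent quadratic in \<open>x\<close>.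

  If \<open>x\<close> is below a threshold depending on \<open>A4\<close> only, the dimension bound appearing in \<open>psi_arg\<close> follows.
  If \<open>x\<close> is above it, the \<open>\<ell>\<^sub>1\<close> loss is controlled directly and the \<open>\<ell>\<^sub>2\<close> loss through Maurey's method. (The
  argument for the dimension bound breaks down there when \<open>A4\<close> is small.) For the supremum norm, the dominating coordinate
  of \<open>b\<close> is moved into a neighbourhood of \<open>0\<close>, which gains an arbitrary power of \<open>p\<close> under the coherence
  condition.\<close>

text \<open>For fixed b the factor exp (<z, X b> - |X b|^2 / 2) has expectation exactly 1 under the
  truth. At full power it therefore leaves nothing to pay for the penalty bias; lowering the power
  of the noise term creates the slack. The 16 comes from playing the chi-square moment exp (Q / 4)
  against weights p^(-4 |S|). With \<delta> = \<open>tilt A4 / 16\<close> the loss p^(16 \<delta>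
  |S|) is p raised to \<open>tilt A4\<close> times |S|. The threshold \<open>lam_cut\<close> keeps
  the bias exponent 32 x^2 / (\<delta> \<phi>^2), per unit of |S0| ln p, below 16 A4 x / \<phi>^2,
  about half of what the prior gains beyond the size allowed by the 33 in \<open>psi_arg\<close>. No
  good event is conditioned on. The far-set bound reads \<open>marginal\<close> of the set <= G
  times the evidence, claimed only where G < 1, with G of small mean; noise failure is one summand
  of G. Posterior sets may be arbitrary, so they are always covered by measurable ones. An empty
  true support is treated apart: its compatibility number is an infimum over the empty set and
  carries no information.\<close>

definition dot :: "nat \<Rightarrow> (nat \<Rightarrow> real) \<Rightarrow> (nat \<Rightarrow> real) \<Rightarrow> real" where
  "dot n u v = (\<Sum>i<n. u i * v i)"

lemma dot_commute: "dot n u v = dot n v u"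
  by (simp add: dot_def mult.commute)

lemma dot_add_left: "dot n (\<lambda>i. u i + v i) w = dot n u w + dot n v w"
  by (simp add: dot_def algebra_simps sum.distrib)

lemma dot_diff_left: "dot n (\<lambda>i. u i - v i) w = dot n u w - dot n v w"
  by (simp add: dot_def algebra_simps sum_subtractf)

lemma dot_scale_left: "dot n (\<lambda>i. c * u i) w = c * dot n u w"
  by (simp add: dot_def algebra_simps sum_distrib_left)

lemma dot_add_right: "dot n w (\<lambda>i. u i + v i) = dot n w u + dot n w v"
  by (simp add: dot_def algebra_simps sum.distrib)

lemma dot_diff_right: "dot n w (\<lambda>i. u i - v i) = dot n w u - dot n w v"
  by (simp add: dot_def algebra_simps sum_subtractf)

lemma dot_scale_right: "dot n w (\<lambda>i. c * u i) = c * dot n w u"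
  by (simp add: dot_def algebra_simps sum_distrib_left)

lemma dot_sum_left: "dot n (\<lambda>i. \<Sum>j\<in>S. f j i) w = (\<Sum>j\<in>S. dot n (f j) w)"
  unfolding dot_def by (subst sum.swap) (simp add: sum_distrib_right)

lemma dot_sum_right: "dot n w (\<lambda>i. \<Sum>j\<in>S. f j i) = (\<Sum>j\<in>S. dot n w (f j))"
  by (simp add: dot_commute[of n w] dot_sum_left)

lemma dot_sum_sum:
  "dot n (\<lambda>i. \<Sum>k\<in>S. e k * u k i) (\<lambda>i. \<Sum>k\<in>S. e k * u k i) =
    (\<Sum>k\<in>S. \<Sum>l\<in>S. e k * e l * dot n (u k) (u l))"
  by (simp only: dot_sum_left dot_scale_left dot_sum_right dot_scale_right sum_distrib_left mult.assoc)

lemma dot_cong: "(\<And>i. i < n \<Longrightarrow> u i = u' i) \<Longrightarrow> (\<And>i. i < n \<Longrightarrow> v i = v' i) \<Longrightarrow> dot n u v = dot n u' v'"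
  by (simp add: dot_def)

lemma dot_self_nonneg: "0 \<le> dot n u u"
  by (simp add: dot_def sum_nonneg)

lemma dot_self_eq_0D: "dot n u u = 0 \<Longrightarrow> i < n \<Longrightarrow> u i = 0"
  by (simp add: dot_def sum_nonneg_eq_0_iff)

lemma norm2_power2: "(norm2 n v)\<^sup>2 = dot n v v"
  by (simp add: norm2_def dot_def power2_eq_square sum_nonneg)

lemma norm2_nonneg: "0 \<le> norm2 n v"
  by (simp add: norm2_def sum_nonneg)

lemma norm2_scale: "norm2 n (\<lambda>i. c * v i) = \<bar>c\<bar> * norm2 n v"
  by (simp add: norm2_def power_mult_distrib sum_distrib_left[symmetric] real_sqrt_mult)

subsection \<open>Gram--Schmidt orthogonalisation\<close>

text \<open>Linearly dependent vectors are kept as zero vectors instead of being discarded, hence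
  norms in {0, 1}. The index set stays S, so later exponents involve \<open>card S\<close> and never
  a rank.\<close>

lemma Gram_Schmidt:
  fixes x :: "'a \<Rightarrow> nat \<Rightarrow> real"
  assumes "finite S"
  shows "\<exists>u. (\<forall>j\<in>S. dot n (u j) (u j) \<in> {0, 1}) \<and>
             (\<forall>j\<in>S. \<forall>k\<in>S. j \<noteq> k \<longrightarrow> dot n (u j) (u k) = 0) \<and>
             (\<forall>j\<in>S. \<exists>c. \<forall>i<n. x j i = (\<Sum>k\<in>S. c k * u k i))"
  using assms
proof (induction S)
  case empty
  show ?case by simp
next
  case (insert a S)
  then obtain u where
    u1: "\<And>j. j \<in> S \<Longrightarrow> dot n (u j) (u j) \<in> {0, 1}" and
    u2: "\<And>j k. j \<in> S \<Longrightarrow> k \<in> S \<Longrightarrow> j \<noteq> k \<Longrightarrow> dot n (u j) (u k) = 0" and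
    u3: "\<And>j. j \<in> S \<Longrightarrow> \<exists>c. \<forall>i<n. x j i = (\<Sum>k\<in>S. c k * u k i)"
    by metis
  define w where "w = (\<lambda>i. x a i - (\<Sum>k\<in>S. dot n (x a) (u k) * u k i))"
  have wu: "dot n w (u k) = 0" if "k \<in> S" for k
  proof -
    have "dot n w (u k) = dot n (x a) (u k) - (\<Sum>l\<in>S. dot n (x a) (u l) * dot n (u l) (u k))"
      unfolding w_def by (simp add: dot_diff_left dot_sum_left dot_scale_left)
    also have "(\<Sum>l\<in>S. dot n (x a) (u l) * dot n (u l) (u k)) = dot n (x a) (u k) * dot n (u k) (u k)"
      using insert.hyps that u2
      by (subst sum.remove[of _ k]) (auto intro!: sum.neutral)
    also have "dot n (x a) (u k) * dot n (u k) (u k) = dot n (x a) (u k)"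
    proof (cases "dot n (u k) (u k) = 0")
      case True
      then have "dot n (x a) (u k) = 0" unfolding dot_def
        using dot_self_eq_0D[OF True] by (intro sum.neutral) auto
      then show ?thesis by simp
    next
      case False
      then show ?thesis using u1[OF that] by auto
    qed
    finally show ?thesis by simp
  qed
  define N where "N = norm2 n w"
  \<comment> \<open>If the residual vanishes then \<open>N = 0\<close>, and division by zero makes
    the new vector zero.\<close>
  define u' where "u' = u(a := (\<lambda>i. w i / N))"
  have a: "u' k = u k" if "k \<in> S" for k using that insert.hyps by (auto simp: u'_def)
  have aa: "dot n (u' a) (u' a) \<in> {0, 1}"
  proof -
    have "dot n (u' a) (u' a) = dot n w w / (N * N)"
      by (simp add: u'_def dot_def sum_divide_distrib)
    moreover have "N * N = dot n w w" unfolding N_def by (metis norm2_power2 power2_eq_square)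
    ultimately show ?thesis by auto
  qed
  have ak: "dot n (u' a) (u' k) = 0" if "k \<in> S" for k
  proof -
    have "dot n (u' a) (u k) = dot n w (u k) / N"
      by (simp add: u'_def dot_def sum_divide_distrib)
    then show ?thesis using wu[OF that] a[OF that] by simp
  qed
  have wN: "w i = N * u' a i" if "i < n" for i
  proof (cases "N = 0")
    case True
    then have "dot n w w = 0" by (metis N_def norm2_power2 zero_power2)
    then show ?thesis using dot_self_eq_0D that True by auto
  qed (simp add: u'_def)
  show ?case
  proof (intro exI[of _ u'] conjI ballI impI)
    fix j assume "j \<in> insert a S"
    then show "dot n (u' j) (u' j) \<in> {0, 1}" using aa u1 a by (metis insertE)
  next
    fix j k assume "j \<in> insert a S" "k \<in> insert a S" "j \<noteq> k"
    then show "dot n (u' j) (u' k) = 0" using ak a u2 dot_commute by (metis insertE)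
  next
    fix j assume j: "j \<in> insert a S"
    show "\<exists>c. \<forall>i<n. x j i = (\<Sum>k\<in>insert a S. c k * u' k i)"
    proof (cases "j = a")
      case True
      have "x j i = (\<Sum>k\<in>insert a S. (if k = a then N else dot n (x a) (u k)) * u' k i)" if "i < n" for i
      proof -
        have "(\<Sum>k\<in>S. (if k = a then N else dot n (x a) (u k)) * u' k i) = (\<Sum>k\<in>S. dot n (x a) (u k) * u k i)"
          using a insert.hyps by (intro sum.cong) auto
        moreover have "x a i = w i + (\<Sum>k\<in>S. dot n (x a) (u k) * u k i)" by (simp add: w_def)
        ultimately show ?thesis using insert.hyps wN[OF that] True by simp
      qed
      then show ?thesis by (intro exI[of _ "\<lambda>k. if k = a then N else dot n (x a) (u k)"]) simp
    next
      case False
      then obtain c where c: "\<And>i. i < n \<Longrightarrow> x j i = (\<Sum>k\<in>S. c k * u k i)" using u3 j by blast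
      have "x j i = (\<Sum>k\<in>insert a S. (c(a := 0)) k * u' k i)" if "i < n" for i
      proof -
        have "(\<Sum>k\<in>S. (c(a := 0)) k * u' k i) = (\<Sum>k\<in>S. c k * u k i)"
          using a insert.hyps by (intro sum.cong) auto
        then show ?thesis using insert.hyps c[OF that] by simp
      qed
      then show ?thesis by blast
    qed
  qed
qed

text \<open>With \<open>u\<close> from Gram--Schmidt, \<open>(\<Sum>k\<in>S. (dot n z (u k))\<^sup>2)\<close> is the squared length of the projection of
  \<open>z\<close> on the span of the \<open>x j\<close>.\<close>

lemma dot_span_le:
  assumes S: "finite S" and u1: "\<And>j. j \<in> S \<Longrightarrow> dot n (u j) (u j) \<in> {0, 1}"
    and u2: "\<And>j k. j \<in> S \<Longrightarrow> k \<in> S \<Longrightarrow> j \<noteq> k \<Longrightarrow> dot n (u j) (u k) = 0"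
    and u3: "\<And>j. j \<in> S \<Longrightarrow> \<exists>c. \<forall>i<n. x j i = (\<Sum>k\<in>S. c k * u k i)"
  shows "(dot n z (\<lambda>i. \<Sum>j\<in>S. b j * x j i))\<^sup>2 \<le>
    (\<Sum>k\<in>S. (dot n z (u k))\<^sup>2) * (norm2 n (\<lambda>i. \<Sum>j\<in>S. b j * x j i))\<^sup>2"
proof -
  obtain c where c: "\<And>j i. j \<in> S \<Longrightarrow> i < n \<Longrightarrow> x j i = (\<Sum>k\<in>S. c j k * u k i)"
    using u3 by metis
  define e where "e k = (\<Sum>j\<in>S. b j * c j k)" for k
  define v where "v = (\<lambda>i. \<Sum>j\<in>S. b j * x j i)"
  have v: "v i = (\<Sum>k\<in>S. e k * u k i)" if "i < n" for i
  proof -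
    have "v i = (\<Sum>j\<in>S. \<Sum>k\<in>S. b j * c j k * u k i)"
      unfolding v_def using c that by (simp add: sum_distrib_left mult.assoc)
    also have "\<dots> = (\<Sum>k\<in>S. e k * u k i)"
      unfolding e_def by (subst sum.swap) (simp add: sum_distrib_right)
    finally show ?thesis .
  qed
  \<comment> \<open>\<open>t k\<close> is 0 or 1, hence idempotent. Inserting it into the
    coefficients erases those of zero vectors, about which the expansion says nothing.\<close>
  define t where "t k = dot n (u k) (u k)" for k
  have tt: "t k * t k = t k" if "k \<in> S" for k using u1[OF that] by (auto simp: t_def)
  have tz: "dot n z (u k) = t k * dot n z (u k)" if "k \<in> S" for k
  proof (cases "t k = 0")
    case True
    then have "dot n z (u k) = 0" unfolding dot_def t_def
      using dot_self_eq_0D[of n "u k"] by (intro sum.neutral) (auto simp: dot_def)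
    then show ?thesis by simp
  next
    case False
    then show ?thesis using u1[OF that] by (auto simp: t_def)
  qed
  have zv: "dot n z v = (\<Sum>k\<in>S. (e k * t k) * dot n z (u k))"
  proof -
    have "dot n z v = dot n z (\<lambda>i. \<Sum>k\<in>S. e k * u k i)" by (rule dot_cong) (auto simp: v)
    also have "\<dots> = (\<Sum>k\<in>S. e k * dot n z (u k))" by (simp add: dot_sum_right dot_scale_right)
    also have "\<dots> = (\<Sum>k\<in>S. (e k * t k) * dot n z (u k))"
      using tz by (intro sum.cong) (auto simp: mult.assoc)
    finally show ?thesis .
  qed
  have vv: "dot n v v = (\<Sum>k\<in>S. (e k * t k)\<^sup>2)"
  proof -
    have "dot n v v = dot n (\<lambda>i. \<Sum>k\<in>S. e k * u k i) (\<lambda>i. \<Sum>k\<in>S. e k * u k i)"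
      by (rule dot_cong) (auto simp: v)
    also have "\<dots> = (\<Sum>k\<in>S. \<Sum>l\<in>S. e k * e l * dot n (u k) (u l))"
      by (rule dot_sum_sum)
    also have "\<dots> = (\<Sum>k\<in>S. (e k * t k)\<^sup>2)"
    proof (intro sum.cong refl)
      fix k assume k: "k \<in> S"
      have "(\<Sum>l\<in>S - {k}. e k * e l * dot n (u k) (u l)) = 0"
        using u2[OF k] by (intro sum.neutral ballI) (metis DiffE insertI1 mult_zero_right)
      then have "(\<Sum>l\<in>S. e k * e l * dot n (u k) (u l)) = e k * e k * t k"
        using S k by (simp add: t_def sum.remove)
      then show "(\<Sum>l\<in>S. e k * e l * dot n (u k) (u l)) = (e k * t k)\<^sup>2"
        using tt[OF k] by (simp add: power2_eq_square mult_ac)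
    qed
    finally show ?thesis .
  qed
  have "(dot n z v)\<^sup>2 \<le> (\<Sum>k\<in>S. (e k * t k)\<^sup>2) * (\<Sum>k\<in>S. (dot n z (u k))\<^sup>2)"
    unfolding zv by (rule Cauchy_Schwarz_ineq_sum)
  then show ?thesis unfolding v_def[symmetric] norm2_power2 vv by (simp add: mult.commute)
qed

subsection \<open>Gaussian noise\<close>

text \<open>Completing the square: tilting by \<open>exp (v * (y - \<mu>))\<close> shifts the mean
  by \<open>v\<close> and leaves a normalised density.\<close>

lemma nn_integral_normal_mgf:
  "(\<integral>\<^sup>+y. ennreal (exp (v * (y - \<mu>))) \<partial>density lborel (normal_density \<mu> 1)) = ennreal (exp (v\<^sup>2 / 2))"
proof -
  have "(\<integral>\<^sup>+y. ennreal (exp (v * (y - \<mu>))) \<partial>density lborel (normal_density \<mu> 1)) =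
        (\<integral>\<^sup>+y. ennreal (exp (v\<^sup>2 / 2)) * ennreal (normal_density (\<mu> + v) 1 y) \<partial>lborel)"
  proof (subst nn_integral_density; (simp; fail)?)
    show "(\<integral>\<^sup>+y. ennreal (normal_density \<mu> 1 y) * ennreal (exp (v * (y - \<mu>))) \<partial>lborel) =
       (\<integral>\<^sup>+y. ennreal (exp (v\<^sup>2 / 2)) * ennreal (normal_density (\<mu> + v) 1 y) \<partial>lborel)"
    proof (intro nn_integral_cong)
      fix y :: real
      have "v * (y - \<mu>) - (y - \<mu>)\<^sup>2 / 2 = v\<^sup>2 / 2 - (y - (\<mu> + v))\<^sup>2 / 2"
        by (simp add: power2_eq_square field_simps)
      then have "exp (- (y - \<mu>)\<^sup>2 / 2) * exp (v * (y - \<mu>)) = exp (v\<^sup>2 / 2) * exp (- (y - (\<mu> + v))\<^sup>2 / 2)"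
        by (simp add: exp_add[symmetric])
      then show "ennreal (normal_density \<mu> 1 y) * ennreal (exp (v * (y - \<mu>))) =
         ennreal (exp (v\<^sup>2 / 2)) * ennreal (normal_density (\<mu> + v) 1 y)"
        by (simp add: normal_density_def ennreal_mult[symmetric])
    qed
  qed
  also have "\<dots> = ennreal (exp (v\<^sup>2 / 2)) * (\<integral>\<^sup>+y. ennreal (normal_density (\<mu> + v) 1 y) \<partial>lborel)"
    by (rule nn_integral_cmult) simp
  also have "(\<integral>\<^sup>+y. ennreal (normal_density (\<mu> + v) 1 y) \<partial>lborel) = 1"
    using prob_space.emeasure_space_1[OF prob_space_normal_density[of 1 "\<mu> + v"]]
    by (simp add: emeasure_density)
  finally show ?thesis by simp
qed

text \<open>The weight turns the standard normal density into sqrt 2 times the density of variance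
  2.\<close>

lemma nn_integral_normal_exp_square:
  "(\<integral>\<^sup>+y. ennreal (exp (y\<^sup>2 / 4)) \<partial>density lborel (normal_density 0 1)) = ennreal (sqrt 2)"
proof -
  have "(\<integral>\<^sup>+y. ennreal (exp (y\<^sup>2 / 4)) \<partial>density lborel (normal_density 0 1)) =
        (\<integral>\<^sup>+y. ennreal (sqrt 2) * ennreal (normal_density 0 (sqrt 2) y) \<partial>lborel)"
  proof (subst nn_integral_density; (simp; fail)?)
    show "(\<integral>\<^sup>+y. ennreal (normal_density 0 1 y) * ennreal (exp (y\<^sup>2 / 4)) \<partial>lborel) =
       (\<integral>\<^sup>+y. ennreal (sqrt 2) * ennreal (normal_density 0 (sqrt 2) y) \<partial>lborel)"
    proof (intro nn_integral_cong)
      fix y :: real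
      have "exp (- y\<^sup>2 / 2) * exp (y\<^sup>2 / 4) = exp (- y\<^sup>2 / 4)"
        by (simp add: exp_add[symmetric])
      moreover have "sqrt (2 * pi * (sqrt 2)\<^sup>2) = sqrt 2 * sqrt (2 * pi)"
        by (simp add: real_sqrt_mult)
      ultimately show "ennreal (normal_density 0 1 y) * ennreal (exp (y\<^sup>2 / 4)) =
         ennreal (sqrt 2) * ennreal (normal_density 0 (sqrt 2) y)"
        by (simp add: normal_density_def ennreal_mult[symmetric])
    qed
  qed
  also have "\<dots> = ennreal (sqrt 2) * (\<integral>\<^sup>+y. ennreal (normal_density 0 (sqrt 2) y) \<partial>lborel)"
    by (rule nn_integral_cmult) simp
  also have "(\<integral>\<^sup>+y. ennreal (normal_density 0 (sqrt 2) y) \<partial>lborel) = 1"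
    using prob_space.emeasure_space_1[OF prob_space_normal_density[of "sqrt 2" 0]]
    by (simp add: emeasure_density)
  finally show ?thesis by simp
qed

abbreviation gauss :: "nat \<Rightarrow> (nat \<Rightarrow> real) \<Rightarrow> (nat \<Rightarrow> real) measure" where
  "gauss n \<mu> \<equiv> PiM {..<n} (\<lambda>i. density lborel (normal_density (\<mu> i) 1))"

lemma prob_space_gauss: "prob_space (gauss n \<mu>)"
  by (intro prob_space_PiM prob_space_normal_density) simp

lemma nn_integral_gauss_mgf:
  "(\<integral>\<^sup>+y. ennreal (exp (dot n (\<lambda>i. y i - \<mu> i) v)) \<partial>gauss n \<mu>) = ennreal (exp (dot n v v / 2))"
proof -
  interpret product_sigma_finite "\<lambda>i. density lborel (normal_density (\<mu> i) 1)"
    unfolding product_sigma_finite_def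
    by (intro allI prob_space_imp_sigma_finite prob_space_normal_density) simp
  have "(\<integral>\<^sup>+y. ennreal (exp (dot n (\<lambda>i. y i - \<mu> i) v)) \<partial>gauss n \<mu>) =
        (\<integral>\<^sup>+y. (\<Prod>i<n. ennreal (exp (v i * (y i - \<mu> i)))) \<partial>gauss n \<mu>)"
    by (intro nn_integral_cong) (simp add: dot_def exp_sum prod_ennreal mult.commute)
  also have "\<dots> = (\<Prod>i<n. \<integral>\<^sup>+y. ennreal (exp (v i * (y - \<mu> i))) \<partial>density lborel (normal_density (\<mu> i) 1))"
    by (intro product_nn_integral_prod) auto
  also have "\<dots> = (\<Prod>i<n. ennreal (exp ((v i)\<^sup>2 / 2)))"
    by (simp only: nn_integral_normal_mgf)
  also have "\<dots> = ennreal (exp (dot n v v / 2))"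
    by (simp add: dot_def exp_sum prod_ennreal power2_eq_square sum_divide_distrib)
  finally show ?thesis .
qed

lemma measurable_dot_gauss [measurable]:
  "(\<lambda>y. dot n (\<lambda>i. y i - \<mu> i) v) \<in> borel_measurable (gauss n \<nu>)"
  unfolding dot_def by measurable

text \<open>The chi-square factor is linearised by \<open>exp (g\<^sup>2 / 4) = E exp (g \<xi> / sqrt 2)\<close> for an independent
  standard normal \<open>\<xi>\<close>; this avoids the rotation invariance of the Gaussian law.\<close>

lemma nn_integral_gauss_chi_square:
  fixes u :: "nat \<Rightarrow> nat \<Rightarrow> real"
  assumes S: "finite S" and u1: "\<And>j. j \<in> S \<Longrightarrow> dot n (u j) (u j) \<in> {0, 1}"
    and u2: "\<And>j k. j \<in> S \<Longrightarrow> k \<in> S \<Longrightarrow> j \<noteq> k \<Longrightarrow> dot n (u j) (u k) = 0"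
  shows "(\<integral>\<^sup>+y. ennreal (exp ((\<Sum>k\<in>S. (dot n (\<lambda>i. y i - \<mu> i) (u k))\<^sup>2) / 4)) \<partial>gauss n \<mu>)
    \<le> 2 ^ card S"
proof -
  let ?N = "\<lambda>k::nat. density lborel (normal_density 0 1)"
  let ?g = "\<lambda>y k. dot n (\<lambda>i. y i - \<mu> i) (u k)"
  interpret N: product_sigma_finite ?N
    unfolding product_sigma_finite_def
    by (intro allI prob_space_imp_sigma_finite prob_space_normal_density) simp
  interpret P: prob_space "PiM S ?N"
    by (intro prob_space_PiM prob_space_normal_density) simp
  interpret G: prob_space "gauss n \<mu>" by (rule prob_space_gauss)
  interpret PG: pair_sigma_finite "PiM S ?N" "gauss n \<mu>" ..
  have 1: "ennreal (exp ((\<Sum>k\<in>S. (?g y k)\<^sup>2) / 4)) =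
    (\<integral>\<^sup>+\<xi>. ennreal (exp (\<Sum>k\<in>S. \<xi> k * ?g y k / sqrt 2)) \<partial>PiM S ?N)" for y
  proof -
    have "(\<integral>\<^sup>+\<xi>. ennreal (exp (\<Sum>k\<in>S. \<xi> k * ?g y k / sqrt 2)) \<partial>PiM S ?N) =
       (\<integral>\<^sup>+\<xi>. (\<Prod>k\<in>S. ennreal (exp ((?g y k / sqrt 2) * (\<xi> k - 0)))) \<partial>PiM S ?N)"
      using S by (intro nn_integral_cong) (simp add: exp_sum prod_ennreal mult.commute)
    also have "\<dots> = (\<Prod>k\<in>S. \<integral>\<^sup>+\<xi>. ennreal (exp ((?g y k / sqrt 2) * (\<xi> - 0))) \<partial>?N k)"
      using S by (intro N.product_nn_integral_prod) auto
    also have "\<dots> = (\<Prod>k\<in>S. ennreal (exp ((?g y k / sqrt 2)\<^sup>2 / 2)))"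
      by (simp only: nn_integral_normal_mgf)
    also have "\<dots> = ennreal (exp ((\<Sum>k\<in>S. (?g y k)\<^sup>2) / 4))"
      using S by (simp add: exp_sum prod_ennreal power_divide sum_divide_distrib)
    finally show ?thesis by simp
  qed
  \<comment> \<open>For frozen \<xi> the exponent is linear in the Gaussian vector; in its variance
    orthogonality kills all cross terms, and norms at most 1 bound the diagonal.\<close>
  have 2: "(\<integral>\<^sup>+y. ennreal (exp (\<Sum>k\<in>S. \<xi> k * ?g y k / sqrt 2)) \<partial>gauss n \<mu>) \<le>
     (\<Prod>k\<in>S. ennreal (exp ((\<xi> k)\<^sup>2 / 4)))" for \<xi>
  proof -
    define v where "v = (\<lambda>i. \<Sum>k\<in>S. (\<xi> k / sqrt 2) * u k i)"
    have "(\<Sum>k\<in>S. \<xi> k * ?g y k / sqrt 2) = dot n (\<lambda>i. y i - \<mu> i) v" for y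
      unfolding v_def by (simp only: dot_sum_right dot_scale_right) simp
    then have "(\<integral>\<^sup>+y. ennreal (exp (\<Sum>k\<in>S. \<xi> k * ?g y k / sqrt 2)) \<partial>gauss n \<mu>) = ennreal (exp (dot n v v / 2))"
      by (simp add: nn_integral_gauss_mgf)
    also have "dot n v v = (\<Sum>k\<in>S. \<Sum>l\<in>S. (\<xi> k / sqrt 2) * (\<xi> l / sqrt 2) * dot n (u k) (u l))"
      unfolding v_def by (rule dot_sum_sum)
    also have "\<dots> = (\<Sum>k\<in>S. (\<xi> k)\<^sup>2 / 2 * dot n (u k) (u k))"
    proof (intro sum.cong refl)
      fix k assume k: "k \<in> S"
      show "(\<Sum>l\<in>S. (\<xi> k / sqrt 2) * (\<xi> l / sqrt 2) * dot n (u k) (u l)) = (\<xi> k)\<^sup>2 / 2 * dot n (u k) (u k)"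
        using S k u2[OF k]
        by (subst sum.remove[of _ k]) (auto intro!: sum.neutral dest!: not_sym[of _ k] simp: power2_eq_square)
    qed
    also have "\<dots> \<le> (\<Sum>k\<in>S. (\<xi> k)\<^sup>2 / 2)"
    proof (intro sum_mono)
      fix k assume "k \<in> S"
      then show "(\<xi> k)\<^sup>2 / 2 * dot n (u k) (u k) \<le> (\<xi> k)\<^sup>2 / 2" using u1[of k] by auto
    qed
    finally show ?thesis
      using S by (simp add: exp_sum[symmetric] prod_ennreal sum_divide_distrib[symmetric])
  qed
  have "(\<integral>\<^sup>+y. ennreal (exp ((\<Sum>k\<in>S. (?g y k)\<^sup>2) / 4)) \<partial>gauss n \<mu>) =
     (\<integral>\<^sup>+y. \<integral>\<^sup>+\<xi>. ennreal (exp (\<Sum>k\<in>S. \<xi> k * ?g y k / sqrt 2)) \<partial>PiM S ?N \<partial>gauss n \<mu>)"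
    by (simp only: 1)
  also have "\<dots> = (\<integral>\<^sup>+\<xi>. \<integral>\<^sup>+y. ennreal (exp (\<Sum>k\<in>S. \<xi> k * ?g y k / sqrt 2)) \<partial>gauss n \<mu> \<partial>PiM S ?N)"
    by (intro PG.Fubini') (simp add: dot_def split_beta')
  also have "\<dots> \<le> (\<integral>\<^sup>+\<xi>. (\<Prod>k\<in>S. ennreal (exp ((\<xi> k)\<^sup>2 / 4))) \<partial>PiM S ?N)"
    by (intro nn_integral_mono 2)
  also have "\<dots> = (\<Prod>k\<in>S. \<integral>\<^sup>+\<xi>. ennreal (exp (\<xi>\<^sup>2 / 4)) \<partial>?N k)"
    using S by (intro N.product_nn_integral_prod) auto
  also have "\<dots> = ennreal (sqrt 2 ^ card S)"
    by (simp add: nn_integral_normal_exp_square ennreal_power)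
  also have "\<dots> \<le> ennreal (2 ^ card S)"
    by (intro ennreal_leI power_mono) (auto simp: real_le_lsqrt)
  finally show ?thesis by (simp add: ennreal_power[symmetric])
qed

section \<open>A noise bound uniform over all supports\<close>

lemma mat_vec_subset:
  assumes "S \<subseteq> {..<p}" "\<And>j. j < p \<Longrightarrow> j \<notin> S \<Longrightarrow> b j = 0"
  shows "mat_vec p X b = (\<lambda>i. \<Sum>j\<in>S. b j * X i j)"
proof
  fix i
  have "(\<Sum>j<p. X i j * b j) = (\<Sum>j\<in>S. X i j * b j)"
    using assms by (intro sum.mono_neutral_right) auto
  then show "mat_vec p X b i = (\<Sum>j\<in>S. b j * X i j)"
    by (simp add: mat_vec_def mult.commute)
qed

lemma sum_Pow_power_card:
  fixes c :: "'a::comm_semiring_1"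
  assumes "finite A"
  shows "(\<Sum>S\<in>Pow A. c ^ card S) = (1 + c) ^ card A"
  using prod_add[OF assms, of "\<lambda>_. c" "\<lambda>_. 1"] by (simp add: add.commute)

lemma sum_Pow_card:
  fixes g :: "nat \<Rightarrow> 'a::semiring_1"
  assumes "finite A"
  shows "(\<Sum>S\<in>Pow A. g (card S)) = (\<Sum>s\<le>card A. of_nat (card A choose s) * g s)"
proof -
  have "(\<Sum>S\<in>Pow A. g (card S)) = (\<Sum>s\<le>card A. \<Sum>S | S \<in> Pow A \<and> card S = s. g (card S))"
    using assms by (intro sum.group[symmetric]) (auto intro: card_mono)
  also have "\<dots> = (\<Sum>s\<le>card A. of_nat (card A choose s) * g s)"
  proof (intro sum.cong refl)
    fix s
    have "{S. S \<in> Pow A \<and> card S = s} = {S. S \<subseteq> A \<and> card S = s}" by auto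
    then show "(\<Sum>S | S \<in> Pow A \<and> card S = s. g (card S)) = of_nat (card A choose s) * g s"
      using assms by (simp add: n_subsets)
  qed
  finally show ?thesis .
qed

text \<open>A bound on the squared projection of \<open>z\<close> onto the span of the columns in S,
  phrased without projections. Any S containing the support of b may be used.\<close>

definition noise_ok :: "nat \<Rightarrow> nat \<Rightarrow> (nat \<Rightarrow> nat \<Rightarrow> real) \<Rightarrow> (nat \<Rightarrow> real) \<Rightarrow> bool" where
  "noise_ok n p X z \<longleftrightarrow> (\<forall>S b. S \<subseteq> {..<p} \<longrightarrow> (\<forall>j<p. j \<notin> S \<longrightarrow> b j = 0) \<longrightarrow>
     (dot n z (mat_vec p X b))\<^sup>2 \<le> 16 * real (card S) * ln (real p) * (norm2 n (mat_vec p X b))\<^sup>2)"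

text \<open>\<open>bad\<close> is a measurable majorant of the indicator of failure, which is
  Markov's inequality kept in integrated form. It is a sum of nonnegative terms over supports, so
  \<open>bad y < 1\<close> controls every support at once.\<close>

lemma gauss_noise_bound:
  fixes p :: nat and X :: "nat \<Rightarrow> nat \<Rightarrow> real"
  assumes p: "p \<ge> 2"
  obtains bad :: "(nat \<Rightarrow> real) \<Rightarrow> real" where
    "bad \<in> borel_measurable (gauss n \<mu>)" "\<And>y. 0 \<le> bad y"
    "(\<integral>\<^sup>+y. ennreal (bad y) \<partial>gauss n \<mu>) \<le> ennreal ((1 + 2 / real p ^ 4) ^ p - 1)"
    "\<And>y. bad y < 1 \<Longrightarrow> noise_ok n p X (\<lambda>i. y i - \<mu> i)"
proof -
  define ortho where "ortho S u \<longleftrightarrow> (\<forall>j\<in>S. dot n (u j) (u j) \<in> {0, 1}) \<and>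
      (\<forall>j\<in>S. \<forall>k\<in>S. j \<noteq> k \<longrightarrow> dot n (u j) (u k) = 0) \<and>
      (\<forall>j\<in>S. \<exists>c. \<forall>i<n. X i j = (\<Sum>k\<in>S. c k * u k i))" for S u
  \<comment> \<open>One orthogonal system is fixed per support, independently of the data, so that
    each \<open>Q S\<close> is measurable.\<close>
  define u where "u S = (SOME u. ortho S u)" for S
  have u: "ortho S (u S)" if "S \<subseteq> {..<p}" for S
  proof -
    have "\<exists>u. ortho S u" unfolding ortho_def
      using that by (intro Gram_Schmidt) (rule finite_subset, auto)
    then show ?thesis unfolding u_def by (rule someI_ex)
  qed
  have u1: "dot n (u S j) (u S j) \<in> {0, 1}" if "S \<subseteq> {..<p}" "j \<in> S" for S j
    using u[OF that(1)] that(2) unfolding ortho_def by blast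
  have u2: "dot n (u S j) (u S k) = 0" if "S \<subseteq> {..<p}" "j \<in> S" "k \<in> S" "j \<noteq> k" for S j k
    using u[OF that(1)] that(2-) unfolding ortho_def by blast
  have u3: "\<exists>c. \<forall>i<n. X i j = (\<Sum>k\<in>S. c k * u S k i)" if "S \<subseteq> {..<p}" "j \<in> S" for S j
    using u[OF that(1)] that(2) unfolding ortho_def by blast
  define Q where "Q S y = (\<Sum>k\<in>S. (dot n (\<lambda>i. y i - \<mu> i) (u S k))\<^sup>2)" for S y
  \<comment> \<open>The weight p^(-4 |S|) makes the moments 2^|S| summable over all supports. The
    empty set is left out since it alone would contribute 1.\<close>
  define bad where "bad y = (\<Sum>S\<in>Pow {..<p} - {{}}. exp (Q S y / 4) / (real p ^ 4) ^ card S)" for y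
  have [measurable]: "Q S \<in> borel_measurable (gauss n \<mu>)" for S unfolding Q_def by measurable
  have p0: "real p > 0" using p by simp
  show ?thesis
  proof (rule that[of bad])
    show "bad \<in> borel_measurable (gauss n \<mu>)" unfolding bad_def by measurable
    show "0 \<le> bad y" for y unfolding bad_def by (intro sum_nonneg) auto
    have "(\<integral>\<^sup>+y. ennreal (bad y) \<partial>gauss n \<mu>) =
      (\<integral>\<^sup>+y. (\<Sum>S\<in>Pow {..<p} - {{}}. ennreal (1 / (real p ^ 4) ^ card S) * ennreal (exp (Q S y / 4))) \<partial>gauss n \<mu>)"
      unfolding bad_def by (intro nn_integral_cong) (simp add: ennreal_mult[symmetric] sum_ennreal)
    also have "\<dots> = (\<Sum>S\<in>Pow {..<p} - {{}}. ennreal (1 / (real p ^ 4) ^ card S) *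
        (\<integral>\<^sup>+y. ennreal (exp (Q S y / 4)) \<partial>gauss n \<mu>))"
      by (subst nn_integral_sum; (simp add: nn_integral_cmult)?)
    also have "\<dots> \<le> (\<Sum>S\<in>Pow {..<p} - {{}}. ennreal (1 / (real p ^ 4) ^ card S) * ennreal (2 ^ card S))"
    proof (intro sum_mono mult_left_mono)
      fix S assume "S \<in> Pow {..<p} - {{}}"
      then have "S \<subseteq> {..<p}" "finite S" using finite_subset by auto
      then show "(\<integral>\<^sup>+y. ennreal (exp (Q S y / 4)) \<partial>gauss n \<mu>) \<le> ennreal (2 ^ card S)"
        unfolding Q_def using nn_integral_gauss_chi_square[of S n "u S" \<mu>] u1 u2
        by (simp add: ennreal_power[symmetric])
    qed simp
    also have "\<dots> = ennreal (\<Sum>S\<in>Pow {..<p} - {{}}. (2 / real p ^ 4) ^ card S)"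
      by (subst sum_ennreal[symmetric]) (auto simp: ennreal_mult[symmetric] power_divide)
    also have "(\<Sum>S\<in>Pow {..<p} - {{}}. (2 / real p ^ 4) ^ card S) = (1 + 2 / real p ^ 4) ^ p - 1"
      by (subst sum_diff) (auto simp: sum_Pow_power_card)
    finally show "(\<integral>\<^sup>+y. ennreal (bad y) \<partial>gauss n \<mu>) \<le> ennreal ((1 + 2 / real p ^ 4) ^ p - 1)" .
  next
    fix y assume y: "bad y < 1"
    show "noise_ok n p X (\<lambda>i. y i - \<mu> i)" unfolding noise_ok_def
    proof (intro allI impI)
      fix S and b :: "nat \<Rightarrow> real" assume S: "S \<subseteq> {..<p}" and b: "\<forall>j<p. j \<notin> S \<longrightarrow> b j = 0"
      have fS: "finite S" using S finite_subset by auto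
      have eq: "mat_vec p X b = (\<lambda>i. \<Sum>j\<in>S. b j * X i j)" using mat_vec_subset[OF S] b by blast
      have "Q S y \<le> 16 * real (card S) * ln (real p)"
      proof (cases "S = {}")
        case False
        have "exp (Q S y / 4) / (real p ^ 4) ^ card S \<le> bad y"
          unfolding bad_def using S False by (intro member_le_sum) auto
        then have "exp (Q S y / 4) / (real p ^ 4) ^ card S < 1" using y by linarith
        then have "exp (Q S y / 4) < (real p ^ 4) ^ card S" using p0 by (simp add: divide_less_eq)
        then have "ln (exp (Q S y / 4)) < ln ((real p ^ 4) ^ card S)"
          using p0 by (subst ln_less_cancel_iff) auto
        then have "Q S y / 4 < real (card S) * (4 * ln (real p))"
          using p0 by (simp add: ln_realpow)
        then show ?thesis by simp
      qed (simp add: Q_def)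
      moreover have "(dot n (\<lambda>i. y i - \<mu> i) (mat_vec p X b))\<^sup>2 \<le> Q S y * (norm2 n (mat_vec p X b))\<^sup>2"
        unfolding eq Q_def using S u1 u2 u3 by (intro dot_span_le[OF fS]) auto
      ultimately show "(dot n (\<lambda>i. y i - \<mu> i) (mat_vec p X b))\<^sup>2
          \<le> 16 * real (card S) * ln (real p) * (norm2 n (mat_vec p X b))\<^sup>2"
        by (meson mult_right_mono order_trans zero_le_power2)
    qed
  qed
qed

subsection \<open>The spike-and-slab prior\<close>

text \<open>Two mirrored exponential densities; both count at the origin, hence the argument up to
  null sets.\<close>

lemma nn_integral_exp_abs:
  assumes c: "c > 0"
  shows "(\<integral>\<^sup>+x. ennreal (exp (- c * \<bar>x - a\<bar>)) \<partial>lborel) = ennreal (2 / c)"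
proof -
  have 1: "(\<integral>\<^sup>+x. ennreal (exponential_density c x) \<partial>lborel) = 1"
    using prob_space.emeasure_space_1[OF prob_space_exponential_density[OF c]]
    by (simp add: emeasure_density)
  have "(\<integral>\<^sup>+x. ennreal (exp (- c * \<bar>x - a\<bar>)) \<partial>lborel) = (\<integral>\<^sup>+x. ennreal (exp (- c * \<bar>x\<bar>)) \<partial>lborel)"
    using nn_integral_real_affine[of "\<lambda>x. ennreal (exp (- c * \<bar>x - a\<bar>))" 1 a] by simp
  also have "\<dots> = (\<integral>\<^sup>+x. ennreal (1 / c) * (ennreal (exponential_density c x) + ennreal (exponential_density c (- x))) \<partial>lborel)"
  proof (intro nn_integral_cong_AE)
    have "AE x in lborel. (x::real) \<noteq> 0" by (rule AE_lborel_singleton)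
    then show "AE x in lborel. ennreal (exp (- c * \<bar>x\<bar>)) =
      ennreal (1 / c) * (ennreal (exponential_density c x) + ennreal (exponential_density c (- x)))"
      by eventually_elim (use c in \<open>auto simp: exponential_density_def ennreal_mult[symmetric] mult.commute\<close>)
  qed
  also have "\<dots> = ennreal (1 / c) * ((\<integral>\<^sup>+x. ennreal (exponential_density c x) \<partial>lborel) +
      (\<integral>\<^sup>+x. ennreal (exponential_density c (- x)) \<partial>lborel))"
    by (subst nn_integral_cmult; simp add: nn_integral_add)
  also have "(\<integral>\<^sup>+x. ennreal (exponential_density c (- x)) \<partial>lborel) = 1"
    using nn_integral_real_affine[of "\<lambda>x. ennreal (exponential_density c x)" "-1" 0] 1 by simp
  also have "ennreal (1 / c) * ((\<integral>\<^sup>+x. ennreal (exponential_density c x) \<partial>lborel) + 1) = ennreal (2 / c)"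
    unfolding 1 using c by (simp add: ennreal_plus[symmetric] ennreal_mult'[symmetric] flip: ennreal_1 ennreal_numeral del: ennreal_plus)
  finally show ?thesis .
qed

lemma sets_laplace [simp, measurable_cong]: "sets (laplace l) = sets borel"
  by (simp add: laplace_def)

lemma nn_integral_laplace:
  "f \<in> borel_measurable borel \<Longrightarrow>
    (\<integral>\<^sup>+x. f x \<partial>laplace l) = (\<integral>\<^sup>+x. ennreal (l / 2 * exp (- l * \<bar>x\<bar>)) * f x \<partial>lborel)"
  unfolding laplace_def by (subst nn_integral_density) auto

lemma prob_space_laplace:
  assumes l: "l > 0"
  shows "prob_space (laplace l)"
proof
  have "emeasure (laplace l) (space (laplace l)) = (\<integral>\<^sup>+x. 1 \<partial>laplace l)" by simp
  also have "\<dots> = (\<integral>\<^sup>+x. ennreal (l / 2) * ennreal (exp (- l * \<bar>x - 0\<bar>)) \<partial>lborel)"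
    using l by (subst nn_integral_laplace) (auto simp: ennreal_mult[symmetric])
  also have "\<dots> = ennreal (l / 2) * ennreal (2 / l)"
    by (subst nn_integral_cmult) (auto simp only: nn_integral_exp_abs[OF l], measurable)
  also have "\<dots> = 1" using l by (simp add: ennreal_mult[symmetric])
  finally show "emeasure (laplace l) (space (laplace l)) = 1" .
qed

section \<open>The prior as a finite mixture over supports\<close>

definition coord :: "real \<Rightarrow> nat set \<Rightarrow> nat \<Rightarrow> real measure" where
  "coord l S i = (if i \<in> S then laplace l else return lborel 0)"

definition model :: "nat \<Rightarrow> real \<Rightarrow> nat set \<Rightarrow> (nat \<Rightarrow> real) measure" where
  "model p l S = PiM {..<p} (coord l S)"

abbreviation vecM :: "nat \<Rightarrow> (nat \<Rightarrow> real) measure" where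
  "vecM p \<equiv> PiM {..<p} (\<lambda>_. borel)"

lemma sets_coord [simp, measurable_cong]: "sets (coord l S i) = sets borel"
  by (simp add: coord_def)

lemma space_coord [simp]: "space (coord l S i) = UNIV"
  using sets_eq_imp_space_eq[OF sets_coord] by simp

lemma prob_space_coord: "l > 0 \<Longrightarrow> prob_space (coord l S i)"
  by (simp add: coord_def prob_space_laplace prob_space_return)

lemma sets_model [simp, measurable_cong]: "sets (model p l S) = sets (vecM p)"
  unfolding model_def by (intro sets_PiM_cong) auto

lemma prob_space_model: "l > 0 \<Longrightarrow> prob_space (model p l S)"
  unfolding model_def by (intro prob_space_PiM prob_space_coord)

lemma product_sigma_finite_coord: "l > 0 \<Longrightarrow> product_sigma_finite (coord l S)"
  unfolding product_sigma_finite_def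
  by (intro allI prob_space_imp_sigma_finite prob_space_coord)

lemma prior_eq: "prior p l \<pi> = measure_pmf (subset_pmf p \<pi>) \<bind> model p l"
  unfolding prior_def model_def coord_def ..

lemma measurable_model: "l > 0 \<Longrightarrow> model p l \<in> measurable (measure_pmf Q) (subprob_algebra (vecM p))"
  by (simp add: space_subprob_algebra prob_space_imp_subprob_space prob_space_model)

lemma sets_prior [simp, measurable_cong]: "sets (prior p l \<pi>) = sets (vecM p)"
  unfolding prior_eq by (rule sets_bind) auto

lemma prob_space_prior: "l > 0 \<Longrightarrow> prob_space (prior p l \<pi>)"
  unfolding prior_eq
  by (rule measure_pmf.prob_space_bind[OF _ measurable_model]) (auto simp: prob_space_model)

definition weight :: "nat \<Rightarrow> nat pmf \<Rightarrow> nat set \<Rightarrow> real" where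
  "weight p \<pi> S = pmf \<pi> (card S) / real (p choose card S)"

lemma weight_nonneg: "0 \<le> weight p \<pi> S" by (simp add: weight_def)

text \<open>Sizes above p would ask for a uniform choice from an empty family, whose value is
  unspecified; the support condition on \<open>\<pi>\<close> rules this out.\<close>

lemma pmf_subset_pmf:
  assumes \<pi>: "set_pmf \<pi> \<subseteq> {0..p}" and S: "S \<subseteq> {..<p}"
  shows "pmf (subset_pmf p \<pi>) S = weight p \<pi> S"
proof -
  have cS: "card S \<le> p" using S by (metis card_lessThan card_mono finite_lessThan)
  have eq: "pmf (pmf_of_set {S. S \<subseteq> {..<p} \<and> card S = s}) S = (if s = card S then 1 / real (p choose s) else 0)"
    if "s \<le> p" for s
  proof -
    have "card {S. S \<subseteq> {..<p} \<and> card S = s} = p choose s"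
      using n_subsets[of "{..<p}" s] by simp
    moreover have "finite {S. S \<subseteq> {..<p} \<and> card S = s}" by (rule finite_subset[of _ "Pow {..<p}"]) auto
    moreover have "{S. S \<subseteq> {..<p} \<and> card S = s} \<noteq> {}"
      using calculation that by (metis card.empty zero_less_binomial_iff not_gr_zero)
    ultimately show ?thesis using S by (subst pmf_of_set) (auto simp: indicator_def)
  qed
  have "ennreal (pmf (subset_pmf p \<pi>) S) =
     (\<integral>\<^sup>+s. ennreal (pmf (pmf_of_set {S. S \<subseteq> {..<p} \<and> card S = s}) S) \<partial>measure_pmf \<pi>)"
    unfolding subset_pmf_def by (rule ennreal_pmf_bind)
  also have "\<dots> = (\<integral>\<^sup>+s. (if s = card S then ennreal (1 / real (p choose s)) else 0) \<partial>measure_pmf \<pi>)"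
  proof (intro nn_integral_cong_AE, unfold AE_measure_pmf_iff, intro ballI)
    fix s assume "s \<in> set_pmf \<pi>"
    then have "s \<le> p" using \<pi> by auto
    then show "ennreal (pmf (pmf_of_set {S. S \<subseteq> {..<p} \<and> card S = s}) S) =
        (if s = card S then ennreal (1 / real (p choose s)) else 0)"
      by (simp only: eq) simp
  qed
  also have "\<dots> = (\<Sum>s\<in>{card S}. (if s = card S then ennreal (1 / real (p choose s)) else 0) * ennreal (pmf \<pi> s))"
    by (rule nn_integral_measure_pmf_support) auto
  also have "\<dots> = ennreal (weight p \<pi> S)"
    by (simp add: weight_def ennreal_mult[symmetric])
  finally show ?thesis by (simp add: weight_nonneg)
qed

text \<open>The form in which the prior is used from here on: a finite sum over supports of
  product-measure integrals.\<close>

lemma nn_integral_prior: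
  assumes \<pi>: "set_pmf \<pi> \<subseteq> {0..p}" and l: "l > 0" and f: "f \<in> borel_measurable (vecM p)"
  shows "(\<integral>\<^sup>+\<beta>. f \<beta> \<partial>prior p l \<pi>) = (\<Sum>S\<in>Pow {..<p}. ennreal (weight p \<pi> S) * (\<integral>\<^sup>+\<beta>. f \<beta> \<partial>model p l S))"
proof -
  have fin: "finite {S. S \<subseteq> {..<p} \<and> card S = s}" for s by (rule finite_subset[of _ "Pow {..<p}"]) auto
  have ne: "{S. S \<subseteq> {..<p} \<and> card S = s} \<noteq> {}" if "s \<le> p" for s
  proof -
    have "card {..<s} = s" "{..<s} \<subseteq> {..<p}" using that by auto
    then show ?thesis by blast
  qed
  have supp: "set_pmf (subset_pmf p \<pi>) \<subseteq> Pow {..<p}"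
    unfolding subset_pmf_def using \<pi> fin ne by (fastforce simp: set_pmf_of_set)
  have "(\<integral>\<^sup>+\<beta>. f \<beta> \<partial>prior p l \<pi>) = (\<integral>\<^sup>+S. \<integral>\<^sup>+\<beta>. f \<beta> \<partial>model p l S \<partial>measure_pmf (subset_pmf p \<pi>))"
    unfolding prior_eq by (rule nn_integral_bind[OF f measurable_model[OF l]])
  also have "\<dots> = (\<Sum>S\<in>Pow {..<p}. (\<integral>\<^sup>+\<beta>. f \<beta> \<partial>model p l S) * ennreal (pmf (subset_pmf p \<pi>) S))"
  proof -
    have "(\<integral>\<^sup>+S. \<integral>\<^sup>+\<beta>. f \<beta> \<partial>model p l S \<partial>measure_pmf (subset_pmf p \<pi>)) =
      (\<integral>\<^sup>+S. (\<integral>\<^sup>+\<beta>. f \<beta> \<partial>model p l S) * indicator (Pow {..<p}) S \<partial>measure_pmf (subset_pmf p \<pi>))"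
      using supp by (intro nn_integral_cong_AE) (auto simp: AE_measure_pmf_iff)
    also have "\<dots> = (\<Sum>S\<in>Pow {..<p}. ((\<integral>\<^sup>+\<beta>. f \<beta> \<partial>model p l S) * indicator (Pow {..<p}) S) * ennreal (pmf (subset_pmf p \<pi>) S))"
      by (rule nn_integral_measure_pmf_support) (use supp in auto)
    finally show ?thesis by (simp add: indicator_def)
  qed
  finally show ?thesis
    using pmf_subset_pmf[OF \<pi>] by (simp add: mult.commute)
qed

lemma AE_model:
  assumes l: "l > 0"
  shows "AE \<beta> in model p l S. \<forall>i<p. i \<notin> S \<longrightarrow> \<beta> i = 0"
proof -
  have "AE \<beta> in model p l S. i \<notin> S \<longrightarrow> \<beta> i = 0" if "i < p" for i
  proof (cases "i \<in> S")
    case False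
    have "AE x in coord l S i. x = 0" using False unfolding coord_def by (simp, subst AE_return) auto
    then have "AE \<beta> in model p l S. \<beta> i = 0"
      unfolding model_def using that by (intro AE_PiM_component prob_space_coord l) auto
    then show ?thesis by eventually_elim simp
  qed simp
  then have "AE \<beta> in model p l S. \<forall>i\<in>{..<p}. i \<notin> S \<longrightarrow> \<beta> i = 0"
    by (intro AE_finite_allI) auto
  then show ?thesis by eventually_elim auto
qed

subsection \<open>Likelihood and posterior\<close>

lemma mat_vec_diff: "mat_vec p X (\<lambda>j. \<beta> j - \<beta>0 j) = (\<lambda>i. mat_vec p X \<beta> i - mat_vec p X \<beta>0 i)"
  by (simp add: mat_vec_def sum_subtractf algebra_simps)

lemma lik_pos: "0 < lik n p X Y \<beta>" by (simp add: lik_def)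

lemma lik_le_1: "lik n p X Y \<beta> \<le> 1" by (simp add: lik_def)

text \<open>Expanding |z - v|^2 with \<open>z\<close> the noise and \<open>v\<close> the image of
  the error. The factor at \<open>\<beta>0\<close> later cancels between numerator and
  evidence.\<close>

lemma lik_ratio:
  "lik n p X Y \<beta> = lik n p X Y \<beta>0 *
     exp (dot n (\<lambda>i. Y i - mat_vec p X \<beta>0 i) (mat_vec p X (\<lambda>j. \<beta> j - \<beta>0 j))
          - (norm2 n (mat_vec p X (\<lambda>j. \<beta> j - \<beta>0 j)))\<^sup>2 / 2)"
proof -
  define z where "z = (\<lambda>i. Y i - mat_vec p X \<beta>0 i)"
  define v where "v = mat_vec p X (\<lambda>j. \<beta> j - \<beta>0 j)"
  have "(\<lambda>i. Y i - mat_vec p X \<beta> i) = (\<lambda>i. z i - v i)"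
    by (simp add: z_def v_def mat_vec_diff)
  then have "(norm2 n (\<lambda>i. Y i - mat_vec p X \<beta> i))\<^sup>2 = dot n z z - 2 * dot n z v + dot n v v"
    by (simp add: norm2_power2 dot_diff_left dot_diff_right dot_commute[of n v z])
  moreover have "(norm2 n (\<lambda>i. Y i - mat_vec p X \<beta>0 i))\<^sup>2 = dot n z z"
    by (simp add: norm2_power2 z_def)
  ultimately show ?thesis
    unfolding lik_def z_def[symmetric] v_def[symmetric] norm2_power2 exp_add[symmetric]
    by (simp add: field_simps)
qed

lemma measurable_mat_vec [measurable]:
  "(\<lambda>\<beta>. mat_vec p X (\<lambda>j. \<beta> j - \<beta>0 j) i) \<in> borel_measurable (vecM p)"
  unfolding mat_vec_def by measurable

lemma measurable_norm2_mat_vec [measurable]: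
  "(\<lambda>\<beta>. norm2 n (mat_vec p X (\<lambda>j. \<beta> j - \<beta>0 j))) \<in> borel_measurable (vecM p)"
  unfolding norm2_def by measurable

lemma measurable_norm1 [measurable]:
  "(\<lambda>\<beta>. norm1 p (\<lambda>j. \<beta> j - \<beta>0 j)) \<in> borel_measurable (vecM p)"
  unfolding norm1_def by measurable

lemma measurable_norm1' [measurable]: "norm1 p \<in> borel_measurable (vecM p)"
  unfolding norm1_def by measurable

lemma measurable_dot_mat_vec [measurable]:
  "(\<lambda>\<beta>. dot n z (mat_vec p X (\<lambda>j. \<beta> j - \<beta>0 j))) \<in> borel_measurable (vecM p)"
  unfolding dot_def by measurable

lemma measurable_lik [measurable]: "lik n p X Y \<in> borel_measurable (vecM p)"
  unfolding lik_def norm2_def mat_vec_def by measurable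

section \<open>Marginal likelihoods and expected posterior mass\<close>

text \<open>The unnormalised posterior, valued in \<open>ennreal\<close> so that monotonicity in the
  set holds without measurability or integrability side conditions.\<close>

definition marginal :: "nat \<Rightarrow> nat \<Rightarrow> (nat \<Rightarrow> nat \<Rightarrow> real) \<Rightarrow> real \<Rightarrow> nat pmf \<Rightarrow> (nat \<Rightarrow> real) \<Rightarrow>
    (nat \<Rightarrow> real) set \<Rightarrow> ennreal" where
  "marginal n p X l \<pi> Y B = (\<integral>\<^sup>+\<beta>. indicator B \<beta> * ennreal (lik n p X Y \<beta>) \<partial>prior p l \<pi>)"

lemma marginal_mono: "A \<subseteq> B \<Longrightarrow> marginal n p X l \<pi> Y A \<le> marginal n p X l \<pi> Y B"
  unfolding marginal_def by (intro nn_integral_mono mult_right_mono) (auto simp: indicator_def)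

lemma marginal_UNIV: "marginal n p X l \<pi> Y UNIV = (\<integral>\<^sup>+\<beta>. ennreal (lik n p X Y \<beta>) \<partial>prior p l \<pi>)"
  by (simp add: marginal_def)

lemma marginal_UNIV_finite:
  assumes "l > 0" shows "marginal n p X l \<pi> Y UNIV < \<infinity>"
proof -
  interpret prob_space "prior p l \<pi>" by (rule prob_space_prior[OF assms])
  have "marginal n p X l \<pi> Y UNIV \<le> (\<integral>\<^sup>+\<beta>. 1 \<partial>prior p l \<pi>)"
    unfolding marginal_UNIV by (intro nn_integral_mono) (simp add: lik_le_1)
  also have "\<dots> = 1" by (simp add: emeasure_space_1)
  finally show ?thesis by (simp add: le_less_trans[OF _ ennreal_one_less_top])
qed

lemma marginal_UNIV_pos:
  assumes "l > 0" shows "marginal n p X l \<pi> Y UNIV > 0"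
proof -
  interpret prob_space "prior p l \<pi>" by (rule prob_space_prior[OF assms])
  have "marginal n p X l \<pi> Y UNIV \<noteq> 0"
  proof
    assume "marginal n p X l \<pi> Y UNIV = 0"
    then have "AE \<beta> in prior p l \<pi>. ennreal (lik n p X Y \<beta>) = 0"
      unfolding marginal_UNIV by (subst (asm) nn_integral_0_iff_AE) auto
    then have "AE \<beta> in prior p l \<pi>. False"
      by eventually_elim (use lik_pos in \<open>auto simp: ennreal_eq_0_iff not_le[symmetric]\<close>)
    then show False by simp
  qed
  then show ?thesis by (simp add: zero_less_iff_neq_zero)
qed

text \<open>A non-integrable function has Bochner integral 0, so the inequality survives for
  arbitrary sets in the posterior.\<close>

lemma integral_le_enn2real_nn_integral:
  fixes f :: "'a \<Rightarrow> real"
  assumes "\<And>x. 0 \<le> f x"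
  shows "integral\<^sup>L M f \<le> enn2real (\<integral>\<^sup>+x. ennreal (f x) \<partial>M)"
proof (cases "integrable M f")
  case True
  then show ?thesis using integral_eq_nn_integral[of f M] assms by simp
qed (simp add: not_integrable_integral_eq)

lemma posterior_nonneg: "0 \<le> posterior n p X l \<pi> Y B"
  unfolding posterior_def using lik_pos
  by (intro divide_nonneg_nonneg Bochner_Integration.integral_nonneg mult_nonneg_nonneg)
    (auto simp: less_imp_le)

text \<open>The only passage from \<open>marginal\<close> to \<open>posterior\<close>: a bound by a
  multiple of the evidence, which is positive and finite, can be divided out.\<close>

lemma posterior_le:
  assumes l: "l > 0" and g: "marginal n p X l \<pi> Y B \<le> g * marginal n p X l \<pi> Y UNIV"
  shows "ennreal (posterior n p X l \<pi> Y B) \<le> g"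
proof (cases "g = \<infinity>")
  case False
  define e where "e = marginal n p X l \<pi> Y UNIV"
  have e: "0 < e" "e < \<infinity>"
    unfolding e_def using marginal_UNIV_pos[OF l] marginal_UNIV_finite[OF l] by auto
  obtain c where c: "g = ennreal c" "0 \<le> c" using False by (cases g) auto
  have "(\<integral>\<beta>. indicator B \<beta> * lik n p X Y \<beta> \<partial>prior p l \<pi>) \<le>
      enn2real (\<integral>\<^sup>+\<beta>. ennreal (indicator B \<beta> * lik n p X Y \<beta>) \<partial>prior p l \<pi>)"
    by (intro integral_le_enn2real_nn_integral) (simp add: less_imp_le[OF lik_pos])
  also have "(\<integral>\<^sup>+\<beta>. ennreal (indicator B \<beta> * lik n p X Y \<beta>) \<partial>prior p l \<pi>) = marginal n p X l \<pi> Y B"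
    unfolding marginal_def by (intro nn_integral_cong) (auto simp: indicator_def)
  also have "enn2real (marginal n p X l \<pi> Y B) \<le> enn2real (ennreal c * e)"
    using g e unfolding c e_def[symmetric]
    by (intro enn2real_mono) (auto simp: ennreal_mult_less_top)
  also have "\<dots> = c * enn2real e" using c by (simp add: enn2real_mult)
  finally have "(\<integral>\<beta>. indicator B \<beta> * lik n p X Y \<beta> \<partial>prior p l \<pi>) \<le> c * enn2real e" .
  moreover have "(\<integral>\<beta>. lik n p X Y \<beta> \<partial>prior p l \<pi>) = enn2real e"
    unfolding e_def marginal_UNIV by (rule integral_eq_nn_integral) (auto simp: less_imp_le[OF lik_pos])
  moreover have "0 < enn2real e" using e by (simp add: enn2real_positive_iff)
  ultimately have "posterior n p X l \<pi> Y B \<le> c"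
    unfolding posterior_def by (simp add: divide_le_eq)
  then show ?thesis unfolding c by (rule ennreal_leI)
qed simp

lemma posterior_le_1:
  assumes "l > 0" shows "posterior n p X l \<pi> Y B \<le> 1"
  using posterior_le[OF assms, of n p X \<pi> Y B 1] marginal_mono[of B UNIV] by simp

lemma prob_space_data_law: "prob_space (data_law n p X \<beta>0)"
  unfolding data_law_def by (rule prob_space_gauss)

lemma post_risk_nonneg: "0 \<le> post_risk n p X l \<pi> \<beta>0 B"
  unfolding post_risk_def by (intro Bochner_Integration.integral_nonneg posterior_nonneg)

lemma post_risk_le:
  assumes "\<And>Y. ennreal (posterior n p X l \<pi> Y B) \<le> g Y"
    and "(\<integral>\<^sup>+Y. g Y \<partial>data_law n p X \<beta>0) \<le> ennreal \<epsilon>" "0 \<le> \<epsilon>"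
  shows "post_risk n p X l \<pi> \<beta>0 B \<le> \<epsilon>"
proof -
  have "(\<integral>\<^sup>+Y. ennreal (posterior n p X l \<pi> Y B) \<partial>data_law n p X \<beta>0) \<le> ennreal \<epsilon>"
    by (rule order_trans[OF nn_integral_mono assms(2)]) (rule assms(1))
  then have "enn2real (\<integral>\<^sup>+Y. ennreal (posterior n p X l \<pi> Y B) \<partial>data_law n p X \<beta>0) \<le> \<epsilon>"
    using assms(3) by (simp add: enn2real_leI)
  then show ?thesis unfolding post_risk_def
    using integral_le_enn2real_nn_integral[of "\<lambda>Y. posterior n p X l \<pi> Y B" "data_law n p X \<beta>0"]
    by (simp add: posterior_nonneg)
qed

text \<open>Fubini moves the data average inside, where it is a Gaussian moment generating function.
  With c = 1 - \<delta> this yields the gain; with c = 1 it shows that likelihood ratios average to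
  1.\<close>

lemma nn_integral_data_law_exp:
  assumes K: "sigma_finite_measure K" "sets K = sets (vecM p)" and f [measurable]: "f \<in> borel_measurable (vecM p)"
  shows "(\<integral>\<^sup>+Y. \<integral>\<^sup>+\<beta>. f \<beta> * ennreal (exp (c * dot n (\<lambda>i. Y i - mat_vec p X \<beta>0 i) (mat_vec p X (\<lambda>j. \<beta> j - \<beta>0 j)))) \<partial>K
       \<partial>data_law n p X \<beta>0) =
     (\<integral>\<^sup>+\<beta>. f \<beta> * ennreal (exp (c\<^sup>2 * (norm2 n (mat_vec p X (\<lambda>j. \<beta> j - \<beta>0 j)))\<^sup>2 / 2)) \<partial>K)"
proof -
  let ?D = "data_law n p X \<beta>0"
  let ?z = "\<lambda>Y i. Y i - mat_vec p X \<beta>0 i" and ?v = "\<lambda>\<beta>. mat_vec p X (\<lambda>j. \<beta> j - \<beta>0 j)"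
  note [measurable_cong] = K(2)
  have [measurable_cong]: "sets ?D = sets (PiM {..<n} (\<lambda>_. borel))"
    unfolding data_law_def by (intro sets_PiM_cong) auto
  interpret D: prob_space ?D by (rule prob_space_data_law)
  interpret K: sigma_finite_measure K by fact
  interpret P: pair_sigma_finite K ?D ..
  have "(\<integral>\<^sup>+Y. \<integral>\<^sup>+\<beta>. f \<beta> * ennreal (exp (c * dot n (?z Y) (?v \<beta>))) \<partial>K \<partial>?D) =
     (\<integral>\<^sup>+\<beta>. \<integral>\<^sup>+Y. f \<beta> * ennreal (exp (c * dot n (?z Y) (?v \<beta>))) \<partial>?D \<partial>K)"
    by (intro P.Fubini') (simp add: dot_def mat_vec_def split_beta')
  also have "\<dots> = (\<integral>\<^sup>+\<beta>. f \<beta> * ennreal (exp (c\<^sup>2 * (norm2 n (?v \<beta>))\<^sup>2 / 2)) \<partial>K)"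
  proof (intro nn_integral_cong)
    fix \<beta>
    have "(\<integral>\<^sup>+Y. f \<beta> * ennreal (exp (c * dot n (?z Y) (?v \<beta>))) \<partial>?D) =
       f \<beta> * (\<integral>\<^sup>+Y. ennreal (exp (dot n (?z Y) (\<lambda>i. c * ?v \<beta> i))) \<partial>?D)"
      by (subst nn_integral_cmult[symmetric]) (auto simp: dot_scale_right dot_def)
    also have "(\<integral>\<^sup>+Y. ennreal (exp (dot n (?z Y) (\<lambda>i. c * ?v \<beta> i))) \<partial>?D) =
       ennreal (exp (c\<^sup>2 * (norm2 n (?v \<beta>))\<^sup>2 / 2))"
      unfolding data_law_def
      by (subst nn_integral_gauss_mgf)
        (simp add: norm2_power2[unfolded power2_eq_square] dot_scale_right dot_scale_left power2_eq_square)
    finally show "(\<integral>\<^sup>+Y. f \<beta> * ennreal (exp (c * dot n (?z Y) (?v \<beta>))) \<partial>?D) =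
       f \<beta> * ennreal (exp (c\<^sup>2 * (norm2 n (?v \<beta>))\<^sup>2 / 2))" .
  qed
  finally show ?thesis .
qed

lemma measurable_nn_integral_data_law:
  assumes K: "sigma_finite_measure K" "sets K = sets (vecM p)" and f [measurable]: "f \<in> borel_measurable (vecM p)"
  shows "(\<lambda>Y. \<integral>\<^sup>+\<beta>. f \<beta> * ennreal (exp (c * dot n (\<lambda>i. Y i - mat_vec p X \<beta>0 i) (mat_vec p X (\<lambda>j. \<beta> j - \<beta>0 j)))) \<partial>K)
       \<in> borel_measurable (data_law n p X \<beta>0)"
proof -
  note [measurable_cong] = K(2)
  have [measurable_cong]: "sets (data_law n p X \<beta>0) = sets (PiM {..<n} (\<lambda>_. borel))"
    unfolding data_law_def by (intro sets_PiM_cong) auto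
  interpret K: sigma_finite_measure K by fact
  show ?thesis unfolding dot_def mat_vec_def by measurable
qed

subsection \<open>A lower bound for the evidence\<close>

lemma norm2_triangle: "norm2 n (\<lambda>i. u i + v i) \<le> norm2 n u + norm2 n v"
  using L2_set_triangle_ineq[of u v "{..<n}"] by (simp add: norm2_def L2_set_def)

lemma colnorm_le_Xnorm: "j < p \<Longrightarrow> colnorm n X j \<le> Xnorm n p X"
  unfolding Xnorm_def by (rule Max_ge) auto

lemma colnorm_nonneg: "0 \<le> colnorm n X j"
  by (simp add: colnorm_def norm2_nonneg)

lemma Xnorm_nonneg: "0 \<le> Xnorm n p X"
  unfolding Xnorm_def by (rule Max_ge) auto

lemma norm2_mat_vec_le: "norm2 n (mat_vec p X b) \<le> Xnorm n p X * norm1 p b"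
proof -
  have "norm2 n (\<lambda>i. \<Sum>j<m. X i j * b j) \<le> (\<Sum>j<m. colnorm n X j * \<bar>b j\<bar>)" for m
  proof (induction m)
    case 0
    show ?case by (simp add: norm2_def)
  next
    case (Suc m)
    have "norm2 n (\<lambda>i. \<Sum>j<Suc m. X i j * b j) \<le> norm2 n (\<lambda>i. \<Sum>j<m. X i j * b j) + norm2 n (\<lambda>i. b m * X i m)"
      using norm2_triangle[of n "\<lambda>i. \<Sum>j<m. X i j * b j" "\<lambda>i. b m * X i m"] by (simp add: mult.commute)
    then show ?case using Suc by (simp add: norm2_scale colnorm_def mult.commute)
  qed
  from this[of p] have "norm2 n (mat_vec p X b) \<le> (\<Sum>j<p. colnorm n X j * \<bar>b j\<bar>)"
    by (simp add: mat_vec_def)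
  also have "\<dots> \<le> (\<Sum>j<p. Xnorm n p X * \<bar>b j\<bar>)"
    by (intro sum_mono mult_right_mono colnorm_le_Xnorm) auto
  finally show ?thesis by (simp add: norm1_def sum_distrib_left)
qed

text \<open>Coordinatewise domination passes to products by splitting off one coordinate at a time.
  It serves to compare the slab prior with a uniform law on a box.\<close>

lemma nn_integral_PiM_mono_scaled:
  assumes M: "product_sigma_finite M" "\<And>i. sets (M i) = sets borel"
    and M': "product_sigma_finite M'" "\<And>i. sets (M' i) = sets borel"
    and le: "\<And>i f. i \<in> I \<Longrightarrow> f \<in> borel_measurable borel \<Longrightarrow>
        c i * (\<integral>\<^sup>+x. f x \<partial>M' i) \<le> (\<integral>\<^sup>+x. f x \<partial>M i)"
    and I: "finite I" and f: "f \<in> borel_measurable (PiM I (\<lambda>_. borel))"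
  shows "(\<Prod>i\<in>I. c i) * (\<integral>\<^sup>+x. f x \<partial>PiM I M') \<le> (\<integral>\<^sup>+x. f x \<partial>PiM I M)"
  using I le f
proof (induction I arbitrary: f)
  case empty
  then show ?case by (simp add: PiM_empty)
next
  case (insert i I)
  note [measurable] = insert.prems(2)
  note [measurable_cong] = M(2) M'(2)
  interpret M: product_sigma_finite M by fact
  interpret M': product_sigma_finite M' by fact
  have sM: "sets (PiM J M) = sets (PiM J (\<lambda>_. borel))" for J by (intro sets_PiM_cong M(2) refl)
  have sM': "sets (PiM J M') = sets (PiM J (\<lambda>_. borel))" for J by (intro sets_PiM_cong M'(2) refl)
  note [measurable_cong] = sM sM'
  have [measurable]: "(\<lambda>z. f ((fst z)(i := snd z))) \<in> borel_measurable (PiM I (\<lambda>_. borel) \<Otimes>\<^sub>M borel)"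
    using measurable_comp[OF measurable_add_dim[of i I "\<lambda>_. borel"] insert.prems(2)]
    by (simp add: comp_def split_beta')
  have m1: "(\<lambda>x. \<integral>\<^sup>+y. f (x(i := y)) \<partial>M i) \<in> borel_measurable (PiM I (\<lambda>_. borel))"
    by (rule sigma_finite_measure.borel_measurable_nn_integral[OF M.sigma_finite_measures]) (simp add: split_beta')
  have m2: "(\<lambda>x. \<integral>\<^sup>+y. f (x(i := y)) \<partial>M' i) \<in> borel_measurable (PiM I (\<lambda>_. borel))"
    by (rule sigma_finite_measure.borel_measurable_nn_integral[OF M'.sigma_finite_measures]) (simp add: split_beta')
  have "(\<Prod>j\<in>insert i I. c j) * (\<integral>\<^sup>+x. f x \<partial>PiM (insert i I) M') =
     (\<Prod>j\<in>I. c j) * (c i * (\<integral>\<^sup>+x. \<integral>\<^sup>+y. f (x(i := y)) \<partial>M' i \<partial>PiM I M'))"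
    using insert.hyps by (subst M'.product_nn_integral_insert) (auto simp: mult_ac)
  also have "\<dots> = (\<Prod>j\<in>I. c j) * (\<integral>\<^sup>+x. c i * (\<integral>\<^sup>+y. f (x(i := y)) \<partial>M' i) \<partial>PiM I M')"
    using m2 by (subst nn_integral_cmult) auto
  also have "\<dots> \<le> (\<Prod>j\<in>I. c j) * (\<integral>\<^sup>+x. (\<integral>\<^sup>+y. f (x(i := y)) \<partial>M i) \<partial>PiM I M')"
  proof (intro mult_left_mono nn_integral_mono)
    fix x assume "x \<in> space (PiM I M')"
    then have "x \<in> space (PiM I (\<lambda>_. borel))" using sets_eq_imp_space_eq[OF sM'] by blast
    then have "(\<lambda>y. f (x(i := y))) \<in> borel_measurable borel" by measurable
    then show "c i * (\<integral>\<^sup>+y. f (x(i := y)) \<partial>M' i) \<le> (\<integral>\<^sup>+y. f (x(i := y)) \<partial>M i)"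
      by (intro insert.prems) auto
  qed simp
  also have "\<dots> \<le> (\<integral>\<^sup>+x. (\<integral>\<^sup>+y. f (x(i := y)) \<partial>M i) \<partial>PiM I M)"
    by (rule insert.IH[OF _ m1]) (rule insert.prems(1), auto)
  also have "\<dots> = (\<integral>\<^sup>+x. f x \<partial>PiM (insert i I) M)"
    using insert.hyps by (subst M.product_nn_integral_insert) auto
  finally show ?case .
qed

text \<open>The reflection y -> 2 a - y preserves the interval and flips the sign of the
  integrand.\<close>

lemma integral_uniform_symmetric:
  assumes r: "r > 0"
  shows "integrable (uniform_measure lborel {a - r..a + r}) (\<lambda>y::real. y - a)"
    and "(\<integral>y. y - a \<partial>uniform_measure lborel {a - r..a + r}) = 0"
proof -
  let ?U = "uniform_measure lborel {a - r..a + r}"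
  have U: "?U = density lborel (\<lambda>y. ennreal (indicator {a - r..a + r} y / (2 * r)))"
    unfolding uniform_measure_def using r
    by (intro density_cong) (auto simp: indicator_def divide_ennreal simp flip: ennreal_1)
  interpret prob_space ?U by (rule prob_space_uniform_measure) (use r in auto)
  have "AE y in ?U. y \<in> {a - r..a + r}"
    by (rule AE_uniform_measureI) auto
  then have "AE y in ?U. norm (y - a) \<le> r" by eventually_elim auto
  then show "integrable ?U (\<lambda>y. y - a)"
    by (intro integrable_const_bound[where B = r]) auto
  define g where "g y = indicator {a - r..a + r} y / (2 * r) * (y - a)" for y :: real
  have "g (2 * a + (-1) * y) = - g y" for y
  proof -
    have "indicator {a - r..a + r} (2 * a + (-1) * y) = (indicator {a - r..a + r} y :: real)"
      by (auto simp: indicator_def)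
    moreover have "2 * a + (-1) * y - a = - (y - a)" by simp
    ultimately show ?thesis unfolding g_def by (simp only: mult_minus_right)
  qed
  then have "(\<integral>y. g y \<partial>lborel) = - (\<integral>y. g y \<partial>lborel)"
    using lborel_integral_real_affine[of "-1" g "2 * a"] by simp
  moreover have "(\<integral>y. y - a \<partial>?U) = (\<integral>y. g y \<partial>lborel)"
    unfolding U g_def using r by (subst integral_real_density) auto
  ultimately show "(\<integral>y. y - a \<partial>?U) = 0" by simp
qed

text \<open>On the interval the Laplace density is at least l / 2 * exp (- l |a| - l r), while the
  uniform density is 1 / (2 r); the factor is their quotient.\<close>

lemma laplace_ge_uniform:
  assumes l: "l > 0" and r: "r > 0" and f [measurable]: "f \<in> borel_measurable borel"
  shows "ennreal (l * r * exp (- l * \<bar>a\<bar> - l * r)) * (\<integral>\<^sup>+y. f y \<partial>uniform_measure lborel {a - r..a + r})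
    \<le> (\<integral>\<^sup>+y. f y \<partial>laplace l)"
proof -
  let ?I = "\<integral>\<^sup>+y. f y * indicator {a - r..a + r} y \<partial>lborel"
  have U: "(\<integral>\<^sup>+y. f y \<partial>uniform_measure lborel {a - r..a + r}) = ennreal (1 / (2 * r)) * ?I"
    using r by (subst nn_integral_uniform_measure)
      (auto simp: divide_ennreal_def inverse_ennreal mult.commute inverse_eq_divide)
  have "ennreal (l * r * exp (- l * \<bar>a\<bar> - l * r)) * (ennreal (1 / (2 * r)) * ?I) =
     ennreal (l / 2 * exp (- l * \<bar>a\<bar> - l * r)) * ?I"
    using r l by (simp add: mult.assoc[symmetric] ennreal_mult[symmetric])
  also have "\<dots> = (\<integral>\<^sup>+y. ennreal (l / 2 * exp (- l * \<bar>a\<bar> - l * r)) * (f y * indicator {a - r..a + r} y) \<partial>lborel)"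
    by (rule nn_integral_cmult[symmetric]) simp
  also have "\<dots> \<le> (\<integral>\<^sup>+y. ennreal (l / 2 * exp (- l * \<bar>y\<bar>)) * f y \<partial>lborel)"
  proof (intro nn_integral_mono)
    fix y :: real
    show "ennreal (l / 2 * exp (- l * \<bar>a\<bar> - l * r)) * (f y * indicator {a - r..a + r} y)
        \<le> ennreal (l / 2 * exp (- l * \<bar>y\<bar>)) * f y"
    proof (cases "y \<in> {a - r..a + r}")
      case True
      then have "\<bar>y\<bar> \<le> \<bar>a\<bar> + r" unfolding atLeastAtMost_iff by linarith
      then have "l * \<bar>y\<bar> \<le> l * (\<bar>a\<bar> + r)" using l by (intro mult_left_mono) auto
      then have "l / 2 * exp (- l * \<bar>a\<bar> - l * r) \<le> l / 2 * exp (- l * \<bar>y\<bar>)"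
        using l by (intro mult_left_mono) (simp_all add: distrib_left)
      then show ?thesis using True by (simp add: mult_right_mono ennreal_leI)
    qed simp
  qed
  also have "\<dots> = (\<integral>\<^sup>+y. f y \<partial>laplace l)" by (simp add: nn_integral_laplace)
  finally show ?thesis unfolding U .
qed

text \<open>On the box \<open>\<bar>b\<^sub>j\<bar> \<le> 1 / (\<parallel>X\<parallel> s)\<close> around \<open>\<beta>0\<close> the quadratic part of the log-likelihood ratio is at
  least \<open>-1/2\<close>; the linear part is handled by \<open>exp t \<ge> 1 + t\<close> and integrates to zero by symmetry.\<close>

lemma evidence_lower_bound:
  fixes \<beta>0 :: "nat \<Rightarrow> real"
  assumes l: "l > 0" and \<pi>: "set_pmf \<pi> \<subseteq> {0..p}" and X: "Xnorm n p X > 0"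
  defines "s \<equiv> card (supp p \<beta>0)"
  shows "ennreal (lik n p X Y \<beta>0 * weight p \<pi> (supp p \<beta>0) *
      (exp (- 1 / 2) * (l / (Xnorm n p X * real s)) ^ s * exp (- l * norm1 p \<beta>0) * exp (- l / Xnorm n p X)))
    \<le> marginal n p X l \<pi> Y UNIV"
proof -
  let ?S = "supp p \<beta>0"
  let ?x = "Xnorm n p X"
  have S: "?S \<subseteq> {..<p}" "finite ?S" by (auto simp: supp_def)
  \<comment> \<open>With s active coordinates the box has l1 radius 1 / |X|. For s = 0 division by
    zero gives \<open>r = 0\<close>, and no coordinate uses it.\<close>
  define r where "r = 1 / (?x * real s)"
  have r: "r > 0" if "i \<in> ?S" for i
  proof -
    have "s > 0" using that S unfolding s_def by (metis card_gt_0_iff empty_iff)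
    then show ?thesis using X by (simp add: r_def)
  qed
  \<comment> \<open>The comparison law: uniform on the active coordinates, the point mass at 0 on
    the others. It is centred at \<open>\<beta>0\<close>.\<close>
  define M' where "M' i = (if i \<in> ?S then uniform_measure lborel {\<beta>0 i - r..\<beta>0 i + r} else return lborel 0)" for i
  have P: "prob_space (M' i)" for i
    unfolding M'_def using r[of i] by (auto intro!: prob_space_uniform_measure prob_space_return)
  have sM': "sets (M' i) = sets borel" for i by (simp add: M'_def)
  have psf: "product_sigma_finite M'"
    unfolding product_sigma_finite_def by (intro allI prob_space_imp_sigma_finite P)
  interpret PM: prob_space "PiM {..<p} M'" by (intro prob_space_PiM P)
  have [measurable_cong]: "sets (PiM {..<p} M') = sets (vecM p)" by (intro sets_PiM_cong sM' refl)
  note [measurable_cong] = sM'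
  let ?z = "\<lambda>i. Y i - mat_vec p X \<beta>0 i"
  let ?b = "\<lambda>\<beta> j. \<beta> j - \<beta>0 j"
  define a where "a j = dot n ?z (\<lambda>i. X i j)" for j
  have dot_eq: "dot n ?z (mat_vec p X b) = (\<Sum>j<p. a j * b j)" for b
    unfolding mat_vec_def a_def
    by (subst dot_sum_right) (simp add: mult.commute[of _ "b _"] dot_scale_right)
  have comp: "integrable (M' j) (\<lambda>y. y - \<beta>0 j) \<and> (\<integral>y. y - \<beta>0 j \<partial>M' j) = 0" if "j < p" for j
  proof (cases "j \<in> ?S")
    case True
    then show ?thesis using integral_uniform_symmetric[OF r] by (simp add: M'_def)
  next
    case False
    then have "\<beta>0 j = 0" using that by (simp add: supp_def)
    moreover have "integrable (return lborel 0) (\<lambda>y::real. y)"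
    proof (rule finite_measure.integrable_const_bound[where B = 0])
      show "finite_measure (return lborel (0::real))"
        by (intro prob_space.finite_measure prob_space_return) simp
      show "AE y in return lborel (0::real). norm y \<le> 0" by (subst AE_return) auto
    qed simp
    moreover have "(\<integral>y. y \<partial>return lborel (0::real)) = 0" by (subst integral_return) auto
    ultimately show ?thesis using False by (simp add: M'_def)
  qed
  have comp': "integrable (PiM {..<p} M') (\<lambda>\<beta>. \<beta> j - \<beta>0 j) \<and> (\<integral>\<beta>. \<beta> j - \<beta>0 j \<partial>PiM {..<p} M') = 0" if "j < p" for j
  proof -
    have eq: "distr (PiM {..<p} M') (M' j) (\<lambda>\<omega>. \<omega> j) = M' j"
      by (rule distr_PiM_component) (use P that in auto)
    have m: "(\<lambda>\<omega>. \<omega> j) \<in> measurable (PiM {..<p} M') (M' j)" using that by simp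
    have "integrable (distr (PiM {..<p} M') (M' j) (\<lambda>\<omega>. \<omega> j)) (\<lambda>y. y - \<beta>0 j)"
      unfolding eq using comp[OF that] by simp
    moreover have "(\<integral>y. y - \<beta>0 j \<partial>distr (PiM {..<p} M') (M' j) (\<lambda>\<omega>. \<omega> j)) = 0"
      unfolding eq using comp[OF that] by simp
    ultimately show ?thesis
      using m by (simp add: integrable_distr_eq integral_distr)
  qed
  have int: "integrable (PiM {..<p} M') (\<lambda>\<beta>. 1 + dot n ?z (mat_vec p X (?b \<beta>)))"
    unfolding dot_eq using comp' by (intro Bochner_Integration.integrable_add Bochner_Integration.integrable_sum integrable_mult_right) auto
  have int1: "(\<integral>\<beta>. 1 + dot n ?z (mat_vec p X (?b \<beta>)) \<partial>PiM {..<p} M') = 1"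
  proof -
    have "(\<integral>\<beta>. 1 + (\<Sum>j<p. a j * (\<beta> j - \<beta>0 j)) \<partial>PiM {..<p} M') =
      (\<integral>\<beta>. 1 \<partial>PiM {..<p} M') + (\<integral>\<beta>. (\<Sum>j<p. a j * (\<beta> j - \<beta>0 j)) \<partial>PiM {..<p} M')"
      using comp' by (intro Bochner_Integration.integral_add Bochner_Integration.integrable_sum integrable_mult_right) auto
    also have "(\<integral>\<beta>. (\<Sum>j<p. a j * (\<beta> j - \<beta>0 j)) \<partial>PiM {..<p} M') = (\<Sum>j<p. \<integral>\<beta>. a j * (\<beta> j - \<beta>0 j) \<partial>PiM {..<p} M')"
      using comp' by (intro Bochner_Integration.integral_sum integrable_mult_right) auto
    also have "\<dots> = 0" using comp' by simp
    finally show ?thesis unfolding dot_eq by (simp add: PM.prob_space)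
  qed
  have AE: "AE \<beta> in PiM {..<p} M'. \<forall>j\<in>{..<p}. \<bar>\<beta> j - \<beta>0 j\<bar> \<le> (if j \<in> ?S then r else 0)"
  proof (intro AE_finite_allI)
    fix j assume j: "j \<in> {..<p}"
    have "AE y in M' j. \<bar>y - \<beta>0 j\<bar> \<le> (if j \<in> ?S then r else 0)"
    proof (cases "j \<in> ?S")
      case True
      have "AE y in uniform_measure lborel {\<beta>0 j - r..\<beta>0 j + r}. y \<in> {\<beta>0 j - r..\<beta>0 j + r}"
        by (rule AE_uniform_measureI) auto
      then have "AE y in uniform_measure lborel {\<beta>0 j - r..\<beta>0 j + r}. \<bar>y - \<beta>0 j\<bar> \<le> r"
        by eventually_elim auto
      then show ?thesis using True unfolding M'_def by (simp only: if_True)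
    next
      case False
      then have "\<beta>0 j = 0" using j by (simp add: supp_def)
      then show ?thesis using False unfolding M'_def by (simp, subst AE_return) auto
    qed
    then show "AE \<beta> in PiM {..<p} M'. \<bar>\<beta> j - \<beta>0 j\<bar> \<le> (if j \<in> ?S then r else 0)"
      using j P by (intro AE_PiM_component) auto
  qed simp
  have pw: "AE \<beta> in PiM {..<p} M'. lik n p X Y \<beta>0 * exp (- 1 / 2) * (1 + dot n ?z (mat_vec p X (?b \<beta>))) \<le> lik n p X Y \<beta>"
    using AE
  proof eventually_elim
    fix \<beta> assume b: "\<forall>j\<in>{..<p}. \<bar>\<beta> j - \<beta>0 j\<bar> \<le> (if j \<in> ?S then r else 0)"
    define t where "t = dot n ?z (mat_vec p X (?b \<beta>))"
    define q where "q = norm2 n (mat_vec p X (?b \<beta>))"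
    have "norm1 p (?b \<beta>) \<le> (\<Sum>j<p. if j \<in> ?S then r else 0)"
      unfolding norm1_def using b by (intro sum_mono) auto
    also have "\<dots> = real s * r"
      using S by (simp add: sum.If_cases s_def Int_absorb1)
    finally have "?x * norm1 p (?b \<beta>) \<le> ?x * (real s * r)" using X by (intro mult_left_mono) auto
    also have "\<dots> \<le> 1" using X by (simp add: r_def divide_le_eq_1 field_simps)
    finally have "q \<le> 1" unfolding q_def using norm2_mat_vec_le[of n p X "?b \<beta>"] by linarith
    then have q1: "q\<^sup>2 \<le> 1" unfolding q_def using norm2_nonneg by (metis power_le_one)
    have "lik n p X Y \<beta> = lik n p X Y \<beta>0 * exp (t - q\<^sup>2 / 2)"
      unfolding t_def q_def by (rule lik_ratio)
    moreover have "exp (- 1 / 2) * (1 + t) \<le> exp (t - q\<^sup>2 / 2)"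
    proof -
      have "exp (- 1 / 2) * (1 + t) \<le> exp (- 1 / 2) * exp t"
        by (intro mult_left_mono exp_ge_add_one_self) auto
      also have "\<dots> \<le> exp (t - q\<^sup>2 / 2)" using q1 by (simp add: exp_add[symmetric])
      finally show ?thesis .
    qed
    ultimately show "lik n p X Y \<beta>0 * exp (- 1 / 2) * (1 + dot n ?z (mat_vec p X (?b \<beta>))) \<le> lik n p X Y \<beta>"
      unfolding t_def[symmetric] mult.assoc using lik_pos by (simp add: mult_left_mono less_imp_le)
  qed
  have ilik: "integrable (PiM {..<p} M') (lik n p X Y)"
    by (intro PM.integrable_const_bound[where B = 1]) (auto simp: lik_le_1 less_imp_le[OF lik_pos])
  have "lik n p X Y \<beta>0 * exp (- 1 / 2) = (\<integral>\<beta>. lik n p X Y \<beta>0 * exp (- 1 / 2) * (1 + dot n ?z (mat_vec p X (?b \<beta>))) \<partial>PiM {..<p} M')"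
    by (simp add: int1)
  also have "\<dots> \<le> (\<integral>\<beta>. lik n p X Y \<beta> \<partial>PiM {..<p} M')"
    using int ilik pw by (intro integral_mono_AE integrable_mult_right) auto
  finally have low: "ennreal (lik n p X Y \<beta>0 * exp (- 1 / 2)) \<le> (\<integral>\<^sup>+\<beta>. ennreal (lik n p X Y \<beta>) \<partial>PiM {..<p} M')"
    using ilik by (subst nn_integral_eq_integral) (auto simp: less_imp_le[OF lik_pos] intro: ennreal_leI)
  define c where "c i = (if i \<in> ?S then l * r * exp (- l * \<bar>\<beta>0 i\<bar> - l * r) else 1)" for i
  have c0: "0 \<le> c i" for i unfolding c_def using r l by (auto intro!: mult_nonneg_nonneg simp: less_imp_le)
  have "(\<Prod>i\<in>{..<p}. ennreal (c i)) * (\<integral>\<^sup>+\<beta>. ennreal (lik n p X Y \<beta>) \<partial>PiM {..<p} M')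
     \<le> (\<integral>\<^sup>+\<beta>. ennreal (lik n p X Y \<beta>) \<partial>PiM {..<p} (coord l ?S))"
  proof (rule nn_integral_PiM_mono_scaled)
    fix i and f :: "real \<Rightarrow> ennreal" assume f: "f \<in> borel_measurable borel"
    show "ennreal (c i) * (\<integral>\<^sup>+x. f x \<partial>M' i) \<le> (\<integral>\<^sup>+x. f x \<partial>coord l ?S i)"
      using laplace_ge_uniform[OF l r f, of i "\<beta>0 i"]
      by (cases "i \<in> ?S") (auto simp: c_def M'_def coord_def)
  qed (use psf product_sigma_finite_coord[OF l] sM' in auto)
  then have mono: "ennreal (\<Prod>i\<in>{..<p}. c i) * (\<integral>\<^sup>+\<beta>. ennreal (lik n p X Y \<beta>) \<partial>PiM {..<p} M')
     \<le> (\<integral>\<^sup>+\<beta>. ennreal (lik n p X Y \<beta>) \<partial>model p l ?S)"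
    unfolding model_def by (simp only: prod_ennreal c0)
  have prod_c: "(\<Prod>i\<in>{..<p}. c i) = (l * r) ^ s * exp (- l * norm1 p \<beta>0) * exp (- l * (real s * r))"
  proof -
    have "(\<Prod>i\<in>{..<p}. c i) = (\<Prod>i\<in>?S. l * r * exp (- l * \<bar>\<beta>0 i\<bar> - l * r))"
      using S by (simp add: c_def prod.If_cases Int_absorb1)
    also have "\<dots> = (l * r) ^ s * exp (\<Sum>i\<in>?S. - l * \<bar>\<beta>0 i\<bar> - l * r)"
      using S by (simp add: prod.distrib exp_sum s_def)
    also have "(\<Sum>i\<in>?S. - l * \<bar>\<beta>0 i\<bar> - l * r) = - l * (\<Sum>i\<in>?S. \<bar>\<beta>0 i\<bar>) - l * (real s * r)"
      by (simp add: sum_subtractf sum_distrib_left s_def sum_negf)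
    also have "(\<Sum>i\<in>?S. \<bar>\<beta>0 i\<bar>) = norm1 p \<beta>0"
      unfolding norm1_def by (intro sum.mono_neutral_left) (auto simp: supp_def)
    finally show ?thesis by (simp add: exp_diff exp_minus divide_inverse)
  qed
  have m: "ennreal ((l * r) ^ s * exp (- l * norm1 p \<beta>0) * exp (- l * (real s * r))) * ennreal (lik n p X Y \<beta>0 * exp (- 1 / 2))
     \<le> (\<integral>\<^sup>+\<beta>. ennreal (lik n p X Y \<beta>) \<partial>model p l ?S)"
    by (rule order_trans[OF mult_left_mono[OF low] mono[unfolded prod_c]]) simp
  \<comment> \<open>An equality unless s = 0, where the left side is 0.\<close>
  have srx: "real s * r \<le> 1 / ?x" using X by (simp add: r_def field_simps)
  have lr: "l * r = l / (?x * real s)" by (simp add: r_def)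
  have lr0: "0 \<le> l * r" using l X by (simp add: r_def)
  have "ennreal (lik n p X Y \<beta>0 * weight p \<pi> ?S *
      (exp (- 1 / 2) * (l / (?x * real s)) ^ s * exp (- l * norm1 p \<beta>0) * exp (- l / ?x)))
     \<le> ennreal (weight p \<pi> ?S * ((l * r) ^ s * exp (- l * norm1 p \<beta>0) * exp (- l * (real s * r)) * (lik n p X Y \<beta>0 * exp (- 1 / 2))))"
  proof (rule ennreal_leI)
    have e: "exp (- l / ?x) \<le> exp (- l * (real s * r))"
      using mult_left_mono[OF srx, of l] l by simp
    have "lik n p X Y \<beta>0 * weight p \<pi> ?S * (exp (- 1 / 2) * (l * r) ^ s * exp (- l * norm1 p \<beta>0)) * exp (- l / ?x)
       \<le> lik n p X Y \<beta>0 * weight p \<pi> ?S * (exp (- 1 / 2) * (l * r) ^ s * exp (- l * norm1 p \<beta>0)) * exp (- l * (real s * r))"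
      using e lr0 lik_pos[of n p X Y \<beta>0] weight_nonneg
      by (intro mult_left_mono) (auto intro!: mult_nonneg_nonneg simp: less_imp_le)
    then show "lik n p X Y \<beta>0 * weight p \<pi> ?S *
      (exp (- 1 / 2) * (l / (?x * real s)) ^ s * exp (- l * norm1 p \<beta>0) * exp (- l / ?x))
     \<le> weight p \<pi> ?S * ((l * r) ^ s * exp (- l * norm1 p \<beta>0) * exp (- l * (real s * r)) * (lik n p X Y \<beta>0 * exp (- 1 / 2)))"
      unfolding lr by (simp add: mult_ac)
  qed
  also have "\<dots> = ennreal (weight p \<pi> ?S) * (ennreal ((l * r) ^ s * exp (- l * norm1 p \<beta>0) * exp (- l * (real s * r))) * ennreal (lik n p X Y \<beta>0 * exp (- 1 / 2)))"
    using lr0 lik_pos[of n p X Y \<beta>0] weight_nonneg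
    by (simp add: ennreal_mult[symmetric] less_imp_le)
  also have "\<dots> \<le> ennreal (weight p \<pi> ?S) * (\<integral>\<^sup>+\<beta>. ennreal (lik n p X Y \<beta>) \<partial>model p l ?S)"
    by (intro mult_left_mono m) simp
  \<comment> \<open>All supports but the true one are dropped from the mixture.\<close>
  also have "\<dots> \<le> (\<Sum>S\<in>Pow {..<p}. ennreal (weight p \<pi> S) * (\<integral>\<^sup>+\<beta>. ennreal (lik n p X Y \<beta>) \<partial>model p l S))"
    using S by (intro member_le_sum) auto
  also have "\<dots> = marginal n p X l \<pi> Y UNIV"
    unfolding marginal_UNIV by (rule nn_integral_prior[OF \<pi> l, symmetric]) simp
  finally show ?thesis .
qed

subsection \<open>Posterior concentration\<close>

lemma compat_le:
  assumes X: "Xnorm n p X > 0"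
    and cone: "(\<Sum>i\<in>{..<p} - S. \<bar>b i\<bar>) \<le> 7 * (\<Sum>i\<in>S. \<bar>b i\<bar>)" and ne: "\<exists>i\<in>S. b i \<noteq> 0"
  shows "compat n p X S \<le> norm2 n (mat_vec p X b) * sqrt (real (card S)) / (Xnorm n p X * (\<Sum>i\<in>S. \<bar>b i\<bar>))"
  unfolding compat_def
proof (rule cInf_lower)
  show "bdd_below {norm2 n (mat_vec p X \<beta>) * sqrt (real (card S)) / (Xnorm n p X * (\<Sum>i\<in>S. \<bar>\<beta> i\<bar>)) |\<beta>.
      (\<Sum>i\<in>{..<p} - S. \<bar>\<beta> i\<bar>) \<le> 7 * (\<Sum>i\<in>S. \<bar>\<beta> i\<bar>) \<and> (\<exists>i\<in>S. \<beta> i \<noteq> 0)}"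
  proof (rule bdd_belowI[of _ 0], clarify)
    fix \<beta> :: "nat \<Rightarrow> real"
    show "0 \<le> norm2 n (mat_vec p X \<beta>) * sqrt (real (card S)) / (Xnorm n p X * (\<Sum>i\<in>S. \<bar>\<beta> i\<bar>))"
      by (intro divide_nonneg_nonneg mult_nonneg_nonneg sum_nonneg norm2_nonneg Xnorm_nonneg) auto
  qed
qed (use cone ne in blast)

text \<open>Inside the cone of the compatibility number the \<open>\<ell>\<^sub>1\<close> bias is absorbed by the quadratic term through
  AM-GM; outside of it the penalty itself gains.\<close>

lemma l1_bias_bound:
  fixes \<beta>0 \<beta> :: "nat \<Rightarrow> real"
  assumes X: "Xnorm n p X > 0" and l: "l > 0" and \<delta>: "\<delta> > 0"
    and phi: "compat n p X (supp p \<beta>0) > 0"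
  defines "b \<equiv> \<lambda>j. \<beta> j - \<beta>0 j"
  shows "l * norm1 p \<beta>0 \<le> l * norm1 p \<beta> - 3 / 4 * l * norm1 p b + \<delta> / 8 * (norm2 n (mat_vec p X b))\<^sup>2
     + 8 * l\<^sup>2 * real (card (supp p \<beta>0)) / (\<delta> * (Xnorm n p X)\<^sup>2 * (compat n p X (supp p \<beta>0))\<^sup>2)"
proof -
  let ?S = "supp p \<beta>0"
  have S: "?S \<subseteq> {..<p}" "finite ?S" by (auto simp: supp_def)
  define x where "x = Xnorm n p X"
  define \<phi> where "\<phi> = compat n p X ?S"
  define N where "N = norm2 n (mat_vec p X b)"
  define s where "s = real (card ?S)"
  define u where "u = (\<Sum>i\<in>?S. \<bar>b i\<bar>)"
  define v where "v = (\<Sum>i\<in>{..<p} - ?S. \<bar>b i\<bar>)"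
  have uv: "0 \<le> u" "0 \<le> v" by (auto simp: u_def v_def sum_nonneg)
  have split: "(\<Sum>i<p. f i) = (\<Sum>i\<in>?S. f i) + (\<Sum>i\<in>{..<p} - ?S. f i)" for f :: "nat \<Rightarrow> real"
    using S by (metis add.commute finite_lessThan sum.subset_diff)
  have nb: "norm1 p b = u + v" unfolding norm1_def u_def v_def by (rule split)
  have "norm1 p \<beta>0 - norm1 p \<beta> = (\<Sum>i\<in>?S. \<bar>\<beta>0 i\<bar> - \<bar>\<beta> i\<bar>) + (\<Sum>i\<in>{..<p} - ?S. \<bar>\<beta>0 i\<bar> - \<bar>\<beta> i\<bar>)"
    unfolding norm1_def split sum_subtractf by simp
  also have "\<dots> \<le> u - v"
  proof -
    have "(\<Sum>i\<in>?S. \<bar>\<beta>0 i\<bar> - \<bar>\<beta> i\<bar>) \<le> u" unfolding u_def b_def by (intro sum_mono) linarith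
    moreover have "(\<Sum>i\<in>{..<p} - ?S. \<bar>\<beta>0 i\<bar> - \<bar>\<beta> i\<bar>) = - v"
      unfolding v_def b_def sum_negf[symmetric] by (intro sum.cong) (auto simp: supp_def)
    ultimately show ?thesis by linarith
  qed
  finally have base: "norm1 p \<beta>0 - norm1 p \<beta> \<le> u - v" .
  define E where "E = \<delta> / 8 * N\<^sup>2 + 8 * l\<^sup>2 * s / (\<delta> * x\<^sup>2 * \<phi>\<^sup>2)"
  have E0: "0 \<le> E" using \<delta> by (auto simp: E_def s_def intro!: add_nonneg_nonneg divide_nonneg_nonneg mult_nonneg_nonneg)
  have "l * (u - v) \<le> - (3 / 4) * l * (u + v) + E"
  proof (cases "7 * u < v \<or> u = 0")
    case True
    \<comment> \<open>This inequality is equivalent to 7 u <= v: the 7 of the cone is the origin of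
      the 3/4. Inside the cone the same penalty is split off through u - v = 2 u - (u + v).\<close>
    then have "u - v \<le> - (3 / 4) * (u + v)" using uv by argo
    then have "l * (u - v) \<le> l * (- (3 / 4) * (u + v))" using l by (intro mult_left_mono) auto
    then show ?thesis using E0 by (simp add: mult_ac)
  next
    case False
    then have u: "u > 0" using uv by auto
    have ne: "\<exists>i\<in>?S. b i \<noteq> 0"
    proof (rule ccontr)
      assume "\<not> (\<exists>i\<in>?S. b i \<noteq> 0)"
      then have "u = 0" unfolding u_def by (intro sum.neutral) auto
      then show False using u by simp
    qed
    have "\<phi> \<le> N * sqrt s / (x * u)"
      unfolding \<phi>_def N_def s_def x_def u_def
      using False ne by (intro compat_le X) (auto simp: u_def v_def)
    then have "u * (x * \<phi>) \<le> N * sqrt s"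
      using X u unfolding x_def by (simp add: pos_le_divide_eq mult_ac)
    moreover have xp: "x * \<phi> > 0" using X phi by (simp add: x_def \<phi>_def)
    ultimately have ule: "u \<le> N * (sqrt s / (x * \<phi>))" by (simp add: pos_le_divide_eq)
    define d where "d = sqrt s / (x * \<phi>)"
    have "2 * l * u \<le> 2 * l * (N * d)" using ule l by (intro mult_left_mono) (auto simp: d_def)
    also have "\<dots> \<le> \<delta> / 8 * N\<^sup>2 + 8 / \<delta> * (l * d)\<^sup>2"
    proof -
      \<comment> \<open>The weights are tuned so that the quadratic term costs exactly \<delta> /
        8.\<close>
      have "0 \<le> 8 / \<delta> * (\<delta> / 8 * N - l * d)\<^sup>2" using \<delta> by simp
      also have "\<dots> = \<delta> / 8 * N\<^sup>2 + 8 / \<delta> * (l * d)\<^sup>2 - 2 * l * (N * d)"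
        using \<delta> by (simp add: power2_eq_square field_simps)
      finally show ?thesis by simp
    qed
    also have "8 / \<delta> * (l * d)\<^sup>2 = 8 * l\<^sup>2 * s / (\<delta> * x\<^sup>2 * \<phi>\<^sup>2)"
      by (simp add: d_def power_mult_distrib power_divide s_def mult_ac)
    finally have "2 * l * u \<le> E" unfolding E_def by simp
    moreover have "l * (u - v) \<le> 2 * l * u - (3 / 4) * l * (u + v)"
      using l uv by (simp add: algebra_simps)
    ultimately show ?thesis by simp
  qed
  moreover have "l * (norm1 p \<beta>0 - norm1 p \<beta>) \<le> l * (u - v)" using base l by (intro mult_left_mono) auto
  ultimately show ?thesis
    unfolding nb E_def N_def[symmetric] s_def[symmetric] x_def[symmetric] \<phi>_def[symmetric]
    by (simp add: algebra_simps)
qed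

text \<open>\<open>exp (l * norm1 p \<beta>)\<close> cancels the slab density; what remains has rate
  l / 2 and total mass 2 per active coordinate. An inactive coordinate contributes at most
  1.\<close>

lemma nn_integral_model_exp_norm1:
  assumes l: "l > 0" and S: "S \<subseteq> {..<p}"
  shows "(\<integral>\<^sup>+\<beta>. ennreal (exp (l * norm1 p \<beta> - l / 2 * norm1 p (\<lambda>j. \<beta> j - \<beta>0 j))) \<partial>model p l S) \<le> ennreal (2 ^ card S)"
proof -
  interpret product_sigma_finite "coord l S" by (rule product_sigma_finite_coord[OF l])
  have le: "(\<integral>\<^sup>+y. ennreal (exp (l * \<bar>y\<bar> - l / 2 * \<bar>y - \<beta>0 i\<bar>)) \<partial>coord l S i) \<le> ennreal (if i \<in> S then 2 else 1)" for i
  proof (cases "i \<in> S")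
    case True
    have "(\<integral>\<^sup>+y. ennreal (exp (l * \<bar>y\<bar> - l / 2 * \<bar>y - \<beta>0 i\<bar>)) \<partial>coord l S i) =
       (\<integral>\<^sup>+y. ennreal (l / 2 * exp (- l * \<bar>y\<bar>)) * ennreal (exp (l * \<bar>y\<bar> - l / 2 * \<bar>y - \<beta>0 i\<bar>)) \<partial>lborel)"
      using True by (simp add: coord_def nn_integral_laplace)
    also have "\<dots> = (\<integral>\<^sup>+y. ennreal (l / 2) * ennreal (exp (- (l / 2) * \<bar>y - \<beta>0 i\<bar>)) \<partial>lborel)"
      using l by (intro nn_integral_cong) (simp add: ennreal_mult[symmetric] exp_add[symmetric])
    also have "\<dots> = ennreal (l / 2) * ennreal (2 / (l / 2))"
      using l by (subst nn_integral_cmult) (auto simp only: nn_integral_exp_abs half_gt_zero, measurable)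
    also have "\<dots> = ennreal 2" using l by (simp add: ennreal_mult[symmetric])
    finally show ?thesis using True by simp
  next
    case False
    then show ?thesis using l by (auto simp: coord_def nn_integral_return intro!: mult_nonneg_nonneg)
  qed
  have "(\<integral>\<^sup>+\<beta>. ennreal (exp (l * norm1 p \<beta> - l / 2 * norm1 p (\<lambda>j. \<beta> j - \<beta>0 j))) \<partial>model p l S) =
     (\<integral>\<^sup>+\<beta>. (\<Prod>i<p. ennreal (exp (l * \<bar>\<beta> i\<bar> - l / 2 * \<bar>\<beta> i - \<beta>0 i\<bar>))) \<partial>model p l S)"
    by (intro nn_integral_cong)
      (simp add: norm1_def prod_ennreal exp_sum[symmetric] sum_subtractf sum_distrib_left)
  also have "\<dots> = (\<Prod>i<p. \<integral>\<^sup>+y. ennreal (exp (l * \<bar>y\<bar> - l / 2 * \<bar>y - \<beta>0 i\<bar>)) \<partial>coord l S i)"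
    unfolding model_def by (intro product_nn_integral_prod) auto
  also have "\<dots> \<le> (\<Prod>i<p. ennreal (if i \<in> S then 2 else 1))"
    using le by (intro prod_mono_ennreal) auto
  also have "\<dots> = ennreal (2 ^ card S)"
  proof -
    have "(\<Prod>i<p. if i \<in> S then 2 else 1 :: real) = 2 ^ card S"
      using S by (simp add: prod.If_cases Int_absorb1)
    then show ?thesis by (subst prod_ennreal) auto
  qed
  finally show ?thesis .
qed

lemma supp_diff_subset:
  assumes "\<And>j. j < p \<Longrightarrow> j \<notin> S \<Longrightarrow> \<beta> j = 0"
  shows "supp p (\<lambda>j. \<beta> j - \<beta>0 j) \<subseteq> S \<union> supp p \<beta>0"
  using assms by (auto simp: supp_def)

lemma card_supp_eq: "real (card (supp p b)) = (\<Sum>j<p. indicator (- {0}) (b j))"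
proof -
  have "supp p b = {j \<in> {..<p}. b j \<noteq> 0}" by (auto simp: supp_def)
  then show ?thesis by (simp add: indicator_def sum.If_cases Int_def)
qed

lemma measurable_card_supp [measurable]:
  "(\<lambda>\<beta>. real (card (supp p (\<lambda>j. \<beta> j - \<beta>0 j)))) \<in> borel_measurable (vecM p)"
proof -
  have ind: "(indicator (- {0::real}) :: real \<Rightarrow> real) \<in> borel_measurable borel"
    by (rule borel_measurable_indicator) simp
  have "(\<lambda>\<beta>. indicator (- {0}) (\<beta> j - \<beta>0 j) :: real) \<in> borel_measurable (vecM p)" if "j < p" for j
    by (rule measurable_compose[OF _ ind]) (use that in simp)
  then show ?thesis unfolding card_supp_eq by (intro borel_measurable_sum) simp
qed

text \<open>Too large a loss or too large a dimension. The dimension is counted on the error, so the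
  second alternative forces every model carrying \<beta> to have more than \<open>k\<close>
  elements.\<close>

definition far_set :: "nat \<Rightarrow> nat \<Rightarrow> (nat \<Rightarrow> nat \<Rightarrow> real) \<Rightarrow> real \<Rightarrow> (nat \<Rightarrow> real) \<Rightarrow> real \<Rightarrow> real \<Rightarrow> real \<Rightarrow>
    (nat \<Rightarrow> real) set" where
  "far_set n p X l \<beta>0 \<delta> k W = {\<beta>.
     W < \<delta> / 8 * (norm2 n (mat_vec p X (\<lambda>j. \<beta> j - \<beta>0 j)))\<^sup>2 + l / 4 * norm1 p (\<lambda>j. \<beta> j - \<beta>0 j) \<or>
     k + real (card (supp p \<beta>0)) < real (card (supp p (\<lambda>j. \<beta> j - \<beta>0 j)))}"

lemma measurable_indicator_far_set [measurable]:
  "(indicator (far_set n p X l \<beta>0 \<delta> k W) :: _ \<Rightarrow> ennreal) \<in> borel_measurable (vecM p)"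
proof -
  have "indicator (far_set n p X l \<beta>0 \<delta> k W) = (\<lambda>\<beta>. if
     W < \<delta> / 8 * (norm2 n (mat_vec p X (\<lambda>j. \<beta> j - \<beta>0 j)))\<^sup>2 + l / 4 * norm1 p (\<lambda>j. \<beta> j - \<beta>0 j) \<or>
     k + real (card (supp p \<beta>0)) < real (card (supp p (\<lambda>j. \<beta> j - \<beta>0 j))) then 1 else 0 :: ennreal)"
    by (rule ext) (auto simp: far_set_def indicator_def)
  then show ?thesis by simp
qed

text \<open>The part of the evidence lower bound that depends on \<open>\<beta>0\<close> only
  through its sparsity. For s = 0 the power is 0^0 = 1.\<close>

definition evidence_const :: "nat \<Rightarrow> nat \<Rightarrow> (nat \<Rightarrow> nat \<Rightarrow> real) \<Rightarrow> real \<Rightarrow> nat \<Rightarrow> real" where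
  "evidence_const n p X l s = exp (- 1 / 2) * (l / (Xnorm n p X * real s)) ^ s * exp (- l / Xnorm n p X)"

lemma evidence_const_pos: "l > 0 \<Longrightarrow> Xnorm n p X > 0 \<Longrightarrow> evidence_const n p X l s > 0"
  by (cases "s = 0") (auto simp: evidence_const_def)

text \<open>The price of penalising \<open>\<beta>0\<close> itself, namely the last term of
  \<open>l1_bias_bound\<close>.\<close>

definition bias :: "nat \<Rightarrow> nat \<Rightarrow> (nat \<Rightarrow> nat \<Rightarrow> real) \<Rightarrow> real \<Rightarrow> real \<Rightarrow> nat set \<Rightarrow> real" where
  "bias n p X l \<delta> S = 8 * l\<^sup>2 * real (card S) / (\<delta> * (Xnorm n p X)\<^sup>2 * (compat n p X S)\<^sup>2)"

text \<open>The random factor G adds the noise failure to the tempered sum over models divided by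
  the evidence bound; T bounds the mean of the second part. G also certifies the noise bound, which
  the sup-norm argument needs under the same condition.\<close>

lemma posterior_far_set:
  fixes \<beta>0 :: "nat \<Rightarrow> real" and k W :: real
  assumes l: "l > 0" and \<pi>: "set_pmf \<pi> \<subseteq> {0..p}" and X: "Xnorm n p X > 0" and p: "p \<ge> 2"
    and phi: "compat n p X (supp p \<beta>0) > 0" and \<delta>: "\<delta> > 0" "\<delta> \<le> 1"
    and w0: "weight p \<pi> (supp p \<beta>0) > 0"
  defines "s \<equiv> card (supp p \<beta>0)"
  defines "z \<equiv> \<lambda>Y i. Y i - mat_vec p X \<beta>0 i"
  defines "T \<equiv> exp (bias n p X l \<delta> (supp p \<beta>0)) / (weight p \<pi> (supp p \<beta>0) * evidence_const n p X l s) *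
     (\<Sum>S\<in>Pow {..<p}. weight p \<pi> S * real p powr (16 * \<delta> * real (card S + s)) *
        ((if k < real (card S) then 1 else 0) + exp (- W)) * 2 ^ card S)"
  obtains G :: "(nat \<Rightarrow> real) \<Rightarrow> ennreal" where
    "G \<in> borel_measurable (data_law n p X \<beta>0)"
    "(\<integral>\<^sup>+Y. G Y \<partial>data_law n p X \<beta>0) \<le> ennreal ((1 + 2 / real p ^ 4) ^ p - 1 + T)"
    "\<And>Y. G Y < 1 \<Longrightarrow> noise_ok n p X (z Y)"
    "\<And>Y. G Y < 1 \<Longrightarrow> marginal n p X l \<pi> Y (far_set n p X l \<beta>0 \<delta> k W) \<le> G Y * marginal n p X l \<pi> Y UNIV"
proof -
  let ?S0 = "supp p \<beta>0"
  have S0: "?S0 \<subseteq> {..<p}" "finite ?S0" by (auto simp: supp_def)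
  let ?D = "data_law n p X \<beta>0"
  let ?v = "\<lambda>\<beta>. mat_vec p X (\<lambda>j. \<beta> j - \<beta>0 j)"
  let ?q = "\<lambda>\<beta>. (norm2 n (?v \<beta>))\<^sup>2"
  let ?b1 = "\<lambda>\<beta>. norm1 p (\<lambda>j. \<beta> j - \<beta>0 j)"
  define E where "E = bias n p X l \<delta> ?S0"
  obtain bad :: "(nat \<Rightarrow> real) \<Rightarrow> real" where
    bad [measurable]: "bad \<in> borel_measurable ?D" and bad0: "\<And>y. 0 \<le> bad y" and
    bad_int: "(\<integral>\<^sup>+y. ennreal (bad y) \<partial>?D) \<le> ennreal ((1 + 2 / real p ^ 4) ^ p - 1)" and
    bad_noise: "\<And>y. bad y < 1 \<Longrightarrow> noise_ok n p X (z y)"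
    by (rule gauss_noise_bound[OF p, of n "mat_vec p X \<beta>0" X]) (rule that[unfolded data_law_def z_def])
  define I where "I S = (if k < real (card S) then 1 else 0 :: real)" for S :: "nat set"
  define c where "c S = real p powr (16 * \<delta> * real (card S + s))" for S :: "nat set"
  \<comment> \<open>The bracket majorises the indicator of the far set: the first summand covers
    excess dimension, the exponential covers excess loss as in a Chernoff bound. The last factor is
    the quadratic term left after \<delta> t has been replaced by its bound.\<close>
  define h where "h S \<beta> = (I S + exp (\<delta> / 8 * ?q \<beta> + l / 4 * ?b1 \<beta> - W)) * exp (- (1 / 2 - \<delta> / 4) * ?q \<beta>)" for S \<beta>
  have h0: "0 \<le> h S \<beta>" for S \<beta> by (auto simp: h_def I_def)
  have c0: "0 \<le> c S" for S by (simp add: c_def)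
  have [measurable]: "(\<lambda>\<beta>. ennreal (h S \<beta>)) \<in> borel_measurable (vecM p)" for S unfolding h_def by measurable
  define H where "H S Y = (\<integral>\<^sup>+\<beta>. ennreal (h S \<beta>) * ennreal (exp ((1 - \<delta>) * dot n (z Y) (?v \<beta>))) \<partial>model p l S)" for S Y
  have H_meas [measurable]: "H S \<in> borel_measurable ?D" for S
    unfolding H_def z_def
    by (rule measurable_nn_integral_data_law)
      (auto intro!: prob_space_imp_sigma_finite prob_space_model l)
  define \<kappa> where "\<kappa> = evidence_const n p X l s * exp (- l * norm1 p \<beta>0)"
  have \<kappa>: "\<kappa> > 0" unfolding \<kappa>_def using evidence_const_pos[OF l X] by simp
  define w where "w = weight p \<pi>"
  have w: "0 \<le> w S" for S by (simp add: w_def weight_nonneg)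
  define Kc where "Kc = 1 / (w ?S0 * \<kappa>)"
  have Kc: "Kc > 0" using w0 \<kappa> by (simp add: Kc_def w_def)
  \<comment> \<open>The evidence enters only through \<open>Kc\<close>, the reciprocal of its
    deterministic part.\<close>
  define G where "G Y = ennreal (bad Y) + ennreal Kc * (\<Sum>S\<in>Pow {..<p}. ennreal (w S * c S) * H S Y)" for Y
  have noise: "noise_ok n p X (z Y)" if "G Y < 1" for Y
  proof -
    have "ennreal (bad Y) \<le> G Y" unfolding G_def by simp
    then have "ennreal (bad Y) < 1" using that by (rule le_less_trans)
    then have "bad Y < 1" using bad0 by (simp add: ennreal_less_one_iff)
    then show ?thesis by (rule bad_noise)
  qed
  show ?thesis
  proof (rule that[of G])
    show "G \<in> borel_measurable ?D" unfolding G_def by measurable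
    show "\<And>Y. G Y < 1 \<Longrightarrow> noise_ok n p X (z Y)" by (rule noise)
  next
    fix Y assume "G Y < 1"
    note nY = noise[OF this, unfolded noise_ok_def, rule_format]
    let ?V = "far_set n p X l \<beta>0 \<delta> k W"
    define L0 where "L0 = lik n p X Y \<beta>0"
    have L0: "L0 > 0" unfolding L0_def by (rule lik_pos)
    have le: "(\<integral>\<^sup>+\<beta>. indicator ?V \<beta> * ennreal (lik n p X Y \<beta>) \<partial>model p l S) \<le> ennreal (L0 * c S) * H S Y"
      if S: "S \<subseteq> {..<p}" for S
    proof -
      have "AE \<beta> in model p l S. indicator ?V \<beta> * ennreal (lik n p X Y \<beta>) \<le>
         ennreal (L0 * c S) * (ennreal (h S \<beta>) * ennreal (exp ((1 - \<delta>) * dot n (z Y) (?v \<beta>))))"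
        using AE_model[OF l]
      proof eventually_elim
        fix \<beta> :: "nat \<Rightarrow> real" assume \<beta>: "\<forall>i<p. i \<notin> S \<longrightarrow> \<beta> i = 0"
        show "indicator ?V \<beta> * ennreal (lik n p X Y \<beta>) \<le>
         ennreal (L0 * c S) * (ennreal (h S \<beta>) * ennreal (exp ((1 - \<delta>) * dot n (z Y) (?v \<beta>))))"
        proof (cases "\<beta> \<in> ?V")
          case True
          define t where "t = dot n (z Y) (?v \<beta>)"
          define q where "q = ?q \<beta>"
          have q0: "0 \<le> q" by (simp add: q_def)
          have fS: "finite S" using S finite_subset by blast
          have sub: "supp p (\<lambda>j. \<beta> j - \<beta>0 j) \<subseteq> S \<union> ?S0" using \<beta> by (intro supp_diff_subset) auto
          have cardle: "card (supp p (\<lambda>j. \<beta> j - \<beta>0 j)) \<le> card S + s"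
            unfolding s_def using card_mono[OF _ sub] card_Un_le[of S ?S0] fS S0 by (meson finite_UnI le_trans)
          define m where "m = real (card S + s) * ln (real p)"
          have m0: "0 \<le> m" using p by (simp add: m_def)
          have "t\<^sup>2 \<le> 16 * real (card (S \<union> ?S0)) * ln (real p) * q"
            unfolding t_def q_def using S S0 \<beta> by (intro nY) (auto simp: supp_def)
          also have "\<dots> \<le> 16 * m * q"
          proof -
            have "real (card (S \<union> ?S0)) \<le> real (card S + s)" unfolding s_def using card_Un_le by (simp only: of_nat_le_iff)
            then have "real (card (S \<union> ?S0)) * ln (real p) * q \<le> m * q"
              unfolding m_def using p q0 by (intro mult_right_mono) auto
            then show ?thesis by simp
          qed
          \<comment> \<open>4 u v <= (u + v)^2 with u = q / 4 and v = 16 m. Quartering q makes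
            \<delta> t cost only \<delta> q / 4 of the quadratic term.\<close>
          also have "\<dots> \<le> (q / 4 + 16 * m)\<^sup>2"
          proof -
            have "0 \<le> (q / 4 - 16 * m)\<^sup>2 + 0" by simp
            then show ?thesis by (simp add: power2_eq_square algebra_simps)
          qed
          finally have "t \<le> q / 4 + 16 * m"
            using q0 m0 by (intro power2_le_imp_le[of t "q / 4 + 16 * m"]) auto
          then have "\<delta> * t \<le> \<delta> * (q / 4 + 16 * m)" using \<delta> by (intro mult_left_mono) auto
          then have expo: "t - q / 2 \<le> 16 * \<delta> * m + (- (1 / 2 - \<delta> / 4) * q) + (1 - \<delta>) * t"
            by (simp add: algebra_simps)
          have one: "1 \<le> I S + exp (\<delta> / 8 * q + l / 4 * ?b1 \<beta> - W)"
            using True cardle unfolding far_set_def mem_Collect_eq q_def[symmetric] s_def[symmetric] I_def by auto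
          have cS: "c S = exp (16 * \<delta> * m)" using p by (simp add: c_def m_def powr_def mult_ac)
          have "lik n p X Y \<beta> = L0 * exp (t - q / 2)"
            unfolding L0_def t_def q_def z_def by (rule lik_ratio)
          also have "\<dots> \<le> L0 * (exp (16 * \<delta> * m) * exp (- (1 / 2 - \<delta> / 4) * q) * exp ((1 - \<delta>) * t))"
            using L0 expo by (intro mult_left_mono) (auto simp: exp_add[symmetric])
          also have "\<dots> \<le> L0 * (exp (16 * \<delta> * m) * ((I S + exp (\<delta> / 8 * q + l / 4 * ?b1 \<beta> - W)) * exp (- (1 / 2 - \<delta> / 4) * q)) * exp ((1 - \<delta>) * t))"
            using L0 one by (intro mult_left_mono mult_right_mono) (auto simp: mult_le_cancel_right1)
          also have "\<dots> = (L0 * c S) * (h S \<beta> * exp ((1 - \<delta>) * t))"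
            unfolding h_def cS q_def[symmetric] by (simp add: mult_ac)
          finally have "ennreal (lik n p X Y \<beta>) \<le> ennreal ((L0 * c S) * (h S \<beta> * exp ((1 - \<delta>) * t)))"
            by (rule ennreal_leI)
          then show ?thesis using True L0 c0[of S] h0[of S \<beta>] unfolding t_def by (simp add: ennreal_mult)
        qed simp
      qed
      then have "(\<integral>\<^sup>+\<beta>. indicator ?V \<beta> * ennreal (lik n p X Y \<beta>) \<partial>model p l S) \<le>
         (\<integral>\<^sup>+\<beta>. ennreal (L0 * c S) * (ennreal (h S \<beta>) * ennreal (exp ((1 - \<delta>) * dot n (z Y) (?v \<beta>)))) \<partial>model p l S)"
        by (rule nn_integral_mono_AE)
      also have "\<dots> = ennreal (L0 * c S) * H S Y"
        unfolding H_def by (rule nn_integral_cmult) measurable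
      finally show ?thesis .
    qed
    have ev: "ennreal (L0 * w ?S0 * \<kappa>) \<le> marginal n p X l \<pi> Y UNIV"
      using evidence_lower_bound[OF l \<pi> X, of Y \<beta>0] unfolding L0_def w_def \<kappa>_def evidence_const_def s_def
      by (simp add: mult_ac)
    have "marginal n p X l \<pi> Y ?V = (\<Sum>S\<in>Pow {..<p}. ennreal (w S) * (\<integral>\<^sup>+\<beta>. indicator ?V \<beta> * ennreal (lik n p X Y \<beta>) \<partial>model p l S))"
      unfolding marginal_def w_def by (rule nn_integral_prior[OF \<pi> l]) measurable
    also have "\<dots> \<le> (\<Sum>S\<in>Pow {..<p}. ennreal (w S) * (ennreal (L0 * c S) * H S Y))"
      by (intro sum_mono mult_left_mono le) auto
    also have "\<dots> = ennreal L0 * (\<Sum>S\<in>Pow {..<p}. ennreal (w S * c S) * H S Y)"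
      using L0 w c0 by (simp add: sum_distrib_left ennreal_mult mult_ac)
    also have "\<dots> = ennreal Kc * (\<Sum>S\<in>Pow {..<p}. ennreal (w S * c S) * H S Y) * ennreal (L0 * w ?S0 * \<kappa>)"
    proof -
      have "L0 = Kc * (L0 * w ?S0 * \<kappa>)" using w0 \<kappa> by (simp add: Kc_def w_def)
      then have "ennreal L0 = ennreal Kc * ennreal (L0 * w ?S0 * \<kappa>)"
        using Kc L0 w \<kappa> by (metis ennreal_mult less_imp_le mult_nonneg_nonneg)
      then show ?thesis by (simp add: mult_ac)
    qed
    also have "\<dots> \<le> G Y * marginal n p X l \<pi> Y UNIV"
      unfolding G_def by (intro mult_mono ev) auto
    finally show "marginal n p X l \<pi> Y ?V \<le> G Y * marginal n p X l \<pi> Y UNIV" .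
  next
    have HI: "(\<integral>\<^sup>+Y. H S Y \<partial>?D) \<le> ennreal ((I S + exp (- W)) * exp (E - l * norm1 p \<beta>0) * 2 ^ card S)"
      if S: "S \<subseteq> {..<p}" for S
    proof -
      have "(\<integral>\<^sup>+Y. H S Y \<partial>?D) = (\<integral>\<^sup>+\<beta>. ennreal (h S \<beta>) * ennreal (exp ((1 - \<delta>)\<^sup>2 * ?q \<beta> / 2)) \<partial>model p l S)"
        unfolding H_def z_def
        by (rule nn_integral_data_law_exp)
          (auto intro!: prob_space_imp_sigma_finite prob_space_model l)
      also have "\<dots> \<le> (\<integral>\<^sup>+\<beta>. ennreal ((I S + exp (- W)) * exp (E - l * norm1 p \<beta>0)) *
          ennreal (exp (l * norm1 p \<beta> - l / 2 * ?b1 \<beta>)) \<partial>model p l S)"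
      proof (intro nn_integral_mono)
        fix \<beta>
        define q where "q = ?q \<beta>"
        define b where "b = ?b1 \<beta>"
        have b0: "0 \<le> b" by (auto simp: b_def norm1_def sum_nonneg)
        have q0: "0 \<le> q" by (simp add: q_def)
        have bias: "l * norm1 p \<beta>0 \<le> l * norm1 p \<beta> - 3 / 4 * l * b + \<delta> / 8 * q + E"
          using l1_bias_bound[OF X l \<delta>(1) phi, of \<beta>] unfolding E_def bias_def b_def q_def .
        \<comment> \<open>The exact coefficient is -3 \<delta> / 4 + \<delta>^2 / 2, which is at
          most -\<delta> / 4 since \<delta> <= 1.\<close>
        have dd: "- (1 / 2 - \<delta> / 4) * q + (1 - \<delta>)\<^sup>2 * q / 2 \<le> - (\<delta> / 4) * q"
        proof -
          have "\<delta> * (\<delta> * q) \<le> 1 * (\<delta> * q)" using \<delta> q0 by (intro mult_right_mono) auto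
          moreover have "(1 - \<delta>)\<^sup>2 * q / 2 = q / 2 - \<delta> * q + \<delta> * (\<delta> * q) / 2"
            by (simp add: power2_eq_square field_simps)
          moreover have "- (1 / 2 - \<delta> / 4) * q = \<delta> * q / 4 - q / 2" by (simp add: field_simps)
          moreover have "(\<delta> / 4) * q = \<delta> * q / 4" by simp
          ultimately show ?thesis by argo
        qed
        have "h S \<beta> * exp ((1 - \<delta>)\<^sup>2 * q / 2) =
          (I S + exp (\<delta> / 8 * q + l / 4 * b - W)) * exp (- (1 / 2 - \<delta> / 4) * q + (1 - \<delta>)\<^sup>2 * q / 2)"
          unfolding h_def q_def b_def by (simp add: exp_add)
        also have "\<dots> \<le> (I S + exp (\<delta> / 8 * q + l / 4 * b - W)) * exp (- (\<delta> / 4) * q)"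
          using dd by (intro mult_left_mono) (auto simp: I_def)
        \<comment> \<open>The remaining \<delta> / 4 is halved between the loss threshold and the
          bias. Likewise the 3/4 of the l1 penalty splits into 1/4 for the threshold and 1/2 for
          integrability over the slab.\<close>
        also have "\<dots> \<le> (I S + exp (- W)) * exp (l / 4 * b - \<delta> / 8 * q)"
        proof -
          have "I S * exp (- (\<delta> / 4) * q) \<le> I S * exp (l / 4 * b - \<delta> / 8 * q)"
          proof (intro mult_left_mono)
            have "0 \<le> l * b" "0 \<le> \<delta> * q" using l b0 \<delta> q0 by auto
            then show "exp (- (\<delta> / 4) * q) \<le> exp (l / 4 * b - \<delta> / 8 * q)" by simp
          qed (auto simp: I_def)
          moreover have "exp (\<delta> / 8 * q + l / 4 * b - W) * exp (- (\<delta> / 4) * q) = exp (- W) * exp (l / 4 * b - \<delta> / 8 * q)"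
            by (simp add: exp_add[symmetric])
          ultimately show ?thesis by (simp add: distrib_right)
        qed
        also have "\<dots> \<le> (I S + exp (- W)) * (exp (E - l * norm1 p \<beta>0) * exp (l * norm1 p \<beta> - l / 2 * b))"
          using bias by (intro mult_left_mono) (auto simp: I_def exp_add[symmetric])
        finally show "ennreal (h S \<beta>) * ennreal (exp ((1 - \<delta>)\<^sup>2 * ?q \<beta> / 2)) \<le>
          ennreal ((I S + exp (- W)) * exp (E - l * norm1 p \<beta>0)) * ennreal (exp (l * norm1 p \<beta> - l / 2 * ?b1 \<beta>))"
          unfolding q_def b_def using h0[of S \<beta>]
          by (subst (1 2) ennreal_mult[symmetric]) (auto simp: I_def mult_ac intro!: ennreal_leI)
      qed
      also have "\<dots> = ennreal ((I S + exp (- W)) * exp (E - l * norm1 p \<beta>0)) *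
          (\<integral>\<^sup>+\<beta>. ennreal (exp (l * norm1 p \<beta> - l / 2 * ?b1 \<beta>)) \<partial>model p l S)"
        by (rule nn_integral_cmult) measurable
      also have "\<dots> \<le> ennreal ((I S + exp (- W)) * exp (E - l * norm1 p \<beta>0)) * ennreal (2 ^ card S)"
        by (intro mult_left_mono nn_integral_model_exp_norm1[OF l S]) simp
      finally show ?thesis by (simp add: ennreal_mult[symmetric] I_def)
    qed
    have "(\<integral>\<^sup>+Y. G Y \<partial>?D) = (\<integral>\<^sup>+Y. ennreal (bad Y) \<partial>?D) +
        ennreal Kc * (\<Sum>S\<in>Pow {..<p}. ennreal (w S * c S) * (\<integral>\<^sup>+Y. H S Y \<partial>?D))"
      unfolding G_def by (simp add: nn_integral_add nn_integral_cmult nn_integral_sum)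
    also have "\<dots> \<le> ennreal ((1 + 2 / real p ^ 4) ^ p - 1) +
        ennreal Kc * (\<Sum>S\<in>Pow {..<p}. ennreal (w S * c S) * ennreal ((I S + exp (- W)) * exp (E - l * norm1 p \<beta>0) * 2 ^ card S))"
      using HI by (intro add_mono bad_int mult_left_mono sum_mono) auto
    also have "(\<Sum>S\<in>Pow {..<p}. ennreal (w S * c S) * ennreal ((I S + exp (- W)) * exp (E - l * norm1 p \<beta>0) * 2 ^ card S)) =
       ennreal (\<Sum>S\<in>Pow {..<p}. (w S * c S) * ((I S + exp (- W)) * exp (E - l * norm1 p \<beta>0) * 2 ^ card S))"
      using w c0 by (subst sum_ennreal[symmetric]) (auto simp: ennreal_mult[symmetric] I_def intro!: mult_nonneg_nonneg)
    also have "ennreal Kc * \<dots> = ennreal T"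
    proof -
      have "Kc * (\<Sum>S\<in>Pow {..<p}. (w S * c S) * ((I S + exp (- W)) * exp (E - l * norm1 p \<beta>0) * 2 ^ card S)) =
        Kc * exp (E - l * norm1 p \<beta>0) * (\<Sum>S\<in>Pow {..<p}. w S * c S * (I S + exp (- W)) * 2 ^ card S)"
        by (simp add: sum_distrib_left mult_ac)
      also have "Kc * exp (E - l * norm1 p \<beta>0) = exp E / (w ?S0 * evidence_const n p X l s)"
        unfolding Kc_def \<kappa>_def by (simp add: exp_diff exp_minus field_simps)
      also have "\<dots> * (\<Sum>S\<in>Pow {..<p}. w S * c S * (I S + exp (- W)) * 2 ^ card S) = T"
        unfolding T_def E_def w_def c_def I_def ..
      finally show ?thesis using Kc by (simp add: ennreal_mult'[symmetric])
    qed
    also have "ennreal ((1 + 2 / real p ^ 4) ^ p - 1) + ennreal T = ennreal ((1 + 2 / real p ^ 4) ^ p - 1 + T)"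
    proof (rule ennreal_plus[symmetric])
      show "0 \<le> (1 + 2 / real p ^ 4) ^ p - 1" by simp
      show "0 \<le> T" unfolding T_def using evidence_const_pos[OF l X, of s] w0 weight_nonneg
        by (intro mult_nonneg_nonneg sum_nonneg divide_nonneg_nonneg) (auto simp: less_imp_le)
    qed
    finally show "(\<integral>\<^sup>+Y. G Y \<partial>?D) \<le> ennreal ((1 + 2 / real p ^ 4) ^ p - 1 + T)" .
  qed
qed

subsection \<open>The prior on the model size\<close>

text \<open>A single term of the exponential series; it is applied as s^s / s! <= e^s.\<close>

lemma power_le_exp_fact:
  fixes x :: real
  assumes "0 \<le> x"
  shows "x ^ n / fact n \<le> exp x"
proof -
  have "sum (\<lambda>k. x ^ k /\<^sub>R fact k) {n} \<le> (\<Sum>k. x ^ k /\<^sub>R fact k)"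
    using assms by (intro sum_le_suminf summable_exp_generic) auto
  then show ?thesis by (simp add: exp_def divide_inverse mult.commute)
qed

lemma sum_weight:
  "(\<Sum>S\<in>Pow {..<p}. weight p \<pi> S * g (card S)) = (\<Sum>s\<le>p. pmf \<pi> s * g s)"
proof -
  have "(\<Sum>S\<in>Pow {..<p}. weight p \<pi> S * g (card S)) =
     (\<Sum>s\<le>p. real (p choose s) * (pmf \<pi> s / real (p choose s) * g s))"
    using sum_Pow_card[of "{..<p}" "\<lambda>s. pmf \<pi> s / real (p choose s) * g s"] by (simp add: weight_def)
  also have "\<dots> = (\<Sum>s\<le>p. pmf \<pi> s * g s)"
    by (intro sum.cong) auto
  finally show ?thesis .
qed

text \<open>The lower bound on \<open>l\<close> turns the volume factor into (p s)^s. Then (p choose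
  s) s! <= p^s and s^s / s! <= e^s leave p^(2 s), up to two corrections of at most p^(s/16); hence
  17/8.\<close>

lemma binomial_evidence_const_le:
  assumes X: "Xnorm n p X > 0" and p: "p \<ge> 2" and s: "1 \<le> s"
    and l: "Xnorm n p X / real p \<le> l" "l \<le> 2 * lbar n p X" "l > 0"
    and large: "exp (1 / 2 + 4 * sqrt (ln (real p))) \<le> real p powr (1 / 16)" "exp 1 \<le> real p powr (1 / 16)"
  shows "real (p choose s) / evidence_const n p X l s \<le> real p powr (17 / 8 * real s)"
proof -
  define x where "x = Xnorm n p X"
  have p1: "real p \<ge> 1" using p by simp
  have s1: "real s \<ge> 1" using s by simp
  have x: "x > 0" using X by (simp add: x_def)
  have lx: "l / x \<le> 4 * sqrt (ln (real p))"
    using l(2) x by (simp add: x_def lbar_def divide_le_eq mult_ac)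
  have xl: "x / l \<le> real p" using l x p1 by (simp add: x_def divide_le_eq field_simps)
  have "real (p choose s) / evidence_const n p X l s =
     real (p choose s) * (x * real s / l) ^ s * (exp (1 / 2) * exp (l / x))"
    using l x s by (simp add: evidence_const_def x_def[symmetric] exp_minus power_divide field_simps)
  also have "\<dots> \<le> real (p choose s) * (real p * real s) ^ s * (real p powr (1 / 16 * real s))"
  proof (intro mult_mono power_mono)
    have "x / l * real s \<le> real p * real s" using xl by (intro mult_right_mono) auto
    then show "x * real s / l \<le> real p * real s" by simp
    have "exp (1 / 2) * exp (l / x) \<le> exp (1 / 2 + 4 * sqrt (ln (real p)))"
      using lx by (simp add: exp_add)
    also have "\<dots> \<le> real p powr (1 / 16)" by (rule large)
    also have "\<dots> \<le> real p powr (1 / 16 * real s)" using p1 s1 by (intro powr_mono) auto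
    finally show "exp (1 / 2) * exp (l / x) \<le> real p powr (1 / 16 * real s)" .
  qed (use x l in auto)
  also have "real (p choose s) * (real p * real s) ^ s = (real (p choose s) * fact s) * real p ^ s * (real s ^ s / fact s)"
    by (simp add: power_mult_distrib)
  also have "\<dots> \<le> real p ^ s * real p ^ s * exp (real s)"
  proof (intro mult_mono power_le_exp_fact)
    have "real ((p choose s) * fact s) \<le> real (p ^ s)"
      using binomial_fact_pow[of p s] by (simp only: of_nat_le_iff)
    then show "real (p choose s) * fact s \<le> real p ^ s" by simp
  qed auto
  also have "exp (real s) \<le> real p powr (1 / 16 * real s)"
  proof -
    have "exp (real s) = exp 1 powr (real s)" by (simp add: powr_def)
    also have "\<dots> \<le> (real p powr (1 / 16)) powr real s" using large(2) by (intro powr_mono2) auto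
    finally show ?thesis by (simp add: powr_powr)
  qed
  finally have "real (p choose s) / evidence_const n p X l s \<le>
     real p ^ s * real p ^ s * real p powr (1 / 16 * real s) * real p powr (1 / 16 * real s)"
    by (simp add: mult_right_mono mult_left_mono)
  also have "\<dots> = real p powr (real s + real s + 1 / 16 * real s + 1 / 16 * real s)"
  proof -
    have "real p ^ s = real p powr real s" using p by (simp add: powr_realpow)
    then show ?thesis by (simp only: powr_add)
  qed
  also have "real s + real s + 1 / 16 * real s + 1 / 16 * real s = 17 / 8 * real s" by simp
  finally show ?thesis .
qed

section \<open>Summing the tilted prior over model sizes\<close>

text \<open>This is 16 \<delta>. The first bound keeps 2 \<open>tilt\<close> below A4 / 18, so 17/18
  of the prior's decay survives; the second keeps three times \<open>tilt\<close> below 3/8 in the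
  exponent count of \<open>far_set_rate\<close>.\<close>

definition tilt :: "real \<Rightarrow> real" where
  "tilt A4 = min (1 / 36 * A4) (1 / 8)"

text \<open>The explicit meaning of large p up to the final limits: constants, and factors exp (c *
  sqrt (ln p)), are dominated by small powers of p.\<close>

definition large_size :: "real \<Rightarrow> real \<Rightarrow> real \<Rightarrow> nat \<Rightarrow> bool" where
  "large_size A1 A2 A4 p \<longleftrightarrow> p \<ge> 2 \<and> exp (1 / 2 + 4 * sqrt (ln (real p))) \<le> real p powr (1 / 16) \<and>
     exp 1 \<le> real p powr (1 / 16) \<and> 2 \<le> real p powr tilt A4 \<and> 4 * A2 \<le> real p powr tilt A4 \<and> 1 / A1 \<le> real p"

text \<open>A single p is fixed here; all bounds inside are nonasymptotic.\<close>

locale size_prior =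
  fixes A1 A2 A3 A4 :: real and p :: nat and \<pi> :: "nat pmf"
  assumes A_pos: "A1 > 0" "A2 > 0" "A3 > 0" "A4 > 0"
    and supp_\<pi>: "set_pmf \<pi> \<subseteq> {0..p}"
    and \<pi>_lower: "\<And>s. 1 \<le> s \<Longrightarrow> s \<le> p \<Longrightarrow> A1 * real p powr (- A3) * pmf \<pi> (s - 1) \<le> pmf \<pi> s"
    and \<pi>_upper: "\<And>s. 1 \<le> s \<Longrightarrow> s \<le> p \<Longrightarrow> pmf \<pi> s \<le> A2 * real p powr (- A4) * pmf \<pi> (s - 1)"
begin

lemma pmf_ratio_upper: "s0 \<le> s \<Longrightarrow> s \<le> p \<Longrightarrow> pmf \<pi> s \<le> (A2 * real p powr (- A4)) ^ (s - s0) * pmf \<pi> s0"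
proof (induction "s - s0" arbitrary: s)
  case 0
  then show ?case by simp
next
  case (Suc m)
  then obtain s' where s': "s = Suc s'" by (cases s) auto
  have "pmf \<pi> s \<le> A2 * real p powr (- A4) * pmf \<pi> s'"
    using \<pi>_upper[of s] Suc.prems s' by simp
  also have "\<dots> \<le> A2 * real p powr (- A4) * ((A2 * real p powr (- A4)) ^ (s' - s0) * pmf \<pi> s0)"
    using Suc s' A_pos by (intro mult_left_mono Suc.hyps) auto
  also have "\<dots> = (A2 * real p powr (- A4)) ^ (s - s0) * pmf \<pi> s0"
    using Suc.hyps(2) s' by (simp add: Suc_diff_le)
  finally show ?case .
qed

lemma pmf_ratio_lower: "s \<le> s0 \<Longrightarrow> s0 \<le> p \<Longrightarrow> p > 0 \<Longrightarrow> pmf \<pi> s \<le> (real p powr A3 / A1) ^ (s0 - s) * pmf \<pi> s0"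
proof (induction "s0 - s" arbitrary: s)
  case 0
  then show ?case by simp
next
  case (Suc m)
  have le: "A1 * real p powr (- A3) * pmf \<pi> s \<le> pmf \<pi> (Suc s)"
    using \<pi>_lower[of "Suc s"] Suc.prems Suc.hyps(2) by simp
  have pp: "real p powr A3 > 0" using Suc.prems by simp
  have "pmf \<pi> s = (real p powr A3 / A1) * (A1 * real p powr (- A3) * pmf \<pi> s)"
    using A_pos pp by (simp add: powr_minus field_simps)
  also have "\<dots> \<le> (real p powr A3 / A1) * pmf \<pi> (Suc s)"
    using le A_pos by (intro mult_left_mono) auto
  also have "\<dots> \<le> (real p powr A3 / A1) * ((real p powr A3 / A1) ^ (s0 - Suc s) * pmf \<pi> s0)"
    using Suc A_pos by (intro mult_left_mono Suc.hyps) auto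
  also have "\<dots> = (real p powr A3 / A1) ^ (s0 - s) * pmf \<pi> s0"
    using Suc.hyps(2) by (simp add: Suc_diff_Suc[symmetric] del: Suc_diff_Suc)
  finally show ?case .
qed

text \<open>A zero would spread upwards by the upper ratio and downwards by the lower one, leaving
  no mass at all.\<close>

lemma pmf_pos:
  assumes p: "p > 0" and s: "s \<le> p"
  shows "pmf \<pi> s > 0"
proof (rule ccontr)
  assume "\<not> pmf \<pi> s > 0"
  then have 0: "pmf \<pi> s = 0" by (simp add: not_less antisym)
  have "pmf \<pi> t = 0" if "t \<le> p" for t
  proof -
    have "pmf \<pi> t \<le> 0"
      using pmf_ratio_upper[of s t] pmf_ratio_lower[of t s] 0 that s p by (cases "s \<le> t") auto
    then show ?thesis by (simp add: antisym)
  qed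
  moreover obtain t where "t \<in> set_pmf \<pi>" using set_pmf_not_empty by fast
  ultimately show False using supp_\<pi> by (auto simp: set_pmf_iff)
qed

abbreviation a :: real where "a \<equiv> tilt A4"

abbreviation large :: bool where "large \<equiv> large_size A1 A2 A4 p"

lemma a_pos: "a > 0" using A_pos by (simp add: tilt_def)

lemma a_le: "a \<le> 1 / 36 * A4" "a \<le> 1 / 8" by (simp_all add: tilt_def)

lemma two_powr_a_le: "large \<Longrightarrow> 2 * real p powr a \<le> real p powr (2 * a)"
proof -
  assume large
  then have "2 * real p powr a \<le> real p powr a * real p powr a"
    by (intro mult_right_mono) (auto simp: large_size_def)
  also have "\<dots> = real p powr (2 * a)" by (simp add: powr_add[symmetric])
  finally show ?thesis .
qed

text \<open>The 2 stems from integrating a slab coordinate, the p^a from tempering. Each size step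
  above \<open>s0\<close> gains p^(2 a - A4) and keeps a spare 1/2 for geometric summation.\<close>

lemma tilted_upper:
  assumes L: large and s: "s0 \<le> s" "s \<le> p"
  shows "pmf \<pi> s * (2 * real p powr a) ^ s \<le>
    pmf \<pi> s0 * real p powr (2 * a * real s0) * ((real p powr (2 * a - A4)) ^ (s - s0) * (1 / 2) ^ (s - s0))"
proof -
  have p: "real p > 0" using L by (simp add: large_size_def)
  have pa: "2 * real p powr a \<le> real p powr (2 * a)"
    by (rule two_powr_a_le[OF L])
  have B: "A2 * real p powr (- A4) * (2 * real p powr a) \<le> real p powr (2 * a - A4) * (1 / 2)"
  proof -
    have "A2 * real p powr (- A4) * (2 * real p powr a) = (4 * A2) * (real p powr a * real p powr (- A4) * (1 / 2))"
      by simp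
    also have "\<dots> \<le> real p powr a * (real p powr a * real p powr (- A4) * (1 / 2))"
      using L by (intro mult_right_mono) (auto simp: large_size_def)
    also have "\<dots> = real p powr (2 * a - A4) * (1 / 2)"
      by (simp add: powr_add[symmetric])
    finally show ?thesis .
  qed
  have "pmf \<pi> s * (2 * real p powr a) ^ s \<le>
    ((A2 * real p powr (- A4)) ^ (s - s0) * pmf \<pi> s0) * (2 * real p powr a) ^ s"
    using pmf_ratio_upper[OF s] by (intro mult_right_mono) auto
  also have "\<dots> = pmf \<pi> s0 * (2 * real p powr a) ^ s0 * (A2 * real p powr (- A4) * (2 * real p powr a)) ^ (s - s0)"
  proof -
    have "(2 * real p powr a) ^ s = (2 * real p powr a) ^ s0 * (2 * real p powr a) ^ (s - s0)"
      by (metis le_add_diff_inverse power_add s(1))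
    then show ?thesis by (simp only: power_mult_distrib mult_ac)
  qed
  also have "\<dots> \<le> pmf \<pi> s0 * (real p powr (2 * a)) ^ s0 * (real p powr (2 * a - A4) * (1 / 2)) ^ (s - s0)"
    by (rule mult_mono[OF mult_mono[OF order_refl power_mono[OF pa]] power_mono[OF B]]) (use A_pos in auto)
  also have "(real p powr (2 * a)) ^ s0 = real p powr (2 * a * real s0)"
    using p by (simp add: powr_realpow[symmetric] powr_powr)
  finally show ?thesis by (simp only: power_mult_distrib)
qed

lemma powr_power: "real p > 0 \<Longrightarrow> (real p powr y) ^ m = real p powr (y * real m)"
  by (simp add: powr_realpow[symmetric] powr_powr)

text \<open>A bound uniform in s. Below \<open>s0\<close> only the lower ratio is available, which
  costs at most p^(A3 + 1) per missing coordinate.\<close>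

lemma tilted_crude:
  assumes L: large and s: "s \<le> p" "s0 \<le> p"
  shows "pmf \<pi> s * (2 * real p powr a) ^ s \<le> pmf \<pi> s0 * real p powr ((A3 + 1 + 2 * a) * real s0)"
proof (cases "s0 \<le> s")
  case True
  have p: "real p \<ge> 1" using L by (simp add: large_size_def)
  have "(real p powr (2 * a - A4)) ^ (s - s0) * (1 / 2) ^ (s - s0) \<le> 1 * 1"
  proof (intro mult_mono power_le_one)
    have "2 * a - A4 \<le> 0" using a_le A_pos by simp
    then show "real p powr (2 * a - A4) \<le> 1" using p powr_mono[of "2 * a - A4" 0 "real p"] by simp
  qed auto
  then have "pmf \<pi> s0 * real p powr (2 * a * real s0) * ((real p powr (2 * a - A4)) ^ (s - s0) * (1 / 2) ^ (s - s0))
     \<le> pmf \<pi> s0 * real p powr (2 * a * real s0) * 1"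
    by (intro mult_left_mono) auto
  also have "\<dots> \<le> pmf \<pi> s0 * real p powr ((A3 + 1 + 2 * a) * real s0)"
    using p A_pos by (simp, intro mult_left_mono powr_mono) (auto simp: mult_right_mono)
  finally show ?thesis using tilted_upper[OF L True s(1)] by linarith
next
  case False
  have p: "real p \<ge> 1" "p > 0" using L by (auto simp: large_size_def)
  have pa: "2 * real p powr a \<le> real p powr (2 * a)"
    by (rule two_powr_a_le[OF L])
  have r: "real p powr A3 / A1 \<le> real p powr (A3 + 1)"
  proof -
    have "real p powr A3 * (1 / A1) \<le> real p powr A3 * real p" using L by (intro mult_left_mono) (auto simp: large_size_def)
    then show ?thesis using p by (simp add: powr_add)
  qed
  have "pmf \<pi> s * (2 * real p powr a) ^ s \<le> ((real p powr A3 / A1) ^ (s0 - s) * pmf \<pi> s0) * (2 * real p powr a) ^ s"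
    using pmf_ratio_lower[of s s0] False s p by (intro mult_right_mono) auto
  also have "\<dots> \<le> ((real p powr (A3 + 1)) ^ (s0 - s) * pmf \<pi> s0) * (real p powr (2 * a)) ^ s"
    using r pa A_pos by (intro mult_mono power_mono) auto
  also have "\<dots> = pmf \<pi> s0 * (real p powr ((A3 + 1) * real (s0 - s)) * real p powr (2 * a * real s))"
    using p by (simp add: powr_power)
  also have "\<dots> = pmf \<pi> s0 * real p powr ((A3 + 1) * real (s0 - s) + 2 * a * real s)"
    by (simp add: powr_add)
  also have "\<dots> \<le> pmf \<pi> s0 * real p powr ((A3 + 1 + 2 * a) * real s0)"
  proof (intro mult_left_mono powr_mono)
    have "(A3 + 1) * real (s0 - s) \<le> (A3 + 1) * real s0" using A_pos by (intro mult_left_mono) auto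
    moreover have "2 * a * real s \<le> 2 * a * real s0" using a_pos False by (intro mult_left_mono) auto
    ultimately show "(A3 + 1) * real (s0 - s) + 2 * a * real s \<le> (A3 + 1 + 2 * a) * real s0"
      by (simp add: algebra_simps)
  qed (use p in auto)
  finally show ?thesis .
qed

text \<open>There are p + 1 <= p^2 terms, which raises the exponent by 2.\<close>

lemma sum_tilted_crude:
  assumes L: large and s0: "1 \<le> s0" "s0 \<le> p"
  shows "(\<Sum>s\<le>p. pmf \<pi> s * (2 * real p powr a) ^ s) \<le> pmf \<pi> s0 * real p powr ((A3 + 3 + 2 * a) * real s0)"
proof -
  have p: "real p \<ge> 2" using L by (simp add: large_size_def)
  have "(\<Sum>s\<le>p. pmf \<pi> s * (2 * real p powr a) ^ s) \<le> (\<Sum>s\<le>p. pmf \<pi> s0 * real p powr ((A3 + 1 + 2 * a) * real s0))"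
    using tilted_crude[OF L] s0 by (intro sum_mono) auto
  also have "\<dots> = (real p + 1) * (pmf \<pi> s0 * real p powr ((A3 + 1 + 2 * a) * real s0))" by simp
  also have "\<dots> \<le> real p powr (2 * real s0) * (pmf \<pi> s0 * real p powr ((A3 + 1 + 2 * a) * real s0))"
  proof (intro mult_right_mono)
    have "real p * 2 \<le> real p * real p" using p by (intro mult_left_mono) auto
    then have "real p + 1 \<le> real p * real p" using p by linarith
    also have "\<dots> = real p powr 2" using p by (simp add: powr_numeral power2_eq_square)
    also have "\<dots> \<le> real p powr (2 * real s0)" using p s0 by (intro powr_mono) auto
    finally show "real p + 1 \<le> real p powr (2 * real s0)" .
  qed auto
  also have "\<dots> = pmf \<pi> s0 * real p powr ((A3 + 3 + 2 * a) * real s0)"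
    by (simp add: powr_add[symmetric] algebra_simps)
  finally show ?thesis .
qed

text \<open>Beyond \<open>k\<close> the decaying factor is frozen at its value for k - s0 extra
  coordinates; the spare halves then sum to at most 2.\<close>

lemma sum_tilted_tail:
  assumes L: large and s0: "s0 \<le> p" and k: "real s0 \<le> k"
  shows "(\<Sum>s\<le>p. pmf \<pi> s * (2 * real p powr a) ^ s * (if k < real s then 1 else 0))
    \<le> pmf \<pi> s0 * real p powr (2 * a * real s0) * real p powr ((2 * a - A4) * (k - real s0)) * 2"
proof -
  have p: "real p \<ge> 1" using L by (simp add: large_size_def)
  define C where "C = pmf \<pi> s0 * real p powr (2 * a * real s0) * real p powr ((2 * a - A4) * (k - real s0))"
  have C: "C \<ge> 0" by (simp add: C_def)
  have "(\<Sum>s\<le>p. pmf \<pi> s * (2 * real p powr a) ^ s * (if k < real s then 1 else 0))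
     \<le> (\<Sum>s\<in>{..p}. if s0 \<le> s then C * (1 / 2) ^ (s - s0) else 0)"
  proof (intro sum_mono)
    fix s assume s: "s \<in> {..p}"
    show "pmf \<pi> s * (2 * real p powr a) ^ s * (if k < real s then 1 else 0) \<le> (if s0 \<le> s then C * (1 / 2) ^ (s - s0) else 0)"
    proof (cases "k < real s")
      case True
      then have ss: "s0 \<le> s" using k by simp
      have "pmf \<pi> s * (2 * real p powr a) ^ s \<le>
        pmf \<pi> s0 * real p powr (2 * a * real s0) * ((real p powr (2 * a - A4)) ^ (s - s0) * (1 / 2) ^ (s - s0))"
        using s ss by (intro tilted_upper L) auto
      also have "\<dots> \<le> pmf \<pi> s0 * real p powr (2 * a * real s0) * (real p powr ((2 * a - A4) * (k - real s0)) * (1 / 2) ^ (s - s0))"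
      proof (intro mult_left_mono mult_right_mono)
        have "(2 * a - A4) * real (s - s0) \<le> (2 * a - A4) * (k - real s0)"
          using a_le A_pos True ss by (intro mult_left_mono_neg) (auto simp: of_nat_diff)
        then show "(real p powr (2 * a - A4)) ^ (s - s0) \<le> real p powr ((2 * a - A4) * (k - real s0))"
          using p by (simp add: powr_power powr_mono)
      qed auto
      finally show ?thesis using True ss by (simp add: C_def mult_ac)
    qed (use C in auto)
  qed
  also have "\<dots> = (\<Sum>s\<in>{s0..p}. C * (1 / 2) ^ (s - s0))"
    by (rule sum.mono_neutral_cong_right) auto
  also have "\<dots> = C * (\<Sum>j\<le>p - s0. (1 / 2) ^ j)"
    unfolding sum_distrib_left
    by (rule sum.reindex_bij_witness[of _ "\<lambda>j. j + s0" "\<lambda>s. s - s0"]) (use s0 in auto)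
  also have "\<dots> \<le> C * 2"
  proof (intro mult_left_mono C)
    have "(\<Sum>j\<le>m. (1 / 2 :: real) ^ j) = 2 - (1 / 2) ^ m" for m :: nat
      by (induction m) auto
    then show "(\<Sum>j\<le>p - s0. (1 / 2 :: real) ^ j) \<le> 2" by simp
  qed
  finally show ?thesis by (simp add: C_def)
qed

text \<open>One \<open>card S\<close> less than \<open>psi_arg\<close>: the error of a draw of this
  dimension has at most that many more nonzero entries.\<close>

definition dim_bound :: "nat \<Rightarrow> (nat \<Rightarrow> nat \<Rightarrow> real) \<Rightarrow> real \<Rightarrow> nat set \<Rightarrow> real" where
  "dim_bound n X l S = (1 + 3 / A4 + 33 / (compat n p X S)\<^sup>2 * (l / lbar n p X)) * real (card S)"

text \<open>For small \<open>\<lambda>\<close> the prior on the model size beats the bias, whose exponent is quadratic in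
  \<open>\<lambda>\<close>, already beyond \<open>dim_bound\<close>; for larger \<open>\<lambda>\<close> only the vacuous dimension bound \<open>k \<ge> p\<close> is used.\<close>

lemma far_set_rate:
  fixes S :: "nat set" and W k l :: real and X :: "nat \<Rightarrow> nat \<Rightarrow> real" and n :: nat
  defines "s0 \<equiv> card S" and "\<delta> \<equiv> a / 16" and "x \<equiv> l / lbar n p X"
  assumes L: large and X: "Xnorm n p X > 0" and S: "S \<subseteq> {..<p}" "S \<noteq> {}"
    and l: "Xnorm n p X / real p \<le> l" "l \<le> 2 * lbar n p X" "l > 0"
    and phi: "compat n p X S > 0"
    and W: "W = bias n p X l \<delta> S + (7 + A3) * real s0 * ln (real p)"
    and k: "real p \<le> k \<or> (x \<le> \<delta> * A4 / 2 \<and> k = dim_bound n X l S)"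
  shows "exp (bias n p X l \<delta> S) / (weight p \<pi> S * evidence_const n p X l s0) *
     (\<Sum>S'\<in>Pow {..<p}. weight p \<pi> S' * real p powr (16 * \<delta> * real (card S' + s0)) *
        ((if k < real (card S') then 1 else 0) + exp (- W)) * 2 ^ card S')
    \<le> 2 * real p powr (- 1 / 3) + 1 / real p"
proof -
  have p2: "p \<ge> 2" and p: "real p > 1" using L by (auto simp: large_size_def)
  have fS: "finite S" using S finite_subset by auto
  have s0: "1 \<le> s0" "s0 \<le> p"
    using S fS card_mono[of "{..<p}" S] by (auto simp: s0_def card_gt_0_iff Suc_le_eq)
  have lnp: "ln (real p) > 0" using p by simp
  have lb: "lbar n p X > 0" using X p lnp by (simp add: lbar_def)
  have x0: "x > 0" using l lb by (simp add: x_def)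
  define \<phi> where "\<phi> = compat n p X S"
  define P where "P y = real p powr y" for y
  have P_add: "P (y + z) = P y * P z" for y z by (simp add: P_def powr_add)
  have P_pos: "P y > 0" for y using p by (simp add: P_def)
  have P_exp: "exp (y * ln (real p)) = P y" for y using p by (simp add: P_def powr_def)
  have P_mono: "y \<le> z \<Longrightarrow> P y \<le> P z" for y z using p by (simp add: P_def)
  define E where "E = bias n p X l \<delta> S"
  define t where "t s = pmf \<pi> s * (2 * real p powr a) ^ s" for s
  define w where "w = pmf \<pi> s0"
  have w: "w > 0" unfolding w_def using p2 s0 by (intro pmf_pos) auto
  have ch: "real (p choose s0) > 0" using s0 by simp
  define tail where "tail = (\<Sum>s\<le>p. t s * (if k < real s then 1 else 0))"
  have "(\<Sum>S'\<in>Pow {..<p}. weight p \<pi> S' * real p powr (16 * \<delta> * real (card S' + s0)) *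
        ((if k < real (card S') then 1 else 0) + exp (- W)) * 2 ^ card S') =
     (\<Sum>s\<le>p. pmf \<pi> s * (real p powr (16 * \<delta> * real (s + s0)) * ((if k < real s then 1 else 0) + exp (- W)) * 2 ^ s))"
    using sum_weight[of p \<pi> "\<lambda>s. real p powr (16 * \<delta> * real (s + s0)) * ((if k < real s then 1 else 0) + exp (- W)) * 2 ^ s"]
    by (simp only: mult.assoc)
  also have "\<dots> = (\<Sum>s\<le>p. P (a * real s0) * (t s * (if k < real s then 1 else 0) + exp (- W) * t s))"
  proof (intro sum.cong refl)
    fix s
    have "real p powr (16 * \<delta> * real (s + s0)) = P (a * real s0) * (real p powr a) ^ s"
      using p by (simp add: \<delta>_def powr_power P_def powr_add[symmetric] algebra_simps)
    then show "pmf \<pi> s * (real p powr (16 * \<delta> * real (s + s0)) * ((if k < real s then 1 else 0) + exp (- W)) * 2 ^ s)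
       = P (a * real s0) * (t s * (if k < real s then 1 else 0) + exp (- W) * t s)"
      by (simp add: t_def power_mult_distrib algebra_simps)
  qed
  also have "\<dots> = P (a * real s0) * (tail + exp (- W) * (\<Sum>s\<le>p. t s))"
    by (simp add: sum_distrib_left[symmetric] sum.distrib tail_def)
  finally have sum_eq: "(\<Sum>S'\<in>Pow {..<p}. weight p \<pi> S' * real p powr (16 * \<delta> * real (card S' + s0)) *
        ((if k < real (card S') then 1 else 0) + exp (- W)) * 2 ^ card S') = P (a * real s0) * (tail + exp (- W) * (\<Sum>s\<le>p. t s))" .
  have crude: "(\<Sum>s\<le>p. t s) \<le> w * P ((A3 + 3 + 2 * a) * real s0)"
    unfolding t_def w_def P_def by (rule sum_tilted_crude[OF L s0])
  have t0: "0 \<le> t s" for s by (simp add: t_def)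
  have tail0: "0 \<le> tail" unfolding tail_def using t0 by (intro sum_nonneg) auto
  have pre: "exp E / (weight p \<pi> S * evidence_const n p X l s0) \<le> exp E * P (17 / 8 * real s0) / w"
  proof -
    have "real (p choose s0) / evidence_const n p X l s0 \<le> P (17 / 8 * real s0)"
      unfolding P_def using L X p2 s0 l by (intro binomial_evidence_const_le) (auto simp: large_size_def)
    then have "exp E * (real (p choose s0) / evidence_const n p X l s0) / w \<le> exp E * P (17 / 8 * real s0) / w"
      using w by (intro divide_right_mono mult_left_mono) auto
    moreover have "exp E / (weight p \<pi> S * evidence_const n p X l s0) = exp E * (real (p choose s0) / evidence_const n p X l s0) / w"
      using ch w by (simp add: weight_def w_def s0_def[symmetric])
    ultimately show ?thesis by simp
  qed
  have part2: "exp E * P (17 / 8 * real s0) * P (a * real s0) * (exp (- W) * P ((A3 + 3 + 2 * a) * real s0)) \<le> 1 / real p"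
  proof -
    have "exp E * exp (- W) = P (- (7 + A3) * real s0)"
      unfolding W E_def P_exp[symmetric] exp_add[symmetric] by (simp add: algebra_simps)
    then have "exp E * P (17 / 8 * real s0) * P (a * real s0) * (exp (- W) * P ((A3 + 3 + 2 * a) * real s0)) =
      P (- (7 + A3) * real s0 + 17 / 8 * real s0 + a * real s0 + (A3 + 3 + 2 * a) * real s0)"
      unfolding P_add by (simp add: mult_ac)
    also have "\<dots> \<le> P (- 1)"
    proof (rule P_mono)
      have s1: "1 \<le> real s0" using s0 by simp
      \<comment> \<open>The 7 + A3 in the radius pays for everything: -(7 + A3) + 17/8 + a + (A3 + 3
        + 2 a) = 3 a - 15/8, at most -3/2.\<close>
      have "3 * (a * real s0) \<le> 3 / 8 * real s0" using mult_right_mono[OF a_le(2), of "3 * real s0"] by simp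
      moreover have "- (7 + A3) * real s0 + 17 / 8 * real s0 + a * real s0 + (A3 + 3 + 2 * a) * real s0 =
         3 * (a * real s0) - 15 / 8 * real s0" by (simp add: algebra_simps)
      ultimately show "- (7 + A3) * real s0 + 17 / 8 * real s0 + a * real s0 + (A3 + 3 + 2 * a) * real s0 \<le> - 1"
        using s1 by argo
    qed
    also have "P (- 1) = 1 / real p" using p by (simp add: P_def powr_minus_divide)
    finally show ?thesis .
  qed
  have part1: "exp E * P (17 / 8 * real s0) * P (a * real s0) * (tail / w) \<le> 2 * P (- 1 / 3)"
    using k
  proof
    assume "real p \<le> k"
    \<comment> \<open>Model sizes never exceed p.\<close>
    then have "tail = 0" unfolding tail_def by (intro sum.neutral) auto
    then show ?thesis using P_pos[of "- 1 / 3"] by simp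
  next
    assume k: "x \<le> \<delta> * A4 / 2 \<and> k = dim_bound n X l S"
    define y where "y = x / \<phi>\<^sup>2"
    have y0: "y > 0" using x0 phi by (simp add: y_def \<phi>_def)
    have ks: "k - real s0 = (3 / A4 + 33 * y) * real s0"
      using k by (simp add: dim_bound_def y_def \<phi>_def x_def s0_def algebra_simps)
    have "k - real s0 \<ge> 0" unfolding ks using A_pos y0 by simp
    then have "tail \<le> w * P (2 * a * real s0) * P ((2 * a - A4) * (k - real s0)) * 2"
      unfolding tail_def t_def w_def P_def by (intro sum_tilted_tail L s0) auto
    then have tl: "tail / w \<le> P (2 * a * real s0) * P ((2 * a - A4) * (k - real s0)) * 2"
      using w by (simp add: divide_le_eq mult_ac)
    have E: "exp E \<le> P (16 * A4 * y * real s0)"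
    proof -
      have "l = x * lbar n p X" using lb by (simp add: x_def)
      then have lx: "l = x * (2 * Xnorm n p X * sqrt (ln (real p)))" by (simp only: lbar_def)
      have l2: "l\<^sup>2 = x\<^sup>2 * (4 * (Xnorm n p X)\<^sup>2 * ln (real p))"
        unfolding lx using lnp by (simp add: power_mult_distrib)
      have \<delta>: "\<delta> > 0" using a_pos by (simp add: \<delta>_def)
      have "E = (32 * x\<^sup>2 / \<delta>) / \<phi>\<^sup>2 * real s0 * ln (real p)"
        unfolding E_def bias_def l2 using X \<delta> by (simp add: \<phi>_def[symmetric] s0_def[symmetric])
      also have "32 * x\<^sup>2 / \<delta> = 32 / \<delta> * x * x" by (simp add: power2_eq_square)
      \<comment> \<open>One of the two factors x is traded for the threshold, making the bias linear
        in x and so comparable with the dimension term.\<close>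
      also have "32 / \<delta> * x * x / \<phi>\<^sup>2 * real s0 * ln (real p) \<le> 32 / \<delta> * x * (\<delta> * A4 / 2) / \<phi>\<^sup>2 * real s0 * ln (real p)"
        using k x0 \<delta> lnp by (intro mult_right_mono divide_right_mono mult_left_mono) auto
      also have "\<dots> = (16 * A4 * y * real s0) * ln (real p)" using \<delta> by (simp add: y_def)
      finally show ?thesis unfolding P_exp[symmetric] by simp
    qed
    have "exp E * P (17 / 8 * real s0) * P (a * real s0) * (tail / w) \<le>
       P (16 * A4 * y * real s0) * P (17 / 8 * real s0) * P (a * real s0) * (P (2 * a * real s0) * P ((2 * a - A4) * (k - real s0)) * 2)"
      using tl E P_pos tail0 w by (intro mult_mono) (auto simp: less_imp_le intro!: mult_nonneg_nonneg)
    also have "\<dots> = 2 * P (16 * A4 * y * real s0 + 17 / 8 * real s0 + a * real s0 + 2 * a * real s0 + (2 * a - A4) * (k - real s0))"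
      unfolding P_add by (simp add: mult_ac)
    also have "\<dots> \<le> 2 * P (- 1 / 3)"
    proof (intro mult_left_mono P_mono)
      \<comment> \<open>At least 17/18 of A4 multiplies 3 / A4 + 33 y. The gain 187/6 beats the bias
        16 in the y term, and -17/6 + 17/8 + 3/8 = -1/3 remains.\<close>
      have "(2 * a - A4) * (k - real s0) \<le> (- 17 / 18 * A4) * (k - real s0)"
        using a_le \<open>k - real s0 \<ge> 0\<close> by (intro mult_right_mono) auto
      also have "\<dots> = - 17 / 6 * real s0 - 187 / 6 * (A4 * y * real s0)"
        unfolding ks using A_pos by (simp add: field_simps)
      finally have 1: "(2 * a - A4) * (k - real s0) \<le> - 17 / 6 * real s0 - 187 / 6 * (A4 * y * real s0)" .
      have 2: "a * real s0 \<le> 1 / 8 * real s0" using a_le by (intro mult_right_mono) auto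
      have 3: "0 \<le> A4 * y * real s0" using A_pos y0 by simp
      have 4: "1 \<le> real s0" using s0 by simp
      have "16 * A4 * y * real s0 = 16 * (A4 * y * real s0)" "2 * a * real s0 = 2 * (a * real s0)" by simp_all
      then show "16 * A4 * y * real s0 + 17 / 8 * real s0 + a * real s0 + 2 * a * real s0 + (2 * a - A4) * (k - real s0) \<le> - 1 / 3"
        using 1 2 3 4 by argo
    qed simp
    finally show ?thesis .
  qed
  have "exp E / (weight p \<pi> S * evidence_const n p X l s0) * (P (a * real s0) * (tail + exp (- W) * (\<Sum>s\<le>p. t s)))
     \<le> exp E * P (17 / 8 * real s0) / w * (P (a * real s0) * (tail + exp (- W) * (w * P ((A3 + 3 + 2 * a) * real s0))))"
    using pre crude P_pos w tail0 t0
    by (intro mult_mono add_left_mono mult_left_mono) (auto simp: less_imp_le intro!: mult_nonneg_nonneg add_nonneg_nonneg sum_nonneg)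
  also have "\<dots> = exp E * P (17 / 8 * real s0) * P (a * real s0) * (tail / w) +
     exp E * P (17 / 8 * real s0) * P (a * real s0) * (exp (- W) * P ((A3 + 3 + 2 * a) * real s0))"
    using w by (simp add: field_simps)
  also have "\<dots> \<le> 2 * P (- 1 / 3) + 1 / real p" by (intro add_mono part1 part2)
  finally show ?thesis unfolding sum_eq E_def[symmetric] P_def .
qed

end

text \<open>The chi-square failure plus the bound of \<open>far_set_rate\<close>.\<close>

definition noise_rate :: "nat \<Rightarrow> real" where
  "noise_rate p = (1 + 2 / real p ^ 4) ^ p - 1 + (2 * real p powr (- 1 / 3) + 1 / real p)"

lemma noise_rate_tendsto: "noise_rate \<longlonglongrightarrow> 0"
proof -
  have "(\<lambda>p. (1 + 2 / real p ^ 4) ^ p) \<longlonglongrightarrow> 1"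
    by real_asymp
  moreover have "(\<lambda>p. 2 * real p powr (- 1 / 3) + 1 / real p) \<longlonglongrightarrow> 0" by real_asymp
  ultimately have "(\<lambda>p. (1 + 2 / real p ^ 4) ^ p - 1 + (2 * real p powr (- 1 / 3) + 1 / real p)) \<longlonglongrightarrow> 1 - 1 + 0"
    by (intro tendsto_intros)
  then show ?thesis by (simp add: noise_rate_def[abs_def])
qed

lemma eventually_large:
  assumes "A1 > 0" "A4 > 0"
  shows "eventually (\<lambda>p. large_size A1 A2 A4 p) at_top"
proof -
  have a: "min (1 / 36 * A4) (1 / 8) > 0" using assms by simp
  have "eventually (\<lambda>p::nat. p \<ge> 2) at_top" by (rule eventually_ge_at_top)
  moreover have "eventually (\<lambda>p. exp (1 / 2 + 4 * sqrt (ln (real p))) \<le> real p powr (1 / 16)) at_top" by real_asymp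
  moreover have "eventually (\<lambda>p. exp 1 \<le> real p powr (1 / 16)) at_top" by real_asymp
  moreover have "filterlim (\<lambda>p. real p powr min (1 / 36 * A4) (1 / 8)) at_top at_top"
    using a by real_asymp
  then have "eventually (\<lambda>p. max 2 (4 * A2) \<le> real p powr min (1 / 36 * A4) (1 / 8)) at_top"
    by (simp only: filterlim_at_top)
  moreover have "eventually (\<lambda>p. 1 / A1 \<le> real p) at_top" by real_asymp
  ultimately show ?thesis
    by eventually_elim (auto simp: large_size_def tilt_def)
qed

subsection \<open>Compatibility numbers and sparse eigenvalues\<close>

text \<open>Averaging over random signs would give equality. Choosing each sign so that its cross
  term is nonpositive makes this constructive.\<close>

lemma exists_signs_norm2_le:
  fixes x :: "'a \<Rightarrow> nat \<Rightarrow> real"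
  assumes "finite S"
  shows "\<exists>\<sigma>. (\<forall>j. \<sigma> j = 1 \<or> \<sigma> j = -1) \<and>
    (norm2 n (\<lambda>i. \<Sum>j\<in>S. \<sigma> j * x j i))\<^sup>2 \<le> (\<Sum>j\<in>S. (norm2 n (x j))\<^sup>2)"
  using assms
proof (induction S)
  case empty
  show ?case by (intro exI[of _ "\<lambda>_. 1"]) (simp add: norm2_def)
next
  case (insert k S)
  then obtain \<sigma> :: "'a \<Rightarrow> real" where \<sigma>: "\<And>j. \<sigma> j = 1 \<or> \<sigma> j = -1"
    and le: "(norm2 n (\<lambda>i. \<Sum>j\<in>S. \<sigma> j * x j i))\<^sup>2 \<le> (\<Sum>j\<in>S. (norm2 n (x j))\<^sup>2)" by blast
  define v where "v = (\<lambda>i. \<Sum>j\<in>S. \<sigma> j * x j i)"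
  define e :: real where "e = (if dot n v (x k) \<le> 0 then 1 else -1)"
  have e: "e * dot n v (x k) \<le> 0" "e * e = 1" by (auto simp: e_def)
  have sum: "(\<Sum>j\<in>insert k S. (\<sigma>(k := e)) j * x j i) = e * x k i + v i" for i
    using insert.hyps by (simp add: v_def) (intro sum.cong, auto)
  have "(norm2 n (\<lambda>i. \<Sum>j\<in>insert k S. (\<sigma>(k := e)) j * x j i))\<^sup>2 =
     (norm2 n (x k))\<^sup>2 + 2 * (e * dot n v (x k)) + (norm2 n v)\<^sup>2"
    unfolding sum norm2_power2
    by (simp add: dot_add_left dot_add_right dot_scale_left dot_scale_right dot_commute[of n "x k" v] e mult.assoc[symmetric])
  also have "\<dots> \<le> (norm2 n (x k))\<^sup>2 + (norm2 n v)\<^sup>2" using e by simp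
  also have "\<dots> \<le> (\<Sum>j\<in>insert k S. (norm2 n (x j))\<^sup>2)" using le insert.hyps by (simp add: v_def)
  finally have "(norm2 n (\<lambda>i. \<Sum>j\<in>insert k S. (\<sigma>(k := e)) j * x j i))\<^sup>2 \<le> (\<Sum>j\<in>insert k S. (norm2 n (x j))\<^sup>2)" .
  moreover have "\<forall>j. (\<sigma>(k := e)) j = 1 \<or> (\<sigma>(k := e)) j = -1" using \<sigma> by (auto simp: e_def)
  ultimately show ?case by blast
qed

text \<open>A unit vector would only give sqrt |S|; a sign vector spread over S makes the l1 norm
  |S| while the image has norm at most |X| sqrt |S|. The lemma lets terms without 1 / \<phi>^2 be
  absorbed into those with it.\<close>

lemma compat_le_1:
  assumes X: "Xnorm n p X > 0" and S: "S \<subseteq> {..<p}" "S \<noteq> {}"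
  shows "compat n p X S \<le> 1"
proof -
  have fS: "finite S" using S finite_subset by auto
  have s: "card S > 0" using S fS by (simp add: card_gt_0_iff)
  obtain \<sigma> :: "nat \<Rightarrow> real" where \<sigma>: "\<And>j. \<sigma> j = 1 \<or> \<sigma> j = -1"
    and le: "(norm2 n (\<lambda>i. \<Sum>j\<in>S. \<sigma> j * X i j))\<^sup>2 \<le> (\<Sum>j\<in>S. (colnorm n X j)\<^sup>2)"
    using exists_signs_norm2_le[OF fS, of n "\<lambda>j i. X i j"] unfolding colnorm_def by blast
  define b where "b j = (if j \<in> S then \<sigma> j else 0)" for j
  have ab: "\<bar>b j\<bar> = (if j \<in> S then 1 else 0)" for j using \<sigma>[of j] by (auto simp: b_def)
  have sb: "(\<Sum>i\<in>S. \<bar>b i\<bar>) = real (card S)" by (simp add: ab)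
  have eq: "mat_vec p X b = (\<lambda>i. \<Sum>j\<in>S. \<sigma> j * X i j)"
    using mat_vec_subset[OF S(1), of b X] by (simp add: b_def)
  have "compat n p X S \<le> norm2 n (mat_vec p X b) * sqrt (real (card S)) / (Xnorm n p X * (\<Sum>i\<in>S. \<bar>b i\<bar>))"
  proof (rule compat_le[OF X])
    have "(\<Sum>i\<in>{..<p} - S. \<bar>b i\<bar>) = 0" by (intro sum.neutral) (auto simp: ab)
    then show "(\<Sum>i\<in>{..<p} - S. \<bar>b i\<bar>) \<le> 7 * (\<Sum>i\<in>S. \<bar>b i\<bar>)" by (simp add: sb)
    obtain i where "i \<in> S" using S by auto
    moreover from this have "b i \<noteq> 0" using ab[of i] by auto
    ultimately show "\<exists>i\<in>S. b i \<noteq> 0" by blast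
  qed
  also have "\<dots> \<le> (Xnorm n p X * sqrt (real (card S))) * sqrt (real (card S)) / (Xnorm n p X * (\<Sum>i\<in>S. \<bar>b i\<bar>))"
  proof (intro divide_right_mono mult_right_mono)
    have "(\<Sum>j\<in>S. (colnorm n X j)\<^sup>2) \<le> (\<Sum>j\<in>S. (Xnorm n p X)\<^sup>2)"
      using S by (intro sum_mono power_mono colnorm_le_Xnorm colnorm_nonneg) auto
    also have "\<dots> = (Xnorm n p X * sqrt (real (card S)))\<^sup>2" by (simp add: power_mult_distrib)
    finally have "(norm2 n (mat_vec p X b))\<^sup>2 \<le> (Xnorm n p X * sqrt (real (card S)))\<^sup>2"
      using le unfolding eq by linarith
    then show "norm2 n (mat_vec p X b) \<le> Xnorm n p X * sqrt (real (card S))"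
      by (rule power2_le_imp_le) (intro mult_nonneg_nonneg Xnorm_nonneg, simp)
  qed (use X in \<open>auto simp: sb\<close>)
  also have "\<dots> = 1" unfolding sb mult.assoc using X s by simp
  finally show ?thesis .
qed

lemma norm1_pos: "card (supp p b) \<noteq> 0 \<Longrightarrow> norm1 p b > 0"
proof -
  assume "card (supp p b) \<noteq> 0"
  then obtain i where "i < p" "b i \<noteq> 0" by (auto simp: supp_def)
  then have "0 < \<bar>b i\<bar>" "\<bar>b i\<bar> \<le> norm1 p b" unfolding norm1_def by (auto intro: member_le_sum)
  then show ?thesis by linarith
qed

lemma norm2_pos: "card (supp p b) \<noteq> 0 \<Longrightarrow> norm2 p b > 0"
proof -
  assume "card (supp p b) \<noteq> 0"
  then obtain i where "i < p" "b i \<noteq> 0" by (auto simp: supp_def)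
  then have "0 < (b i)\<^sup>2" "(b i)\<^sup>2 \<le> (\<Sum>i<p. (b i)\<^sup>2)" by (auto intro!: member_le_sum)
  then have "0 < (\<Sum>i<p. (b i)\<^sup>2)" by linarith
  then show ?thesis by (simp add: norm2_def)
qed

lemma phibar_le:
  assumes X: "Xnorm n p X > 0" and b: "card (supp p b) \<noteq> 0" "real (card (supp p b)) \<le> s"
  shows "phibar n p X s * (Xnorm n p X * norm1 p b) \<le> norm2 n (mat_vec p X b) * sqrt (real (card (supp p b)))"
proof -
  have "phibar n p X s \<le> norm2 n (mat_vec p X b) * sqrt (real (card (supp p b))) / (Xnorm n p X * norm1 p b)"
    unfolding phibar_def
  proof (rule cInf_lower)
    show "bdd_below {norm2 n (mat_vec p X \<beta>) * sqrt (real (card (supp p \<beta>))) / (Xnorm n p X * norm1 p \<beta>) |\<beta>.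
        card (supp p \<beta>) \<noteq> 0 \<and> real (card (supp p \<beta>)) \<le> s}"
    proof (rule bdd_belowI[of _ 0], clarify)
      fix \<beta> :: "nat \<Rightarrow> real"
      show "0 \<le> norm2 n (mat_vec p X \<beta>) * sqrt (real (card (supp p \<beta>))) / (Xnorm n p X * norm1 p \<beta>)"
        unfolding norm1_def
        by (intro divide_nonneg_nonneg mult_nonneg_nonneg sum_nonneg norm2_nonneg Xnorm_nonneg) auto
    qed
  qed (use b in blast)
  then show ?thesis using X norm1_pos[OF b(1)] by (simp add: pos_le_divide_eq)
qed

lemma phitil_le:
  assumes X: "Xnorm n p X > 0" and b: "real (card (supp p b)) \<le> s"
  shows "phitil n p X s * (Xnorm n p X * norm2 p b) \<le> norm2 n (mat_vec p X b)"
proof (cases "card (supp p b) = 0")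
  case True
  then have "supp p b = {}" by (simp add: supp_def)
  then have "norm2 p b = 0" by (auto simp: norm2_def supp_def)
  then show ?thesis by (simp add: norm2_nonneg)
next
  case False
  have "phitil n p X s \<le> norm2 n (mat_vec p X b) / (Xnorm n p X * norm2 p b)"
    unfolding phitil_def
  proof (rule cInf_lower)
    show "bdd_below {norm2 n (mat_vec p X \<beta>) / (Xnorm n p X * norm2 p \<beta>) |\<beta>.
        card (supp p \<beta>) \<noteq> 0 \<and> real (card (supp p \<beta>)) \<le> s}"
    proof (rule bdd_belowI[of _ 0], clarify)
      fix \<beta> :: "nat \<Rightarrow> real"
      show "0 \<le> norm2 n (mat_vec p X \<beta>) / (Xnorm n p X * norm2 p \<beta>)"
        by (intro divide_nonneg_nonneg mult_nonneg_nonneg norm2_nonneg Xnorm_nonneg)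
    qed
  qed (use b False in blast)
  then show ?thesis using X norm2_pos[OF False] by (simp add: pos_le_divide_eq)
qed

lemma unit_vector:
  assumes "j < p"
  defines "b \<equiv> (\<lambda>i. if i = j then 1 else 0 :: real)"
  shows "supp p b = {j}" "norm1 p b = 1" "norm2 p b = 1" "norm2 n (mat_vec p X b) = colnorm n X j"
proof -
  show "supp p b = {j}" using assms by (auto simp: supp_def)
  have "norm1 p b = (\<Sum>i<p. if i = j then 1 else 0)" unfolding norm1_def b_def by (intro sum.cong) auto
  then show "norm1 p b = 1" using assms by simp
  have "(\<Sum>i<p. (b i)\<^sup>2) = (\<Sum>i<p. if i = j then 1 else 0)" unfolding b_def by (intro sum.cong) auto
  then show "norm2 p b = 1" using assms by (simp add: norm2_def)
  have "mat_vec p X b = (\<lambda>i. X i j)"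
    using mat_vec_subset[of "{j}" p b X] assms by (simp add: b_def)
  then show "norm2 n (mat_vec p X b) = colnorm n X j" by (simp add: colnorm_def)
qed

lemma Xnorm_attained:
  assumes "Xnorm n p X > 0"
  obtains j where "j < p" "colnorm n X j = Xnorm n p X"
proof -
  have "Xnorm n p X \<in> insert 0 (colnorm n X ` {..<p})" unfolding Xnorm_def by (rule Max_in) auto
  then show ?thesis using assms that by auto
qed

text \<open>Tested on the unit vector of a longest column.\<close>

lemma phibar_le_1:
  assumes X: "Xnorm n p X > 0" and s: "1 \<le> s"
  shows "phibar n p X s \<le> 1"
proof -
  obtain j where j: "j < p" "colnorm n X j = Xnorm n p X" using Xnorm_attained[OF X] .
  show ?thesis using phibar_le[OF X, of "\<lambda>i. if i = j then 1 else 0" s] s X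
    by (simp add: unit_vector[OF j(1)] j(2))
qed

lemma phitil_le_1:
  assumes X: "Xnorm n p X > 0" and s: "1 \<le> s"
  shows "phitil n p X s \<le> 1"
proof -
  obtain j where j: "j < p" "colnorm n X j = Xnorm n p X" using Xnorm_attained[OF X] .
  show ?thesis using phitil_le[OF X, of "\<lambda>i. if i = j then 1 else 0" s] s X
    by (simp add: unit_vector[OF j(1)] j(2))
qed

text \<open>A lower bound on the sparse eigenvalue prevents short columns; this gives the curvature
  in each coordinate direction needed for the sup norm.\<close>

lemma colnorm_ge_phitil:
  assumes X: "Xnorm n p X > 0" and s: "1 \<le> s" and j: "j < p"
  shows "phitil n p X s * Xnorm n p X \<le> colnorm n X j"
  using phitil_le[OF X, of "\<lambda>i. if i = j then 1 else 0" s] s unfolding unit_vector[OF j] by simp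

text \<open>Maurey's empirical method: \<open>b\<close> is the mean of the \<open>\<ell>\<^sub>1\<close>-scaled signed unit vectors drawn with
  probabilities \<open>\<bar>b\<^sub>j\<bar> / \<parallel>b\<parallel>\<^sub>1\<close>, and sums of \<open>m\<close> draws are \<open>m\<close>-sparse.\<close>

lemma sparse_eigenvalue_transfer:
  assumes c: "0 \<le> c" and m: "1 \<le> m"
    and sparse: "\<And>v. card (supp p v) \<le> m \<Longrightarrow> c * (norm2 p v)\<^sup>2 \<le> (norm2 n (mat_vec p X v))\<^sup>2"
  shows "(real m - 1) * (c * (norm2 p b)\<^sup>2) \<le>
    (real m - 1) * (norm2 n (mat_vec p X b))\<^sup>2 + (Xnorm n p X)\<^sup>2 * (norm1 p b)\<^sup>2"
proof (cases "norm1 p b = 0")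
  case True
  then have "\<And>i. i < p \<Longrightarrow> b i = 0" by (simp add: norm1_def sum_nonneg_eq_0_iff)
  then have "norm2 p b = 0" by (simp add: norm2_def)
  then show ?thesis using m by simp
next
  case False
  define t where "t = norm1 p b"
  have t: "t > 0" using False by (simp add: t_def norm1_def sum_nonneg less_le)
  define q where "q j = \<bar>b j\<bar> / t" for j
  define w where "w j = (\<lambda>i. if i = j then t * sgn (b j) else 0)" for j
  have q0: "0 \<le> q j" for j using t by (simp add: q_def)
  have q1: "(\<Sum>j<p. q j) = 1" using t by (simp add: q_def sum_divide_distrib[symmetric] t_def norm1_def)
  have qw: "(\<Sum>j<p. q j * w j i) = b i" if "i < p" for i
  proof -
    have "(\<Sum>j<p. q j * w j i) = (\<Sum>j<p. if j = i then q j * (t * sgn (b j)) else 0)"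
      by (intro sum.cong) (auto simp: w_def)
    also have "\<dots> = q i * (t * sgn (b i))" using that by simp
    also have "\<dots> = b i" using t by (simp add: q_def abs_mult_sgn)
    finally show ?thesis .
  qed
  \<comment> \<open>The form is nonnegative on m-sparse vectors; the goal is how negative it can be
    at \<open>b\<close>.\<close>
  define B where "B u v = dot n (mat_vec p X u) (mat_vec p X v) - c * dot p u v" for u v
  have mv_add: "mat_vec p X (\<lambda>i. u i + v i) = (\<lambda>i. mat_vec p X u i + mat_vec p X v i)" for u v
    by (simp add: mat_vec_def sum.distrib algebra_simps)
  have mv_scale: "mat_vec p X (\<lambda>i. a * u i) = (\<lambda>i. a * mat_vec p X u i)" for a u
    by (simp add: mat_vec_def sum_distrib_left algebra_simps)
  have B_add: "B (\<lambda>i. u i + v i) (\<lambda>i. u i + v i) = B u u + 2 * B u v + B v v" for u v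
    unfolding B_def mv_add
    by (simp add: dot_add_left dot_add_right dot_commute[of n "mat_vec p X v" "mat_vec p X u"] dot_commute[of p v u] algebra_simps)
  have B_scale: "B (\<lambda>i. a * u i) (\<lambda>i. a * u i) = a\<^sup>2 * B u u" for a u
    unfolding B_def mv_scale by (simp add: dot_scale_left dot_scale_right power2_eq_square algebra_simps)
  have B_mean: "(\<Sum>j<p. q j * B u (w j)) = B u b" for u
  proof -
    have 1: "(\<Sum>j<p. q j * dot p u (w j)) = dot p u b"
    proof -
      have "(\<Sum>j<p. q j * dot p u (w j)) = dot p u (\<lambda>i. \<Sum>j<p. q j * w j i)"
        by (simp add: dot_sum_right dot_scale_right)
      also have "\<dots> = dot p u b" by (rule dot_cong) (simp_all add: qw)
      finally show ?thesis .
    qed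
    have 2: "(\<Sum>j<p. q j * mat_vec p X (w j) i) = mat_vec p X b i" for i
    proof -
      have "(\<Sum>j<p. q j * mat_vec p X (w j) i) = (\<Sum>j<p. \<Sum>k<p. X i k * (q j * w j k))"
        by (simp add: mat_vec_def sum_distrib_left mult_ac)
      also have "\<dots> = (\<Sum>k<p. X i k * (\<Sum>j<p. q j * w j k))"
        by (subst sum.swap) (simp add: sum_distrib_left)
      also have "\<dots> = mat_vec p X b i" by (simp add: mat_vec_def qw)
      finally show ?thesis .
    qed
    have 3: "(\<Sum>j<p. q j * dot n (mat_vec p X u) (mat_vec p X (w j))) = dot n (mat_vec p X u) (mat_vec p X b)"
    proof -
      have "(\<Sum>j<p. q j * dot n (mat_vec p X u) (mat_vec p X (w j))) =
        dot n (mat_vec p X u) (\<lambda>i. \<Sum>j<p. q j * mat_vec p X (w j) i)"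
        by (simp add: dot_sum_right dot_scale_right)
      then show ?thesis by (simp only: 2)
    qed
    have "(\<Sum>j<p. q j * B u (w j)) = (\<Sum>j<p. q j * dot n (mat_vec p X u) (mat_vec p X (w j))) - c * (\<Sum>j<p. q j * dot p u (w j))"
      by (simp add: B_def sum_subtractf sum_distrib_left algebra_simps)
    then show ?thesis unfolding 1 3 by (simp add: B_def)
  qed
  \<comment> \<open>The variance of a single draw, measured in the possibly indefinite form
    \<open>B\<close>.\<close>
  define V where "V = (\<Sum>j<p. q j * B (w j) (w j)) - B b b"
  have step: "(\<Sum>j<p. q j * B (\<lambda>i. u i + w j i) (\<lambda>i. u i + w j i)) = B (\<lambda>i. u i + b i) (\<lambda>i. u i + b i) + V" for u
  proof -
    have "(\<Sum>j<p. q j * B (\<lambda>i. u i + w j i) (\<lambda>i. u i + w j i)) =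
      (\<Sum>j<p. q j) * B u u + 2 * (\<Sum>j<p. q j * B u (w j)) + (\<Sum>j<p. q j * B (w j) (w j))"
      unfolding B_add by (simp add: sum.distrib sum_distrib_left sum_distrib_right algebra_simps)
    then show ?thesis unfolding B_mean B_add V_def q1 by simp
  qed
  \<comment> \<open>The right side is the mean of \<open>B\<close> at \<open>u\<close> plus
    \<open>k\<close> independent draws. Revealing one draw adds at most one element to the support,
    so the induction lowers \<open>k\<close> and enlarges \<open>u\<close>.\<close>
  have main: "0 \<le> B (\<lambda>i. u i + real k * b i) (\<lambda>i. u i + real k * b i) + real k * V"
    if "card (supp p u) + k \<le> m" for k u
    using that
  proof (induction k arbitrary: u)
    case 0
    then show ?case using sparse[of u] by (simp add: B_def norm2_power2)
  next
    case (Suc k)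
    have "0 \<le> B (\<lambda>i. (u i + w j i) + real k * b i) (\<lambda>i. (u i + w j i) + real k * b i) + real k * V" for j
    proof (rule Suc.IH)
      have "supp p (\<lambda>i. u i + w j i) \<subseteq> insert j (supp p u)" by (auto simp: supp_def w_def)
      then have "card (supp p (\<lambda>i. u i + w j i)) \<le> card (insert j (supp p u))"
        by (intro card_mono) (auto simp: supp_def)
      also have "\<dots> \<le> Suc (card (supp p u))" by (rule card_insert_le_m1) auto
      finally show "card (supp p (\<lambda>i. u i + w j i)) + k \<le> m" using Suc.prems by simp
    qed
    then have "0 \<le> (\<Sum>j<p. q j * (B (\<lambda>i. (u i + w j i) + real k * b i) (\<lambda>i. (u i + w j i) + real k * b i) + real k * V))"
      using q0 by (intro sum_nonneg mult_nonneg_nonneg) auto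
    also have "\<dots> = (\<Sum>j<p. q j * B (\<lambda>i. (u i + real k * b i) + w j i) (\<lambda>i. (u i + real k * b i) + w j i)) + real k * V"
      using q1 by (simp add: distrib_left sum.distrib sum_distrib_right[symmetric] add_ac)
    also have "\<dots> = B (\<lambda>i. (u i + real k * b i) + b i) (\<lambda>i. (u i + real k * b i) + b i) + V + real k * V"
      by (simp only: step)
    finally show ?case by (simp add: algebra_simps)
  qed
  \<comment> \<open>Starting from u = 0 with all m draws: m^2 B(b, b) + m V >= 0. The subtracted
    B(b, b) in V is why m - 1 appears in the end.\<close>
  have "0 \<le> B (\<lambda>i. 0 + real m * b i) (\<lambda>i. 0 + real m * b i) + real m * V"
    by (rule main) (simp add: supp_def)
  then have "0 \<le> real m * (real m * B b b + V)"
    by (simp add: B_scale power2_eq_square algebra_simps)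
  then have "0 \<le> real m * B b b + V" using m by (simp add: zero_le_mult_iff)
  moreover have "(\<Sum>j<p. q j * B (w j) (w j)) \<le> (Xnorm n p X)\<^sup>2 * t\<^sup>2"
  proof -
    have "(\<Sum>j<p. q j * B (w j) (w j)) \<le> (\<Sum>j<p. q j * ((Xnorm n p X)\<^sup>2 * t\<^sup>2))"
    proof (intro sum_mono mult_left_mono q0)
      fix j assume "j \<in> {..<p}"
      have n1: "norm1 p (w j) \<le> t"
      proof -
        have "norm1 p (w j) = (\<Sum>i<p. if i = j then \<bar>t * sgn (b j)\<bar> else 0)"
          unfolding norm1_def by (intro sum.cong) (auto simp: w_def)
        also have "\<dots> = \<bar>t * sgn (b j)\<bar>" using \<open>j \<in> {..<p}\<close> by simp
        also have "\<dots> \<le> t" using t by (simp add: abs_mult sgn_if)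
        finally show ?thesis .
      qed
      have "B (w j) (w j) \<le> (norm2 n (mat_vec p X (w j)))\<^sup>2"
        using c dot_self_nonneg[of p "w j"] by (simp add: B_def norm2_power2)
      also have "\<dots> \<le> (Xnorm n p X * t)\<^sup>2"
      proof (intro power_mono norm2_nonneg)
        show "norm2 n (mat_vec p X (w j)) \<le> Xnorm n p X * t"
          using norm2_mat_vec_le[of n p X "w j"] mult_left_mono[OF n1 Xnorm_nonneg, of n p X] by linarith
      qed
      finally show "B (w j) (w j) \<le> (Xnorm n p X)\<^sup>2 * t\<^sup>2" by (simp add: power_mult_distrib)
    qed
    also have "\<dots> = (Xnorm n p X)\<^sup>2 * t\<^sup>2" by (simp add: sum_distrib_right[symmetric] q1)
    finally show ?thesis .
  qed
  ultimately have "0 \<le> (real m - 1) * B b b + (Xnorm n p X)\<^sup>2 * t\<^sup>2"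
    unfolding V_def by (simp add: algebra_simps)
  then show ?thesis unfolding t_def by (simp add: B_def norm2_power2 algebra_simps)
qed

subsection \<open>Recovery in prediction, \<open>\<ell>\<^sub>1\<close> and \<open>\<ell>\<^sub>2\<close> norm\<close>

definition temper :: "real \<Rightarrow> real" where "temper A4 = tilt A4 / 16"

text \<open>The largest x for which 32 x^2 / \<delta> <= 16 A4 x.\<close>

definition lam_cut :: "real \<Rightarrow> real" where "lam_cut A4 = temper A4 * A4 / 2"

text \<open>7 + A3 is the linear part of the radius; 128 / \<delta> bounds the bias factor 32 x^2 /
  \<delta> for x <= 2.\<close>

definition conc_const :: "real \<Rightarrow> real \<Rightarrow> real" where "conc_const A3 A4 = 7 + A3 + 128 / temper A4"

definition pred_const :: "real \<Rightarrow> real \<Rightarrow> real" where "pred_const A3 A4 = sqrt (8 * conc_const A3 A4 / temper A4)"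

text \<open>Solves l / 4 times the l1 loss <= radius, with l bounded below through x >
  \<open>lam_cut A4\<close>.\<close>

definition l1_const :: "real \<Rightarrow> real \<Rightarrow> real" where "l1_const A3 A4 = 2 * conc_const A3 A4 / lam_cut A4"

text \<open>Prediction part plus Maurey correction; 33 \<open>lam_cut A4\<close> is the constant in
  the lower bound for m - 1.\<close>

definition l2_const :: "real \<Rightarrow> real \<Rightarrow> real" where
  "l2_const A3 A4 = sqrt ((pred_const A3 A4)\<^sup>2 + (l1_const A3 A4)\<^sup>2 / (33 * lam_cut A4))"

lemma noise_rate_nonneg: "0 \<le> noise_rate p"
  by (simp add: noise_rate_def)

context size_prior
begin

lemma temper_pos: "temper A4 > 0" using a_pos by (simp add: temper_def)

lemma temper_le_1: "temper A4 \<le> 1" using a_le by (simp add: temper_def)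

lemma lam_cut_pos: "lam_cut A4 > 0" using temper_pos A_pos by (simp add: lam_cut_def)

lemma conc_const_pos: "conc_const A3 A4 > 0" using temper_pos A_pos by (simp add: conc_const_def add_pos_pos)

definition radius :: "nat \<Rightarrow> (nat \<Rightarrow> nat \<Rightarrow> real) \<Rightarrow> real \<Rightarrow> nat set \<Rightarrow> real" where
  "radius n X l S = bias n p X l (temper A4) S + (7 + A3) * real (card S) * ln (real p)"

text \<open>Above the threshold the value p makes the dimension part of the far set vacuous for the
  bounds on the prior mass.\<close>

definition dim_cut :: "nat \<Rightarrow> (nat \<Rightarrow> nat \<Rightarrow> real) \<Rightarrow> real \<Rightarrow> nat set \<Rightarrow> real" where
  "dim_cut n X l S = (if l / lbar n p X \<le> lam_cut A4 then dim_bound n X l S else real p)"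

abbreviation far :: "nat \<Rightarrow> (nat \<Rightarrow> nat \<Rightarrow> real) \<Rightarrow> real \<Rightarrow> (nat \<Rightarrow> real) \<Rightarrow> (nat \<Rightarrow> real) set" where
  "far n X l \<beta>0 \<equiv> far_set n p X l \<beta>0 (temper A4) (dim_cut n X l (supp p \<beta>0)) (radius n X l (supp p \<beta>0))"

lemma posterior_concentration:
  assumes L: large and X: "Xnorm n p X > 0" and S: "supp p \<beta>0 \<noteq> {}"
    and l: "Xnorm n p X / real p \<le> l" "l \<le> 2 * lbar n p X" "l > 0"
    and phi: "compat n p X (supp p \<beta>0) > 0"
  obtains G :: "(nat \<Rightarrow> real) \<Rightarrow> ennreal" where
    "(\<integral>\<^sup>+Y. G Y \<partial>data_law n p X \<beta>0) \<le> ennreal (noise_rate p)"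
    "\<And>Y. G Y < 1 \<Longrightarrow> noise_ok n p X (\<lambda>i. Y i - mat_vec p X \<beta>0 i)"
    "\<And>Y. G Y < 1 \<Longrightarrow> marginal n p X l \<pi> Y (far n X l \<beta>0) \<le> G Y * marginal n p X l \<pi> Y UNIV"
    "G \<in> borel_measurable (data_law n p X \<beta>0)"
proof -
  let ?S = "supp p \<beta>0"
  have sub: "?S \<subseteq> {..<p}" by (auto simp: supp_def)
  have p: "p \<ge> 2" using L by (simp add: large_size_def)
  have "card ?S \<le> p" using card_mono[OF _ sub] by simp
  then have w0: "weight p \<pi> ?S > 0"
    unfolding weight_def using p by (intro divide_pos_pos pmf_pos) auto
  have k: "real p \<le> dim_cut n X l ?S \<or> (l / lbar n p X \<le> tilt A4 / 16 * A4 / 2 \<and> dim_cut n X l ?S = dim_bound n X l ?S)"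
    by (simp add: dim_cut_def lam_cut_def temper_def)
  note rate = far_set_rate[OF L X sub S l phi radius_def[of n X l ?S, unfolded temper_def] k]
  show ?thesis
  proof (rule posterior_far_set[OF l(3) supp_\<pi> X p phi temper_pos temper_le_1 w0,
      where k = "dim_cut n X l ?S" and W = "radius n X l ?S"], goal_cases)
    case (1 G)
    show ?thesis
    proof (rule that[of G])
      show "(\<integral>\<^sup>+Y. G Y \<partial>data_law n p X \<beta>0) \<le> ennreal (noise_rate p)"
        using rate by (intro order_trans[OF 1(2)] ennreal_leI) (simp add: noise_rate_def temper_def)
    qed (use 1 in blast)+
  qed
qed

text \<open>Where G >= 1 the bound is trivial because a posterior mass is at most 1, so the mean of
  G bounds the risk everywhere.\<close>

lemma post_risk_far:
  assumes L: large and X: "Xnorm n p X > 0" and S: "supp p \<beta>0 \<noteq> {}"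
    and l: "Xnorm n p X / real p \<le> l" "l \<le> 2 * lbar n p X" "l > 0"
    and phi: "compat n p X (supp p \<beta>0) > 0" and B: "B \<subseteq> far n X l \<beta>0"
  shows "post_risk n p X l \<pi> \<beta>0 B \<le> noise_rate p"
proof -
  obtain G :: "(nat \<Rightarrow> real) \<Rightarrow> ennreal" where G: "(\<integral>\<^sup>+Y. G Y \<partial>data_law n p X \<beta>0) \<le> ennreal (noise_rate p)"
    "\<And>Y. G Y < 1 \<Longrightarrow> marginal n p X l \<pi> Y (far n X l \<beta>0) \<le> G Y * marginal n p X l \<pi> Y UNIV"
    using posterior_concentration[OF L X S l phi] by metis
  have "ennreal (posterior n p X l \<pi> Y B) \<le> G Y" for Y
  proof (cases "G Y < 1")
    case True
    then show ?thesis by (intro posterior_le[OF l(3)] order_trans[OF marginal_mono[OF B] G(2)])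
  next
    case False
    have "ennreal (posterior n p X l \<pi> Y B) \<le> 1" using posterior_le_1[OF l(3)] by simp
    also have "1 \<le> G Y" using False by (simp add: not_less)
    finally show ?thesis .
  qed
  then show ?thesis by (rule post_risk_le[OF _ G(1) noise_rate_nonneg])
qed

text \<open>With no true signal there is no bias to pay, so the likelihood ratio is used at full
  power: each model's ratio averages to 1, and the mass of nonzero vectors is at most the prior odds
  of nonempty supports over the evidence constant.\<close>

lemma post_risk_null:
  assumes L: large and X: "Xnorm n p X > 0" and S: "supp p \<beta>0 = {}"
    and l: "Xnorm n p X / real p \<le> l" "l \<le> 2 * lbar n p X" "l > 0"
    and B: "\<And>\<beta>. \<beta> \<in> B \<Longrightarrow> \<exists>i<p. \<beta> i \<noteq> 0"
  shows "post_risk n p X l \<pi> \<beta>0 B \<le> exp (1 / 2 + 4 * sqrt (ln (real p))) * (2 * A2 * real p powr (- A4))"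
proof -
  let ?N = "{\<beta>. \<exists>i<p. \<beta> i \<noteq> 0} :: (nat \<Rightarrow> real) set"
  let ?v = "\<lambda>\<beta>. mat_vec p X (\<lambda>j. \<beta> j - \<beta>0 j)"
  let ?z = "\<lambda>Y i. Y i - mat_vec p X \<beta>0 i"
  have p: "p \<ge> 2" and p1: "real p > 1" using L by (auto simp: large_size_def)
  have b0: "norm1 p \<beta>0 = 0" using S by (auto simp: norm1_def supp_def)
  define e where "e = exp (- 1 / 2) * exp (- l / Xnorm n p X)"
  have e: "e > 0" by (simp add: e_def)
  define w where "w = weight p \<pi>"
  have w: "0 \<le> w S" for S by (simp add: w_def weight_nonneg)
  have w0: "w {} = pmf \<pi> 0" by (simp add: w_def weight_def)
  have pi0: "pmf \<pi> 0 > 0" using p by (intro pmf_pos) auto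
  define f where "f \<beta> = ennreal (exp (- (norm2 n (?v \<beta>))\<^sup>2 / 2))" for \<beta>
  have [measurable]: "f \<in> borel_measurable (vecM p)" unfolding f_def by measurable
  define H where "H S Y = (\<integral>\<^sup>+\<beta>. f \<beta> * ennreal (exp (1 * dot n (?z Y) (?v \<beta>))) \<partial>model p l S)" for S Y
  have sf: "sigma_finite_measure (model p l S)" for S
    by (intro prob_space_imp_sigma_finite prob_space_model l)
  have [measurable]: "H S \<in> borel_measurable (data_law n p X \<beta>0)" for S
    unfolding H_def by (rule measurable_nn_integral_data_law[OF sf]) auto
  have H1: "(\<integral>\<^sup>+Y. H S Y \<partial>data_law n p X \<beta>0) = 1" for S
  proof -
    have "(\<integral>\<^sup>+Y. H S Y \<partial>data_law n p X \<beta>0) = (\<integral>\<^sup>+\<beta>. f \<beta> * ennreal (exp (1\<^sup>2 * (norm2 n (?v \<beta>))\<^sup>2 / 2)) \<partial>model p l S)"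
      unfolding H_def by (rule nn_integral_data_law_exp[OF sf]) auto
    also have "\<dots> = (\<integral>\<^sup>+\<beta>. 1 \<partial>model p l S)"
      by (intro nn_integral_cong) (simp add: f_def ennreal_mult[symmetric] exp_add[symmetric])
    finally show ?thesis using prob_space.emeasure_space_1[OF prob_space_model[OF l(3)]] by simp
  qed
  define G where "G Y = ennreal (1 / (w {} * e)) * (\<Sum>S\<in>Pow {..<p} - {{}}. ennreal (w S) * H S Y)" for Y
  have "ennreal (posterior n p X l \<pi> Y B) \<le> G Y" for Y
  proof (rule posterior_le[OF l(3)])
    define L0 where "L0 = lik n p X Y \<beta>0"
    have L0: "L0 > 0" unfolding L0_def by (rule lik_pos)
    have ev: "ennreal (L0 * w {} * e) \<le> marginal n p X l \<pi> Y UNIV"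
      using evidence_lower_bound[OF l(3) supp_\<pi> X, of Y \<beta>0] unfolding L0_def w_def e_def by (simp add: S b0)
    have lik: "ennreal (lik n p X Y \<beta>) = ennreal L0 * (f \<beta> * ennreal (exp (1 * dot n (?z Y) (?v \<beta>))))" for \<beta>
      unfolding L0_def f_def using lik_ratio[of n p X Y \<beta> \<beta>0] lik_pos[of n p X Y \<beta>0]
      by (simp add: ennreal_mult[symmetric] less_imp_le exp_add[symmetric])
    have Nm [measurable]: "(indicator ?N :: _ \<Rightarrow> ennreal) \<in> borel_measurable (vecM p)"
    proof -
      have "(\<lambda>\<beta>. \<beta> i) \<in> borel_measurable (vecM p)" if "i < p" for i using that by simp
      then have "{\<beta> \<in> space (vecM p). \<exists>i\<in>{..<p}. \<beta> i \<noteq> 0} \<in> sets (vecM p)" by measurable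
      moreover have "{\<beta> \<in> space (vecM p). \<exists>i\<in>{..<p}. \<beta> i \<noteq> 0} = ?N \<inter> space (vecM p)" by auto
      ultimately show ?thesis by (simp add: borel_measurable_indicator_iff)
    qed
    have le: "(\<integral>\<^sup>+\<beta>. indicator ?N \<beta> * ennreal (lik n p X Y \<beta>) \<partial>model p l S) \<le> (if S = {} then 0 else ennreal L0 * H S Y)"
      if "S \<subseteq> {..<p}" for S
    proof (cases "S = {}")
      case True
      have "AE \<beta> in model p l S. indicator ?N \<beta> * ennreal (lik n p X Y \<beta>) = 0"
        using AE_model[OF l(3), of p S] by eventually_elim (auto simp: True indicator_def)
      then have "(\<integral>\<^sup>+\<beta>. indicator ?N \<beta> * ennreal (lik n p X Y \<beta>) \<partial>model p l S) = (\<integral>\<^sup>+\<beta>. 0 \<partial>model p l S)"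
        by (rule nn_integral_cong_AE)
      then show ?thesis using True by simp
    next
      case False
      have "(\<integral>\<^sup>+\<beta>. indicator ?N \<beta> * ennreal (lik n p X Y \<beta>) \<partial>model p l S) \<le> (\<integral>\<^sup>+\<beta>. ennreal (lik n p X Y \<beta>) \<partial>model p l S)"
        by (intro nn_integral_mono) (auto simp: indicator_def)
      also have "\<dots> = ennreal L0 * H S Y" unfolding lik H_def by (rule nn_integral_cmult) measurable
      finally show ?thesis using False by simp
    qed
    have "marginal n p X l \<pi> Y B \<le> marginal n p X l \<pi> Y ?N" using B by (intro marginal_mono) auto
    also have "\<dots> = (\<Sum>S\<in>Pow {..<p}. ennreal (w S) * (\<integral>\<^sup>+\<beta>. indicator ?N \<beta> * ennreal (lik n p X Y \<beta>) \<partial>model p l S))"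
      unfolding marginal_def w_def by (rule nn_integral_prior[OF supp_\<pi> l(3)]) measurable
    also have "\<dots> \<le> (\<Sum>S\<in>Pow {..<p}. ennreal (w S) * (if S = {} then 0 else ennreal L0 * H S Y))"
      by (intro sum_mono mult_left_mono le) auto
    also have "\<dots> = (\<Sum>S\<in>Pow {..<p} - {{}}. ennreal (w S) * (ennreal L0 * H S Y))"
      by (intro sum.mono_neutral_cong_right) auto
    also have "\<dots> = ennreal L0 * (\<Sum>S\<in>Pow {..<p} - {{}}. ennreal (w S) * H S Y)"
      by (simp add: sum_distrib_left mult_ac)
    also have "ennreal L0 = ennreal (1 / (w {} * e)) * ennreal (L0 * w {} * e)"
      using e L0 pi0 by (simp add: ennreal_mult[symmetric] w0 less_imp_le)
    also have "ennreal (1 / (w {} * e)) * ennreal (L0 * w {} * e) * (\<Sum>S\<in>Pow {..<p} - {{}}. ennreal (w S) * H S Y)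
       = G Y * ennreal (L0 * w {} * e)" unfolding G_def by (simp add: mult_ac)
    also have "\<dots> \<le> G Y * marginal n p X l \<pi> Y UNIV" by (intro mult_left_mono ev) simp
    finally show "marginal n p X l \<pi> Y B \<le> G Y * marginal n p X l \<pi> Y UNIV" .
  qed
  moreover have "(\<integral>\<^sup>+Y. G Y \<partial>data_law n p X \<beta>0) \<le> ennreal (exp (1 / 2 + 4 * sqrt (ln (real p))) * (2 * A2 * real p powr (- A4)))"
  proof -
    have "(\<integral>\<^sup>+Y. G Y \<partial>data_law n p X \<beta>0) = ennreal (1 / (w {} * e)) * (\<Sum>S\<in>Pow {..<p} - {{}}. ennreal (w S) * (\<integral>\<^sup>+Y. H S Y \<partial>data_law n p X \<beta>0))"
      unfolding G_def by (simp add: nn_integral_cmult nn_integral_sum)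
    also have "\<dots> = ennreal (1 / (w {} * e) * (\<Sum>S\<in>Pow {..<p} - {{}}. w S))"
      by (subst ennreal_mult') (use e pi0 w in \<open>simp_all add: w0 H1 sum_ennreal\<close>)
    also have "\<dots> \<le> ennreal (exp (1 / 2 + 4 * sqrt (ln (real p))) * (2 * A2 * real p powr (- A4)))"
    proof (rule ennreal_leI)
      define r where "r = A2 * real p powr (- A4)"
      have r0: "0 \<le> r" using A_pos by (simp add: r_def)
      \<comment> \<open>Consecutive sizes lose at least a factor 2, so the size-one term dominates
        the geometric sum.\<close>
      have r: "r \<le> 1 / 2"
      proof -
        have "4 * A2 \<le> real p powr a" using L by (simp add: large_size_def)
        also have "\<dots> \<le> real p powr A4" using p1 a_le A_pos by (intro powr_mono) auto
        finally have "4 * A2 * real p powr (- A4) \<le> real p powr A4 * real p powr (- A4)" by (intro mult_right_mono) auto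
        then show ?thesis using p1 by (simp add: r_def powr_add[symmetric])
      qed
      have "(\<Sum>S\<in>Pow {..<p} - {{}}. w S) = (\<Sum>S\<in>Pow {..<p}. w S * (if card S = 0 then 0 else 1))"
      proof (rule sum.mono_neutral_cong_left)
        fix S assume "S \<in> Pow {..<p} - {{}}"
        then have "card S \<noteq> 0" using finite_subset[of S "{..<p}"] by auto
        then show "w S = w S * (if card S = 0 then 0 else 1)" by simp
      qed auto
      also have "\<dots> = (\<Sum>s\<le>p. pmf \<pi> s * (if s = 0 then 0 else 1))"
        unfolding w_def by (rule sum_weight)
      also have "\<dots> \<le> (\<Sum>s\<in>{1..p}. pmf \<pi> 0 * r * (1 / 2) ^ (s - 1))"
      proof -
        have "(\<Sum>s\<le>p. pmf \<pi> s * (if s = 0 then 0 else 1)) = (\<Sum>s\<in>{1..p}. pmf \<pi> s)"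
          by (rule sum.mono_neutral_cong_right) auto
        also have "\<dots> \<le> (\<Sum>s\<in>{1..p}. pmf \<pi> 0 * r * (1 / 2) ^ (s - 1))"
        proof (intro sum_mono)
          fix s assume s: "s \<in> {1..p}"
          have "pmf \<pi> s \<le> r ^ s * pmf \<pi> 0" using pmf_ratio_upper[of 0 s] s by (simp add: r_def)
          also have "r ^ s = r * r ^ (s - 1)" using s by (cases s) auto
          also have "r * r ^ (s - 1) * pmf \<pi> 0 \<le> r * (1 / 2) ^ (s - 1) * pmf \<pi> 0"
            using r r0 by (intro mult_right_mono mult_left_mono power_mono) auto
          finally show "pmf \<pi> s \<le> pmf \<pi> 0 * r * (1 / 2) ^ (s - 1)" by (simp add: mult_ac)
        qed
        finally show ?thesis .
      qed
      also have "\<dots> = pmf \<pi> 0 * r * (\<Sum>j<p. (1 / 2) ^ j)"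
        unfolding sum_distrib_left
        by (rule sum.reindex_bij_witness[of _ Suc "\<lambda>s. s - 1"]) auto
      also have "\<dots> \<le> pmf \<pi> 0 * r * 2"
      proof (intro mult_left_mono)
        have "(\<Sum>j<m. (1 / 2 :: real) ^ j) \<le> 2 - 2 * (1 / 2) ^ m" for m :: nat
          by (induction m) auto
        from this[of p] show "(\<Sum>j<p. (1 / 2 :: real) ^ j) \<le> 2" by (rule order_trans) simp
      qed (use r0 in auto)
      finally have "1 / (w {} * e) * (\<Sum>S\<in>Pow {..<p} - {{}}. w S) \<le> 1 / (w {} * e) * (pmf \<pi> 0 * r * 2)"
        using e pi0 by (intro mult_left_mono) (auto simp: w0)
      also have "\<dots> = (1 / e) * (2 * r)" using pi0 by (simp add: w0)
      also have "\<dots> \<le> exp (1 / 2 + 4 * sqrt (ln (real p))) * (2 * r)"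
      proof (intro mult_right_mono)
        have "l / Xnorm n p X \<le> 4 * sqrt (ln (real p))"
          using l(2) X by (simp add: lbar_def divide_le_eq mult_ac)
        then show "1 / e \<le> exp (1 / 2 + 4 * sqrt (ln (real p)))"
          by (simp add: e_def exp_minus exp_add inverse_eq_divide)
      qed (use r0 in auto)
      finally show "1 / (w {} * e) * (\<Sum>S\<in>Pow {..<p} - {{}}. w S)
        \<le> exp (1 / 2 + 4 * sqrt (ln (real p))) * (2 * A2 * real p powr (- A4))" by (simp add: r_def mult_ac)
    qed
    finally show ?thesis .
  qed
  ultimately show ?thesis using A_pos by (intro post_risk_le) auto
qed

end

section \<open>From the far set to prediction, l1 and l2 loss\<close>

context size_prior
begin

lemma psi_arg_dim_bound: "psi_arg n p X l A4 S = dim_bound n X l S + real (card S)"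
  by (simp add: psi_arg_def dim_bound_def algebra_simps)

text \<open>Both loss terms are nonnegative, so each is at most the radius, itself of order s ln p /
  \<phi>^2. Dividing the l1 term by l helps only when l is not small, which is why the second claim
  sits above the threshold and the dimension claim below it.\<close>

lemma outside_far:
  fixes \<beta>0 \<beta> :: "nat \<Rightarrow> real" and X :: "nat \<Rightarrow> nat \<Rightarrow> real" and n :: nat and l :: real
  defines "S \<equiv> supp p \<beta>0" and "b \<equiv> \<lambda>j. \<beta> j - \<beta>0 j"
  defines "\<phi> \<equiv> compat n p X S" and "s \<equiv> real (card S)" and "L \<equiv> ln (real p)" and "x \<equiv> l / lbar n p X"
  assumes large: large and X: "Xnorm n p X > 0" and S: "S \<noteq> {}"
    and l: "l \<le> 2 * lbar n p X" "l > 0"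
    and phi: "\<phi> > 0" and \<beta>: "\<beta> \<notin> far n X l \<beta>0"
  shows "norm2 n (mat_vec p X b) \<le> pred_const A3 A4 * (sqrt (s * L) / \<phi>)"
    and "lam_cut A4 < x \<Longrightarrow> norm1 p b \<le> l1_const A3 A4 * (s * sqrt L / (Xnorm n p X * \<phi>\<^sup>2))"
    and "x \<le> lam_cut A4 \<Longrightarrow> real (card (supp p b)) \<le> psi_arg n p X l A4 S"
proof -
  define \<delta> where "\<delta> = temper A4"
  have \<delta>: "\<delta> > 0" using temper_pos by (simp add: \<delta>_def)
  define C where "C = conc_const A3 A4"
  have C: "C > 0" using conc_const_pos by (simp add: C_def)
  define K where "K = Xnorm n p X"
  have K: "K > 0" using X by (simp add: K_def)
  define q where "q = norm2 n (mat_vec p X b)"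
  have p: "p \<ge> 2" using large by (simp add: large_size_def)
  have L: "L > 0" using p by (simp add: L_def)
  have sub: "S \<subseteq> {..<p}" by (auto simp: S_def supp_def)
  have s: "s \<ge> 1" using S sub finite_subset[of S "{..<p}"] by (simp add: s_def card_gt_0_iff Suc_le_eq)
  have lb: "lbar n p X > 0" using X L by (simp add: lbar_def L_def)
  have x: "0 < x" "x \<le> 2" using l lb by (simp_all add: x_def divide_le_eq)
  have lx: "l = x * (2 * K * sqrt L)"
  proof -
    have "l = x * lbar n p X" using lb by (simp add: x_def)
    then show ?thesis by (simp only: lbar_def K_def L_def)
  qed
  have \<phi>1: "\<phi> \<le> 1" unfolding \<phi>_def by (rule compat_le_1[OF X sub S])
  define W where "W = radius n X l S"
  have W: "W \<le> C * (s * L / \<phi>\<^sup>2)"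
  proof -
    have l2: "l\<^sup>2 = x\<^sup>2 * (4 * K\<^sup>2 * L)" unfolding lx using L by (simp add: power_mult_distrib)
    have "bias n p X l \<delta> S = (32 / \<delta> * x\<^sup>2) * (s * L / \<phi>\<^sup>2)"
      unfolding bias_def l2 using K by (simp add: \<phi>_def[symmetric] s_def[symmetric] K_def[symmetric])
    also have "\<dots> \<le> (32 / \<delta> * 2\<^sup>2) * (s * L / \<phi>\<^sup>2)"
      using x \<delta> s L by (intro mult_right_mono mult_left_mono power_mono) auto
    finally have 1: "bias n p X l \<delta> S \<le> 128 / \<delta> * (s * L / \<phi>\<^sup>2)" by simp
    have "\<phi>\<^sup>2 \<le> 1" using \<phi>1 phi by (simp add: power_le_one)
    then have "s * L * \<phi>\<^sup>2 \<le> s * L * 1" using s L by (intro mult_left_mono) auto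
    then have "s * L \<le> s * L / \<phi>\<^sup>2" using phi by (simp add: pos_le_divide_eq)
    then have "(7 + A3) * (s * L) \<le> (7 + A3) * (s * L / \<phi>\<^sup>2)" using A_pos by (intro mult_left_mono) auto
    moreover have "W = bias n p X l \<delta> S + (7 + A3) * (s * L)"
      by (simp add: W_def radius_def \<delta>_def s_def L_def)
    moreover have "C * (s * L / \<phi>\<^sup>2) = 128 / \<delta> * (s * L / \<phi>\<^sup>2) + (7 + A3) * (s * L / \<phi>\<^sup>2)"
      unfolding C_def conc_const_def \<delta>_def distrib_right[of "7 + A3" "128 / temper A4"] by (rule add.commute)
    ultimately show ?thesis using 1 by linarith
  qed
  have out: "\<delta> / 8 * q\<^sup>2 + l / 4 * norm1 p b \<le> W" "real (card (supp p b)) \<le> dim_cut n X l S + s"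
    using \<beta> unfolding far_set_def q_def b_def W_def \<delta>_def S_def s_def by (simp_all add: not_less)
  have nb: "0 \<le> norm1 p b" by (auto simp: norm1_def sum_nonneg)
  have "q\<^sup>2 \<le> 8 * C / \<delta> * (s * L / \<phi>\<^sup>2)"
  proof -
    have "\<delta> / 8 * q\<^sup>2 \<le> C * (s * L / \<phi>\<^sup>2)"
    proof -
      have "0 \<le> l / 4 * norm1 p b" using l nb by simp
      then show ?thesis using out(1) W by linarith
    qed
    then have "(8 / \<delta>) * (\<delta> / 8 * q\<^sup>2) \<le> (8 / \<delta>) * (C * (s * L / \<phi>\<^sup>2))" using \<delta> by (intro mult_left_mono) auto
    then show ?thesis using \<delta> by simp
  qed
  then have "sqrt (q\<^sup>2) \<le> sqrt (8 * C / \<delta> * (s * L / \<phi>\<^sup>2))" by (rule real_sqrt_le_mono)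
  also have "\<dots> = pred_const A3 A4 * (sqrt (s * L) / \<phi>)"
    using phi by (simp add: pred_const_def C_def \<delta>_def real_sqrt_mult real_sqrt_divide)
  finally show "norm2 n (mat_vec p X b) \<le> pred_const A3 A4 * (sqrt (s * L) / \<phi>)"
    by (simp add: q_def norm2_nonneg)
  show "real (card (supp p b)) \<le> psi_arg n p X l A4 S" if "x \<le> lam_cut A4"
    using out(2) that by (simp add: dim_cut_def psi_arg_dim_bound x_def s_def)
  show "norm1 p b \<le> l1_const A3 A4 * (s * sqrt L / (Xnorm n p X * \<phi>\<^sup>2))" if xc: "lam_cut A4 < x"
  proof -
    define c where "c = lam_cut A4"
    have c: "0 < c" "c \<le> x" using lam_cut_pos xc by (auto simp: c_def)
    have "l / 4 * norm1 p b \<le> C * (s * L / \<phi>\<^sup>2)"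
    proof -
      have "0 \<le> \<delta> / 8 * q\<^sup>2" using \<delta> by simp
      then show ?thesis using out(1) W by linarith
    qed
    moreover have "(c * (2 * K * sqrt L)) / 4 * norm1 p b \<le> l / 4 * norm1 p b"
      unfolding lx using c K L nb by (intro mult_right_mono divide_right_mono) auto
    ultimately have "(c * (2 * K * sqrt L)) / 4 * norm1 p b \<le> C * (s * L / \<phi>\<^sup>2)" by linarith
    also have "\<dots> = (c * (2 * K * sqrt L)) / 4 * (2 * C / c * (s * sqrt L / (K * \<phi>\<^sup>2)))"
    proof -
      have "L = sqrt L * sqrt L" using L by simp
      then show ?thesis using c K phi by (simp add: field_simps)
    qed
    finally have "norm1 p b \<le> 2 * C / c * (s * sqrt L / (K * \<phi>\<^sup>2))"
      by (rule mult_left_le_imp_le) (use c K L in simp)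
    then show ?thesis by (simp add: l1_const_def C_def c_def K_def)
  qed
qed

text \<open>The spare 2 in the last inequality is spent in the Maurey step: 1 on rounding the
  sparsity down, 1 on the factor m - 1.\<close>

lemma psi_arg_ge:
  assumes X: "Xnorm n p X > 0" and p: "p \<ge> 2" and S: "S \<subseteq> {..<p}" "S \<noteq> {}" and l: "l > 0"
  shows "2 * real (card S) \<le> psi_arg n p X l A4 S" "1 \<le> psi_arg n p X l A4 S" "1 \<le> real (card S)"
    "33 * (l / lbar n p X) * real (card S) / (compat n p X S)\<^sup>2 \<le> psi_arg n p X l A4 S - 2"
proof -
  have "finite S" using S finite_subset by auto
  then show s: "1 \<le> real (card S)" using S by (simp add: card_gt_0_iff Suc_le_eq)
  have lb: "lbar n p X > 0" using X p by (simp add: lbar_def)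
  define y where "y = 33 / (compat n p X S)\<^sup>2 * (l / lbar n p X)"
  have y: "0 \<le> y" using l lb by (simp add: y_def)
  have eq: "psi_arg n p X l A4 S = 2 * real (card S) + 3 / A4 * real (card S) + y * real (card S)"
    by (simp add: psi_arg_def y_def algebra_simps)
  have "0 \<le> 3 / A4 * real (card S)" "0 \<le> y * real (card S)" using A_pos y by auto
  then show "2 * real (card S) \<le> psi_arg n p X l A4 S" "1 \<le> psi_arg n p X l A4 S"
    using s unfolding eq by linarith+
  have "y * real (card S) \<le> psi_arg n p X l A4 S - 2"
    using s \<open>0 \<le> 3 / A4 * real (card S)\<close> unfolding eq by linarith
  then show "33 * (l / lbar n p X) * real (card S) / (compat n p X S)\<^sup>2 \<le> psi_arg n p X l A4 S - 2"
    by (simp add: y_def mult_ac)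
qed

lemma prediction_subset_far:
  assumes large: large and X: "Xnorm n p X > 0" and S: "supp p \<beta>0 \<noteq> {}"
    and l: "l \<le> 2 * lbar n p X" "l > 0"
    and phi: "compat n p X (supp p \<beta>0) > 0" and psi: "psibar n p X l A4 (supp p \<beta>0) > 0"
    and M: "pred_const A3 A4 \<le> M"
  shows "{\<beta>. norm2 n (\<lambda>i. mat_vec p X \<beta> i - mat_vec p X \<beta>0 i) >
      M / psibar n p X l A4 (supp p \<beta>0) * sqrt (real (card (supp p \<beta>0)) * ln (real p)) / compat n p X (supp p \<beta>0)}
    \<subseteq> far n X l \<beta>0"
proof
  fix \<beta>
  let ?\<psi> = "psibar n p X l A4 (supp p \<beta>0)"
  define t where "t = sqrt (real (card (supp p \<beta>0)) * ln (real p)) / compat n p X (supp p \<beta>0)"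
  have p: "p \<ge> 2" using large by (simp add: large_size_def)
  have sub: "supp p \<beta>0 \<subseteq> {..<p}" by (auto simp: supp_def)
  have t: "0 \<le> t" using phi p by (simp add: t_def)
  have psi1: "?\<psi> \<le> 1" unfolding psibar_def by (rule phibar_le_1[OF X psi_arg_ge(2)[OF X p sub S l(2)]])
  assume "\<beta> \<in> {\<beta>. norm2 n (\<lambda>i. mat_vec p X \<beta> i - mat_vec p X \<beta>0 i) >
      M / ?\<psi> * sqrt (real (card (supp p \<beta>0)) * ln (real p)) / compat n p X (supp p \<beta>0)}"
  then have gt: "norm2 n (mat_vec p X (\<lambda>j. \<beta> j - \<beta>0 j)) > M / ?\<psi> * t"
    by (simp add: mat_vec_diff t_def)
  have M0: "0 \<le> M" using M conc_const_pos temper_pos by (intro order_trans[OF _ M]) (simp add: pred_const_def)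
  have "M \<le> M / ?\<psi>" using psi psi1 M0 by (simp add: pos_le_divide_eq mult_left_le)
  then have "pred_const A3 A4 * t \<le> M / ?\<psi> * t" using M t by (intro mult_right_mono) auto
  show "\<beta> \<in> far n X l \<beta>0"
  proof (rule ccontr)
    assume "\<beta> \<notin> far n X l \<beta>0"
    then have "norm2 n (mat_vec p X (\<lambda>j. \<beta> j - \<beta>0 j)) \<le> pred_const A3 A4 * t"
      unfolding t_def by (intro outside_far(1)[OF large X S l phi])
    then show False using gt \<open>pred_const A3 A4 * t \<le> M / ?\<psi> * t\<close> by linarith
  qed
qed

text \<open>Above the threshold the l1 loss is bounded directly. Below it, sparsity of the error
  lets \<open>phibar\<close> convert prediction loss into l1 loss at the cost of one factor 1 /
  \<psi>, at most 1 / \<psi>^2.\<close>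

lemma l1_subset_far:
  assumes large: large and X: "Xnorm n p X > 0" and S: "supp p \<beta>0 \<noteq> {}"
    and l: "l \<le> 2 * lbar n p X" "l > 0"
    and phi: "compat n p X (supp p \<beta>0) > 0" and psi: "psibar n p X l A4 (supp p \<beta>0) > 0"
    and M: "l1_const A3 A4 \<le> M" "pred_const A3 A4 * sqrt (68 + 3 / A4) \<le> M"
  shows "{\<beta>. norm1 p (\<lambda>i. \<beta> i - \<beta>0 i) >
      M / (psibar n p X l A4 (supp p \<beta>0))^2 * (real (card (supp p \<beta>0)) * sqrt (ln (real p)))
        / (Xnorm n p X * (compat n p X (supp p \<beta>0))^2)} \<subseteq> far n X l \<beta>0"
proof
  fix \<beta>
  let ?S = "supp p \<beta>0"
  define \<psi> where "\<psi> = psibar n p X l A4 ?S"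
  define \<phi> where "\<phi> = compat n p X ?S"
  define s where "s = real (card ?S)"
  define L where "L = ln (real p)"
  define K where "K = Xnorm n p X"
  define b where "b = (\<lambda>i. \<beta> i - \<beta>0 i)"
  define t where "t = s * sqrt L / (K * \<phi>\<^sup>2)"
  have p: "p \<ge> 2" using large by (simp add: large_size_def)
  have sub: "?S \<subseteq> {..<p}" by (auto simp: supp_def)
  note arg = psi_arg_ge[OF X p sub S l(2)]
  have L: "L > 0" using p by (simp add: L_def)
  have K: "K > 0" using X by (simp add: K_def)
  have s: "s \<ge> 1" using arg(3) by (simp add: s_def)
  have \<phi>: "\<phi> > 0" "\<phi> \<le> 1" using phi compat_le_1[OF X sub S] by (auto simp: \<phi>_def)
  have t: "0 \<le> t" using L K s by (simp add: t_def)
  have \<psi>: "\<psi> > 0" "\<psi> \<le> 1" using psi phibar_le_1[OF X arg(2)] by (auto simp: \<psi>_def psibar_def)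
  assume "\<beta> \<in> {\<beta>. norm1 p (\<lambda>i. \<beta> i - \<beta>0 i) >
      M / (psibar n p X l A4 ?S)^2 * (real (card ?S) * sqrt (ln (real p))) / (Xnorm n p X * (compat n p X ?S)^2)}"
  then have gt: "norm1 p b > M / \<psi>\<^sup>2 * t"
    by (simp add: t_def b_def \<psi>_def \<phi>_def s_def L_def K_def)
  have M0: "0 \<le> M"
    using M(2) conc_const_pos temper_pos A_pos by (intro order_trans[OF _ M(2)]) (simp add: pred_const_def)
  have Mle: "M / \<psi> * t \<le> M / \<psi>\<^sup>2 * t" "M * t \<le> M / \<psi>\<^sup>2 * t"
  proof -
    have "\<psi>\<^sup>2 \<le> \<psi>" "\<psi>\<^sup>2 \<le> 1" using \<psi> by (simp_all add: power2_eq_square mult_left_le mult_le_one)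
    then have "M / \<psi> \<le> M / \<psi>\<^sup>2" "M / 1 \<le> M / \<psi>\<^sup>2" using \<psi> M0 by (intro divide_left_mono; simp)+
    then show "M / \<psi> * t \<le> M / \<psi>\<^sup>2 * t" "M * t \<le> M / \<psi>\<^sup>2 * t" using t by (intro mult_right_mono; simp)+
  qed
  show "\<beta> \<in> far n X l \<beta>0"
  proof (rule ccontr)
    assume out: "\<beta> \<notin> far n X l \<beta>0"
    note of = outside_far[OF large X S l phi out, folded b_def]
    have "norm1 p b \<le> M / \<psi>\<^sup>2 * t"
    proof (cases "lam_cut A4 < l / lbar n p X")
      case True
      have "norm1 p b \<le> l1_const A3 A4 * t"
        using of(2)[OF True] by (simp only: t_def s_def L_def K_def \<phi>_def)
      also have "\<dots> \<le> M * t" using M t by (intro mult_right_mono) auto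
      finally show ?thesis using Mle by linarith
    next
      case False
      then have x: "l / lbar n p X \<le> lam_cut A4" by simp
      have lb: "lbar n p X > 0" using X L by (simp add: lbar_def L_def)
      \<comment> \<open>x <= 2 gives 2 + 3 / A4 + 66 after absorbing the first two terms into 1 /
        \<phi>^2; hence the 68.\<close>
      have D: "psi_arg n p X l A4 ?S \<le> (68 + 3 / A4) / \<phi>\<^sup>2 * s"
      proof -
        have \<phi>2: "\<phi>\<^sup>2 \<le> 1" "\<phi>\<^sup>2 > 0" using \<phi> by (simp_all add: power_le_one)
        have "l / lbar n p X \<le> 2" using l lb by (simp add: divide_le_eq)
        then have "33 / \<phi>\<^sup>2 * (l / lbar n p X) \<le> 33 / \<phi>\<^sup>2 * 2" by (intro mult_left_mono) auto
        moreover have "2 + 3 / A4 \<le> (2 + 3 / A4) / \<phi>\<^sup>2"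
          using \<phi>2 A_pos by (simp add: pos_le_divide_eq mult_left_le)
        ultimately have "2 + 3 / A4 + 33 / \<phi>\<^sup>2 * (l / lbar n p X) \<le> (2 + 3 / A4) / \<phi>\<^sup>2 + 33 / \<phi>\<^sup>2 * 2" by linarith
        also have "\<dots> = (68 + 3 / A4) / \<phi>\<^sup>2" by (simp add: add_divide_distrib)
        finally show ?thesis unfolding psi_arg_def \<phi>_def[symmetric] s_def[symmetric] using s by (intro mult_right_mono) auto
      qed
      show ?thesis
      proof (cases "card (supp p b) = 0")
        case True
        then have "supp p b = {}" by (simp add: supp_def)
        then have "norm1 p b = 0" by (auto simp: norm1_def supp_def)
        moreover have "0 \<le> M * t" using M0 t by simp
        ultimately show ?thesis using Mle by linarith
      next
        case False
        have "\<psi> * (K * norm1 p b) \<le> norm2 n (mat_vec p X b) * sqrt (real (card (supp p b)))"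
          unfolding \<psi>_def psibar_def K_def by (rule phibar_le[OF X False of(3)[OF x]])
        also have "\<dots> \<le> (pred_const A3 A4 * (sqrt (s * L) / \<phi>)) * sqrt ((68 + 3 / A4) / \<phi>\<^sup>2 * s)"
        proof (intro mult_mono real_sqrt_le_mono)
          show "norm2 n (mat_vec p X b) \<le> pred_const A3 A4 * (sqrt (s * L) / \<phi>)"
            using of(1) by (simp only: s_def L_def \<phi>_def)
          then show "0 \<le> pred_const A3 A4 * (sqrt (s * L) / \<phi>)" using norm2_nonneg order_trans by blast
          show "real (card (supp p b)) \<le> (68 + 3 / A4) / \<phi>\<^sup>2 * s" using of(3)[OF x] D by linarith
        qed auto
        also have "\<dots> = (pred_const A3 A4 * sqrt (68 + 3 / A4)) * (K * t)"
          using s \<phi> K by (simp add: t_def real_sqrt_mult real_sqrt_divide power2_eq_square)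
        also have "\<dots> \<le> M * (K * t)" using M t K by (intro mult_right_mono) auto
        finally have "K * (\<psi> * norm1 p b) \<le> K * (M * t)" by (simp add: mult_ac)
        then have "\<psi> * norm1 p b \<le> M * t" using K by simp
        then have "norm1 p b \<le> M / \<psi> * t" using \<psi> by (simp add: pos_le_divide_eq mult.commute)
        then show ?thesis using Mle by linarith
      qed
    qed
    then show False using gt by linarith
  qed
qed

text \<open>Above the threshold errors need not be sparse. The sparse eigenvalue is then transferred
  to them, with a correction governed by the l1 loss.\<close>

lemma l2_subset_far:
  assumes large: large and X: "Xnorm n p X > 0" and S: "supp p \<beta>0 \<noteq> {}"
    and l: "l \<le> 2 * lbar n p X" "l > 0"
    and phi: "compat n p X (supp p \<beta>0) > 0" and psi: "psitil n p X l A4 (supp p \<beta>0) > 0"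
    and M: "pred_const A3 A4 \<le> M" "l2_const A3 A4 \<le> M"
  shows "{\<beta>. norm2 p (\<lambda>i. \<beta> i - \<beta>0 i) >
      M / (psitil n p X l A4 (supp p \<beta>0))^2 * sqrt (real (card (supp p \<beta>0)) * ln (real p))
        / (Xnorm n p X * compat n p X (supp p \<beta>0))} \<subseteq> far n X l \<beta>0"
proof
  fix \<beta>
  let ?S = "supp p \<beta>0"
  define \<psi> where "\<psi> = psitil n p X l A4 ?S"
  define \<phi> where "\<phi> = compat n p X ?S"
  define s where "s = real (card ?S)"
  define L where "L = ln (real p)"
  define K where "K = Xnorm n p X"
  define b where "b = (\<lambda>i. \<beta> i - \<beta>0 i)"
  define t where "t = sqrt (s * L) / (K * \<phi>)"
  have p: "p \<ge> 2" using large by (simp add: large_size_def)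
  have sub: "?S \<subseteq> {..<p}" by (auto simp: supp_def)
  note arg = psi_arg_ge[OF X p sub S l(2)]
  have L: "L > 0" using p by (simp add: L_def)
  have K: "K > 0" using X by (simp add: K_def)
  have s: "s \<ge> 1" using arg(3) by (simp add: s_def)
  have \<phi>: "\<phi> > 0" "\<phi> \<le> 1" using phi compat_le_1[OF X sub S] by (auto simp: \<phi>_def)
  have t: "0 \<le> t" using L K s \<phi> by (simp add: t_def)
  have \<psi>: "\<psi> > 0" "\<psi> \<le> 1" using psi phitil_le_1[OF X arg(2)] by (auto simp: \<psi>_def psitil_def)
  assume "\<beta> \<in> {\<beta>. norm2 p (\<lambda>i. \<beta> i - \<beta>0 i) >
      M / (psitil n p X l A4 ?S)^2 * sqrt (real (card ?S) * ln (real p)) / (Xnorm n p X * compat n p X ?S)}"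
  then have gt: "norm2 p b > M / \<psi>\<^sup>2 * t"
    by (simp add: t_def b_def \<psi>_def \<phi>_def s_def L_def K_def)
  have M0: "0 \<le> M"
    using conc_const_pos temper_pos by (intro order_trans[OF _ M(1)]) (simp add: pred_const_def)
  have Mle: "M / \<psi> * t \<le> M / \<psi>\<^sup>2 * t"
  proof -
    have "\<psi>\<^sup>2 \<le> \<psi>" using \<psi> by (simp add: power2_eq_square mult_left_le)
    then have "M / \<psi> \<le> M / \<psi>\<^sup>2" using \<psi> M0 by (intro divide_left_mono; simp)
    then show ?thesis using t by (intro mult_right_mono; simp)
  qed
  show "\<beta> \<in> far n X l \<beta>0"
  proof (rule ccontr)
    assume out: "\<beta> \<notin> far n X l \<beta>0"
    note of = outside_far[OF large X S l phi out, folded b_def]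
    have q: "norm2 n (mat_vec p X b) \<le> pred_const A3 A4 * (K * t)"
      using of(1) K by (simp add: t_def s_def L_def \<phi>_def)
    have "\<psi> * (K * norm2 p b) \<le> M * (K * t)"
    proof (cases "lam_cut A4 < l / lbar n p X")
      case False
      have "\<psi> * (K * norm2 p b) \<le> norm2 n (mat_vec p X b)"
        unfolding \<psi>_def psitil_def K_def using False by (intro phitil_le[OF X] of(3)) simp
      also have "\<dots> \<le> pred_const A3 A4 * (K * t)" by (rule q)
      also have "\<dots> \<le> M * (K * t)" using M t K by (intro mult_right_mono) auto
      finally show ?thesis .
    next
      case True
      define c where "c = lam_cut A4"
      have c: "c > 0" using lam_cut_pos by (simp add: c_def)
      define D where "D = psi_arg n p X l A4 ?S"
      \<comment> \<open>The largest integer sparsity covered by \<open>psitil\<close>.\<close>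
      define m where "m = nat \<lfloor>D\<rfloor>"
      have D2: "2 \<le> D" using arg(1,3) by (simp add: D_def)
      have m: "real m \<le> D" "D - 1 \<le> real m" "1 \<le> m" using D2 unfolding m_def by linarith+
      have mc: "33 * c * s / \<phi>\<^sup>2 \<le> real m - 1"
      proof -
        have "33 * c * s / \<phi>\<^sup>2 \<le> 33 * (l / lbar n p X) * s / \<phi>\<^sup>2"
          using True s by (intro divide_right_mono mult_right_mono mult_left_mono) (auto simp: c_def)
        also have "\<dots> \<le> D - 2" using arg(4) by (simp add: D_def s_def \<phi>_def)
        finally show ?thesis using m(2) by linarith
      qed
      have pos: "33 * c * s / \<phi>\<^sup>2 > 0" using c s \<phi> by simp
      then have m1: "real m - 1 > 0" using mc by linarith
      have tr: "(real m - 1) * ((\<psi>\<^sup>2 * K\<^sup>2) * (norm2 p b)\<^sup>2) \<le>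
        (real m - 1) * (norm2 n (mat_vec p X b))\<^sup>2 + K\<^sup>2 * (norm1 p b)\<^sup>2"
        unfolding K_def
      proof (rule sparse_eigenvalue_transfer[OF _ m(3)])
        fix v assume "card (supp p v) \<le> m"
        then have "real (card (supp p v)) \<le> D" using m(1) by linarith
        then have "\<psi> * (Xnorm n p X * norm2 p v) \<le> norm2 n (mat_vec p X v)"
          unfolding \<psi>_def psitil_def D_def by (rule phitil_le[OF X])
        then have "(\<psi> * (Xnorm n p X * norm2 p v))\<^sup>2 \<le> (norm2 n (mat_vec p X v))\<^sup>2"
          using \<psi> by (intro power_mono) (auto simp: norm2_nonneg Xnorm_nonneg)
        then show "\<psi>\<^sup>2 * (Xnorm n p X)\<^sup>2 * (norm2 p v)\<^sup>2 \<le> (norm2 n (mat_vec p X v))\<^sup>2"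
          by (simp add: power_mult_distrib mult.assoc)
      qed simp
      have "(\<psi> * (K * norm2 p b))\<^sup>2 \<le> (norm2 n (mat_vec p X b))\<^sup>2 + K\<^sup>2 * (norm1 p b)\<^sup>2 / (real m - 1)"
      proof -
        have "(real m - 1) * (\<psi> * (K * norm2 p b))\<^sup>2 \<le>
          (real m - 1) * ((norm2 n (mat_vec p X b))\<^sup>2 + K\<^sup>2 * (norm1 p b)\<^sup>2 / (real m - 1))"
          using tr m1 by (simp add: power_mult_distrib mult.assoc distrib_left)
        then show ?thesis using m1 by (rule mult_left_le_imp_le)
      qed
      also have "\<dots> \<le> (pred_const A3 A4 * (K * t))\<^sup>2 + (l1_const A3 A4)\<^sup>2 / (33 * c) * (K * t)\<^sup>2"
      proof (intro add_mono power_mono q norm2_nonneg)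
        have n1: "norm1 p b \<le> l1_const A3 A4 * (s * sqrt L / (K * \<phi>\<^sup>2))"
          using of(2)[OF True] by (simp only: s_def L_def K_def \<phi>_def)
        have "(norm1 p b)\<^sup>2 \<le> (l1_const A3 A4 * (s * sqrt L / (K * \<phi>\<^sup>2)))\<^sup>2"
          using n1 by (intro power_mono) (auto simp: norm1_def sum_nonneg)
        \<comment> \<open>The squared l1 bound is of order s^2 / \<phi>^4; dividing by m - 1, of
          order s / \<phi>^2, brings it to the l2 rate s / \<phi>^2.\<close>
        then have "K\<^sup>2 * (norm1 p b)\<^sup>2 / (real m - 1) \<le> K\<^sup>2 * (l1_const A3 A4 * (s * sqrt L / (K * \<phi>\<^sup>2)))\<^sup>2 / (33 * c * s / \<phi>\<^sup>2)"
          using mc pos by (intro frac_le mult_left_mono) auto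
        also have "\<dots> = (l1_const A3 A4)\<^sup>2 / (33 * c) * (K * t)\<^sup>2"
          using K s L \<phi> c by (simp add: t_def power_mult_distrib power_divide real_sqrt_mult field_simps power2_eq_square)
        finally show "K\<^sup>2 * (norm1 p b)\<^sup>2 / (real m - 1) \<le> (l1_const A3 A4)\<^sup>2 / (33 * c) * (K * t)\<^sup>2" .
      qed
      also have "\<dots> = (l2_const A3 A4 * (K * t))\<^sup>2"
        using c by (simp add: l2_const_def c_def power_mult_distrib distrib_right)
      finally have "\<psi> * (K * norm2 p b) \<le> l2_const A3 A4 * (K * t)"
        by (rule power2_le_imp_le) (use c K t in \<open>simp add: l2_const_def c_def\<close>)
      also have "\<dots> \<le> M * (K * t)" using M t K by (intro mult_right_mono) auto
      finally show ?thesis .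
    qed
    then have "K * (\<psi> * norm2 p b) \<le> K * (M * t)" by (simp add: mult_ac)
    then have "\<psi> * norm2 p b \<le> M * t" using K by simp
    then have "norm2 p b \<le> M / \<psi> * t" using \<psi> by (simp add: pos_le_divide_eq mult.commute)
    then show False using gt Mle by linarith
  qed
qed

end

subsection \<open>Recovery in the supremum norm\<close>

lemma mcoh_nonneg: "0 \<le> mcoh n p X"
  and mcoh_ge: "i < p \<Longrightarrow> j < p \<Longrightarrow> i \<noteq> j \<Longrightarrow>
    \<bar>dot n (\<lambda>k. X k i) (\<lambda>k. X k j)\<bar> / (colnorm n X i * colnorm n X j) \<le> mcoh n p X"
proof -
  let ?A = "{\<bar>\<Sum>k<n. X k i * X k j\<bar> / (colnorm n X i * colnorm n X j) | i j. i < p \<and> j < p \<and> i \<noteq> j}"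
  have "?A \<subseteq> (\<lambda>(i, j). \<bar>\<Sum>k<n. X k i * X k j\<bar> / (colnorm n X i * colnorm n X j)) ` ({..<p} \<times> {..<p})" by auto
  then have fin: "finite ?A" by (rule finite_subset) auto
  then show "0 \<le> mcoh n p X" unfolding mcoh_def by (intro Max_ge) auto
  assume "i < p" "j < p" "i \<noteq> j"
  then show "\<bar>dot n (\<lambda>k. X k i) (\<lambda>k. X k j)\<bar> / (colnorm n X i * colnorm n X j) \<le> mcoh n p X"
    unfolding mcoh_def dot_def using fin by (intro Max_ge) auto
qed

lemma mat_vec_fun_upd:
  assumes "i < p"
  shows "mat_vec p X (u(i := c)) = (\<lambda>k. mat_vec p X (u(i := 0)) k + c * X k i)"
proof
  fix k
  have "(\<Sum>j\<in>{..<p} - {i}. X k j * (u(i := c)) j) = (\<Sum>j\<in>{..<p} - {i}. X k j * (u(i := 0)) j)"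
    by (intro sum.cong) auto
  then show "mat_vec p X (u(i := c)) k = mat_vec p X (u(i := 0)) k + c * X k i"
    using assms by (simp add: mat_vec_def sum.remove[of "{..<p}" i])
qed

text \<open>Maximality of coordinate i is part of the set so that the other errors, at most R many,
  are bounded by the same size; sparsity and coherence then limit their influence on coordinate
  i.\<close>

definition peak_set :: "nat \<Rightarrow> (nat \<Rightarrow> real) \<Rightarrow> real \<Rightarrow> real \<Rightarrow> nat \<Rightarrow> (nat \<Rightarrow> real) set" where
  "peak_set p \<beta>0 R t i = {\<beta>. real (card (supp p (\<lambda>j. \<beta> j - \<beta>0 j))) \<le> R \<and>
     (\<forall>j\<in>{..<p}. \<bar>\<beta> j - \<beta>0 j\<bar> \<le> \<bar>\<beta> i - \<beta>0 i\<bar>) \<and> t < \<bar>\<beta> i - \<beta>0 i\<bar>}"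

lemma measurable_indicator_peak_set:
  assumes "i < p"
  shows "(indicator (peak_set p \<beta>0 R t i) :: _ \<Rightarrow> ennreal) \<in> borel_measurable (vecM p)"
proof -
  have c: "(\<lambda>\<beta>. \<beta> j) \<in> borel_measurable (vecM p)" if "j < p" for j using that by simp
  have a: "(\<lambda>\<beta>. \<bar>\<beta> j - \<beta>0 j\<bar>) \<in> borel_measurable (vecM p)" if "j < p" for j
    using c[OF that] by measurable
  have "{\<beta> \<in> space (vecM p). real (card (supp p (\<lambda>j. \<beta> j - \<beta>0 j))) \<le> R \<and>
     (\<forall>j\<in>{..<p}. \<bar>\<beta> j - \<beta>0 j\<bar> \<le> \<bar>\<beta> i - \<beta>0 i\<bar>) \<and> t < \<bar>\<beta> i - \<beta>0 i\<bar>} \<in> sets (vecM p)"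
    using assms
    by (intro sets.sets_Collect_conj sets.sets_Collect_finite_All borel_measurable_le borel_measurable_less
        measurable_card_supp a borel_measurable_const) auto
  moreover have "{\<beta> \<in> space (vecM p). real (card (supp p (\<lambda>j. \<beta> j - \<beta>0 j))) \<le> R \<and>
     (\<forall>j\<in>{..<p}. \<bar>\<beta> j - \<beta>0 j\<bar> \<le> \<bar>\<beta> i - \<beta>0 i\<bar>) \<and> t < \<bar>\<beta> i - \<beta>0 i\<bar>} = peak_set p \<beta>0 R t i \<inter> space (vecM p)"
    unfolding peak_set_def by auto
  ultimately show ?thesis by (simp add: borel_measurable_indicator_iff)
qed

text \<open>Replacing a dominating coordinate of the error by one of size at most \<open>1 / \<parallel>X\<parallel>\<close> multiplies the
  likelihood by a power of \<open>p\<close>: the mutual coherence bounds the influence of the other coordinates by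
  a quarter of the curvature in direction \<open>i\<close>.\<close>

lemma lik_peak_le:
  fixes \<beta> \<beta>0 :: "nat \<Rightarrow> real"
  assumes i: "i < p" and K: "Xnorm n p X > 0" and c0: "0 < c0" "c0 \<le> 1"
    and col: "\<And>j. j < p \<Longrightarrow> c0 * Xnorm n p X \<le> colnorm n X j"
    and R: "R * mcoh n p X \<le> c0 / 4"
    and L: "1 \<le> ln (real p)" and C: "0 \<le> C"
    and l: "l \<le> 2 * lbar n p X" "l > 0"
    and M: "80 / c0\<^sup>2 \<le> M" "8 * (5 + C) / c0 \<le> M"
    and noise: "noise_ok n p X (\<lambda>i. Y i - mat_vec p X \<beta>0 i)"
    and \<beta>: "\<beta> \<in> peak_set p \<beta>0 R (M * sqrt (ln (real p)) / Xnorm n p X) i"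
    and h: "\<bar>y - \<beta>0 i\<bar> \<le> 1 / Xnorm n p X"
  shows "lik n p X Y \<beta> * exp (C * ln (real p) + (Xnorm n p X + l) * \<bar>\<beta> i - \<beta>0 i\<bar>) \<le> lik n p X Y (\<beta>(i := y))"
proof -
  define b where "b = (\<lambda>j. \<beta> j - \<beta>0 j)"
  define z where "z = (\<lambda>i. Y i - mat_vec p X \<beta>0 i)"
  define r where "r = sqrt (ln (real p))"
  have r: "1 \<le> r" "r * r = ln (real p)" using L by (simp_all add: r_def)
  have rr: "r \<le> r * r" using mult_left_mono[OF r(1), of r] r(1) by simp
  define k where "k = colnorm n X i"
  define Kx where "Kx = Xnorm n p X"
  have Kx: "Kx > 0" using K by (simp add: Kx_def)
  have "0 < c0 * Kx" using c0 Kx by simp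
  then have k: "c0 * Kx \<le> k" "k \<le> Kx" "k > 0"
    using col[OF i] colnorm_le_Xnorm[OF i, of n X] unfolding k_def Kx_def by linarith+
  define v where "v = mat_vec p X (b(i := 0))"
  define xi where "xi = (\<lambda>k. X k i)"
  have kk: "dot n xi xi = k\<^sup>2" by (simp add: xi_def k_def colnorm_def norm2_power2)
  define g where "g = dot n z xi"
  define d where "d = dot n v xi"
  \<comment> \<open>As a function of the error c in coordinate i the log-likelihood is a parabola:
    slope g from the noise minus d from the other coordinates, curvature k^2.\<close>
  have exp_eq: "lik n p X Y (\<beta>(i := \<beta>0 i + c)) = lik n p X Y \<beta>0 *
     exp (dot n z v - dot n v v / 2 + (c * (g - d) - c\<^sup>2 * k\<^sup>2 / 2))" for c
  proof -
    have "(\<lambda>j. (\<beta>(i := \<beta>0 i + c)) j - \<beta>0 j) = b(i := c)" by (auto simp: b_def)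
    then have mv: "mat_vec p X (\<lambda>j. (\<beta>(i := \<beta>0 i + c)) j - \<beta>0 j) = (\<lambda>m. v m + c * xi m)"
      using mat_vec_fun_upd[OF i, of X b c] by (simp add: v_def xi_def)
    have 1: "dot n z (\<lambda>m. v m + c * xi m) = dot n z v + c * g"
      by (simp add: dot_add_right dot_scale_right g_def)
    have 2: "dot n (\<lambda>m. v m + c * xi m) (\<lambda>m. v m + c * xi m) = dot n v v + 2 * (c * d) + c\<^sup>2 * k\<^sup>2"
      by (simp add: dot_add_right dot_add_left dot_scale_right dot_scale_left dot_commute[of n xi v] kk d_def power2_eq_square)
    show ?thesis
      using lik_ratio[of n p X Y "\<beta>(i := \<beta>0 i + c)" \<beta>0]
      unfolding mv z_def[symmetric] norm2_power2 1 2 by (simp add: algebra_simps add_divide_distrib)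
  qed
  define w where "w = \<bar>b i\<bar>"
  have w: "0 \<le> w" by (simp add: w_def)
  have pk: "real (card (supp p b)) \<le> R" "\<And>j. j < p \<Longrightarrow> \<bar>b j\<bar> \<le> w" "M * r / Kx < w"
    using \<beta> unfolding peak_set_def b_def w_def r_def Kx_def by auto
  \<comment> \<open>The noise bound for the one-element support.\<close>
  have g: "\<bar>g\<bar> \<le> 4 * r * k"
  proof -
    define e where "e = (\<lambda>j. if j = i then 1 else 0 :: real)"
    have me: "mat_vec p X e = xi"
      using mat_vec_subset[of "{i}" p e X] i by (simp add: e_def xi_def)
    have "(dot n z (mat_vec p X e))\<^sup>2 \<le> 16 * real (card {i}) * ln (real p) * (norm2 n (mat_vec p X e))\<^sup>2"
      using noise i unfolding noise_ok_def z_def by (elim allE[of _ "{i}"] allE[of _ e]) (auto simp: e_def)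
    then have "g\<^sup>2 \<le> (4 * r * k)\<^sup>2"
      unfolding me norm2_power2 kk g_def[symmetric] r(2)[symmetric] by (simp add: power2_eq_square mult_ac)
    then show ?thesis using r k by (metis abs_le_square_iff abs_of_nonneg less_imp_le mult_nonneg_nonneg order_trans zero_le_numeral zero_le_one)
  qed
  \<comment> \<open>At most R coordinates of size w interact through the coherence. R
    \<open>mcoh\<close> <= c0 / 4 together with c0 |X| <= k gives a quarter of the
    curvature.\<close>
  have d: "\<bar>d\<bar> \<le> k\<^sup>2 * w / 4"
  proof -
    have col0: "colnorm n X j > 0" if "j < p" for j
      using col[OF that] mult_pos_pos[OF c0(1) K] by linarith
    have deq: "d = (\<Sum>j<p. (b(i := 0)) j * dot n (\<lambda>m. X m j) xi)"
    proof -
      have "v = (\<lambda>m. \<Sum>j<p. (b(i := 0)) j * X m j)"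
        unfolding v_def by (rule mat_vec_subset) auto
      then show ?thesis unfolding d_def by (simp only: dot_sum_left dot_scale_left)
    qed
    have "\<bar>d\<bar> \<le> (\<Sum>j<p. \<bar>(b(i := 0)) j * dot n (\<lambda>m. X m j) xi\<bar>)" unfolding deq by (rule sum_abs)
    also have "\<dots> \<le> (\<Sum>j<p. if j \<in> supp p b then w * (mcoh n p X * (Kx * k)) else 0)"
    proof (intro sum_mono)
      fix j assume "j \<in> {..<p}"
      then have j: "j < p" by simp
      have mk: "0 \<le> mcoh n p X * (Kx * k)" using mcoh_nonneg Kx k by (intro mult_nonneg_nonneg) auto
      show "\<bar>(b(i := 0)) j * dot n (\<lambda>m. X m j) xi\<bar> \<le> (if j \<in> supp p b then w * (mcoh n p X * (Kx * k)) else 0)"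
      proof (cases "j = i \<or> b j = 0")
        case True
        then show ?thesis using w mk by auto
      next
        case False
        then have ne: "j \<noteq> i" and js: "j \<in> supp p b" using j by (auto simp: supp_def)
        have "\<bar>dot n (\<lambda>m. X m j) xi\<bar> \<le> mcoh n p X * (colnorm n X j * k)"
          using mcoh_ge[OF j i ne, of n X] col0[OF j] k(3) unfolding xi_def k_def
          by (simp add: pos_divide_le_eq)
        also have "\<dots> \<le> mcoh n p X * (Kx * k)"
          using mcoh_nonneg k(3) colnorm_le_Xnorm[OF j, of n X] unfolding Kx_def
          by (intro mult_left_mono mult_right_mono) auto
        finally have "\<bar>b j\<bar> * \<bar>dot n (\<lambda>m. X m j) xi\<bar> \<le> w * (mcoh n p X * (Kx * k))"
          using pk(2)[OF j] w by (intro mult_mono) auto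
        then show ?thesis using ne js by (simp add: abs_mult)
      qed
    qed
    also have "\<dots> = real (card (supp p b)) * (w * (mcoh n p X * (Kx * k)))"
    proof -
      have "{..<p} \<inter> {j. j \<in> supp p b} = supp p b" by (auto simp: supp_def)
      then show ?thesis by (simp add: sum.If_cases)
    qed
    also have "\<dots> \<le> R * (w * (mcoh n p X * (Kx * k)))"
      using pk(1) w mcoh_nonneg Kx k by (intro mult_right_mono mult_nonneg_nonneg) auto
    also have "\<dots> = (R * mcoh n p X) * (w * (Kx * k))" by (simp add: mult_ac)
    also have "\<dots> \<le> c0 / 4 * (w * (Kx * k))" using R w Kx k by (intro mult_right_mono) auto
    also have "\<dots> = (c0 * Kx) * (w * k) / 4" by simp
    also have "\<dots> \<le> k * (w * k) / 4" using k w by (intro divide_right_mono mult_right_mono) auto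
    finally show ?thesis by (simp add: power2_eq_square mult_ac)
  qed
  define a where "a = y - \<beta>0 i"
  have a: "k * \<bar>a\<bar> \<le> 1"
  proof -
    have "k * \<bar>a\<bar> \<le> Kx * (1 / Kx)" using h k Kx by (intro mult_mono) (auto simp: a_def Kx_def)
    then show ?thesis using Kx by simp
  qed
  define T where "T = k * w"
  have T0: "0 \<le> T" using k w by (simp add: T_def)
  have Tge: "c0 * M * r \<le> T"
  proof -
    have "M * r \<le> w * Kx" using pk(3) Kx by (simp add: pos_divide_less_eq)
    then have "c0 * (M * r) \<le> c0 * (w * Kx)" using c0 by (intro mult_left_mono) auto
    also have "\<dots> = (c0 * Kx) * w" by simp
    also have "\<dots> \<le> k * w" using k w by (intro mult_right_mono) auto
    finally show ?thesis by (simp add: T_def mult_ac)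
  qed
  have "\<bar>g - d\<bar> \<le> 4 * r * k + k\<^sup>2 * w / 4" using g d by linarith
  then have gd: "\<bar>g - d\<bar> \<le> k * (4 * r + T / 4)" by (simp add: T_def power2_eq_square algebra_simps)
  \<comment> \<open>Log-likelihood at the old value minus that at the new one. The curvature gives
    -T^2 / 2, and the coherence term takes back T^2 / 4.\<close>
  have E: "b i * (g - d) - (b i)\<^sup>2 * k\<^sup>2 / 2 - (a * (g - d) - a\<^sup>2 * k\<^sup>2 / 2) \<le>
     - (1 / 4) * T\<^sup>2 + (4 * r + 1 / 4) * T + 4 * r + 1 / 2"
  proof -
    have "(b i - a) * (g - d) \<le> (w + \<bar>a\<bar>) * (k * (4 * r + T / 4))"
    proof -
      have "(b i - a) * (g - d) \<le> \<bar>b i - a\<bar> * \<bar>g - d\<bar>" by (metis abs_ge_self abs_mult)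
      also have "\<dots> \<le> (w + \<bar>a\<bar>) * (k * (4 * r + T / 4))"
        using gd unfolding w_def by (intro mult_mono abs_triangle_ineq4) auto
      finally show ?thesis .
    qed
    also have "\<dots> = (T + k * \<bar>a\<bar>) * (4 * r + T / 4)" by (simp add: T_def algebra_simps)
    also have "\<dots> \<le> (T + 1) * (4 * r + T / 4)" using a T0 r by (intro mult_right_mono) auto
    finally have 1: "(b i - a) * (g - d) \<le> (T + 1) * (4 * r + T / 4)" .
    have 2: "(b i)\<^sup>2 * k\<^sup>2 = T\<^sup>2" by (simp add: T_def w_def power_mult_distrib)
    have "(k * \<bar>a\<bar>)\<^sup>2 \<le> 1" using a k by (intro power_le_one) auto
    then have 3: "a\<^sup>2 * k\<^sup>2 \<le> 1" by (simp add: power_mult_distrib mult.commute)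
    have "(T + 1) * (4 * r + T / 4) = (1 / 4) * T\<^sup>2 + (4 * r + 1 / 4) * T + 4 * r"
      by (simp add: power2_eq_square algebra_simps)
    moreover have "(b i - a) * (g - d) = b i * (g - d) - a * (g - d)" by (simp add: left_diff_distrib)
    ultimately show ?thesis using 1 2 3 by argo
  qed
  \<comment> \<open>The remaining T^2 / 4 is halved. The condition 80 / c0^2 on M covers the terms
    linear in T, and 8 (5 + C) / c0 covers the gain C ln p together with the constants.\<close>
  have big: "- (1 / 4) * T\<^sup>2 + (4 * r + 1 / 4) * T + 4 * r + 1 / 2 \<le> - (C * (r * r) + (Kx + l) * w)"
  proof -
    have "(Kx + l) * w \<le> (5 * r / c0) * T"
    proof -
      have "l \<le> 4 * r * Kx" using l by (simp add: lbar_def r_def Kx_def mult_ac)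
      moreover have "1 * Kx \<le> r * Kx" using r Kx by (intro mult_right_mono) auto
      ultimately have "Kx + l \<le> 5 * r * Kx" by (simp add: mult.assoc)
      then have "(Kx + l) * w \<le> (5 * r * Kx) * w" using w by (intro mult_right_mono) auto
      also have "\<dots> = (5 * r / c0) * ((c0 * Kx) * w)" using c0 by simp
      also have "\<dots> \<le> (5 * r / c0) * (k * w)"
        using k w r c0 by (intro mult_left_mono mult_right_mono) auto
      finally show ?thesis by (simp add: T_def)
    qed
    moreover have "(4 * r + 1 / 4) * T \<le> (5 * r / c0) * T"
    proof (intro mult_right_mono T0)
      have "5 * r * c0 \<le> 5 * r * 1" using c0 r by (intro mult_left_mono) auto
      then have "5 * r \<le> 5 * r / c0" using c0 by (simp add: pos_le_divide_eq)
      then show "4 * r + 1 / 4 \<le> 5 * r / c0" using r by linarith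
    qed
    moreover have "(10 * r / c0) * T \<le> T\<^sup>2 / 8"
    proof -
      have "80 / c0 * r = c0 * (80 / c0\<^sup>2) * r" using c0 by (simp add: power2_eq_square)
      also have "\<dots> \<le> c0 * M * r" using M(1) c0 r by (intro mult_right_mono mult_left_mono) auto
      finally have "(80 / c0 * r) * T \<le> T * T" using Tge T0 by (intro mult_right_mono) auto
      then show ?thesis by (simp add: power2_eq_square)
    qed
    moreover have "(5 + C) * (r * r) \<le> T\<^sup>2 / 8"
    proof -
      have "8 * (5 + C) = c0 * (8 * (5 + C) / c0)" using c0 by simp
      also have "\<dots> \<le> c0 * M" using M(2) c0 by (intro mult_left_mono) auto
      finally have cM: "8 * (5 + C) \<le> c0 * M" .
      then have "8 * (5 + C) * r \<le> c0 * M * r" using r by (intro mult_right_mono) auto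
      then have T1: "8 * (5 + C) * r \<le> T" using Tge by linarith
      have "1 * r \<le> 8 * (5 + C) * r" using C r by (intro mult_right_mono) auto
      then have "r \<le> T" using T1 by linarith
      then have "(8 * (5 + C) * r) * r \<le> T * T" using T1 r T0 C by (intro mult_mono) auto
      then show ?thesis by (simp add: power2_eq_square algebra_simps)
    qed
    moreover have "4 * r + 1 / 2 \<le> 5 * (r * r)" using rr r by linarith
    moreover have "(10 * r / c0) * T = (5 * r / c0) * T + (5 * r / c0) * T" by simp
    moreover have "(5 + C) * (r * r) = 5 * (r * r) + C * (r * r)" by (simp add: distrib_right)
    ultimately show ?thesis by argo
  qed
  have "lik n p X Y \<beta> = lik n p X Y (\<beta>(i := \<beta>0 i + b i))" by (simp add: b_def)
  also have "\<dots> * exp (C * (r * r) + (Kx + l) * w) = lik n p X Y \<beta>0 *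
     exp (dot n z v - dot n v v / 2 + (b i * (g - d) - (b i)\<^sup>2 * k\<^sup>2 / 2) + (C * (r * r) + (Kx + l) * w))"
    unfolding exp_eq by (simp add: exp_add)
  also have "\<dots> \<le> lik n p X Y \<beta>0 * exp (dot n z v - dot n v v / 2 + (a * (g - d) - a\<^sup>2 * k\<^sup>2 / 2))"
    using E big lik_pos[of n p X Y \<beta>0] by (intro mult_left_mono) auto
  also have "\<dots> = lik n p X Y (\<beta>(i := y))" unfolding exp_eq[symmetric] by (simp add: a_def)
  finally show ?thesis by (simp add: r(2) w_def b_def Kx_def)
qed

text \<open>The value at a peak is compared with the average over an interval around
  \<open>\<beta>0 i\<close>, which the slab charges. Of the factor exp (- (|X| + l) |y -
  \<open>\<beta>0 i\<close>|), the part with l undoes the penalty exp (- l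
  |\<open>\<beta>0 i\<close>|) and the part with |X| makes the integral converge.\<close>

lemma nn_integral_coord_peak_le:
  assumes i: "i < p" and K: "Xnorm n p X > 0" and c0: "0 < c0" "c0 \<le> 1"
    and col: "\<And>j. j < p \<Longrightarrow> c0 * Xnorm n p X \<le> colnorm n X j"
    and R: "R * mcoh n p X \<le> c0 / 4"
    and L: "1 \<le> ln (real p)" and C: "0 \<le> C"
    and l: "l \<le> 2 * lbar n p X" "l > 0"
    and M: "80 / c0\<^sup>2 \<le> M" "8 * (5 + C) / c0 \<le> M"
    and noise: "noise_ok n p X (\<lambda>i. Y i - mat_vec p X \<beta>0 i)"
  shows "(\<integral>\<^sup>+y. indicator (peak_set p \<beta>0 R (M * sqrt (ln (real p)) / Xnorm n p X) i) (u(i := y)) *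
      ennreal (lik n p X Y (u(i := y))) \<partial>coord l S i) \<le>
    ennreal ((Xnorm n p X / l + 1) * exp (l / Xnorm n p X - C * ln (real p))) *
      (\<integral>\<^sup>+y. ennreal (lik n p X Y (u(i := y))) \<partial>laplace l)"
proof -
  let ?B = "peak_set p \<beta>0 R (M * sqrt (ln (real p)) / Xnorm n p X) i"
  define Kx where "Kx = Xnorm n p X"
  have Kx: "Kx > 0" using K by (simp add: Kx_def)
  define f where "f y = lik n p X Y (u(i := y))" for y
  have f0: "0 < f y" for y by (simp add: f_def lik_pos)
  have [measurable]: "f \<in> borel_measurable borel"
    unfolding f_def lik_def norm2_def mat_vec_def fun_upd_apply by measurable
  define a where "a = \<beta>0 i"
  define J where "J = (\<integral>\<^sup>+y. ennreal (f y) \<partial>laplace l)"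
  define Q where "Q = C * ln (real p)"
  define m where "m = l / Kx * exp (- l * \<bar>a\<bar> - l / Kx)"
  have m: "m > 0" using l Kx by (simp add: m_def)
  have point: "ennreal (f y) \<le> J * ennreal (exp (- (Q + (Kx + l) * \<bar>y - a\<bar>)) / m)"
    if y: "u(i := y) \<in> ?B" for y
  proof -
    define D where "D = Q + (Kx + l) * \<bar>y - a\<bar>"
    let ?U = "uniform_measure lborel {a - 1 / Kx..a + 1 / Kx}"
    interpret U: prob_space ?U by (rule prob_space_uniform_measure) (use Kx in auto)
    have "AE y' in ?U. y' \<in> {a - 1 / Kx..a + 1 / Kx}" by (rule AE_uniform_measureI) auto
    then have "AE y' in ?U. ennreal (f y * exp D) \<le> ennreal (f y')"
    proof eventually_elim
      fix y' assume "y' \<in> {a - 1 / Kx..a + 1 / Kx}"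
      then have "\<bar>y' - \<beta>0 i\<bar> \<le> 1 / Xnorm n p X" unfolding a_def Kx_def atLeastAtMost_iff by linarith
      from lik_peak_le[OF i K c0 col R L C l M noise y this]
      show "ennreal (f y * exp D) \<le> ennreal (f y')"
        by (intro ennreal_leI) (simp add: f_def D_def Q_def Kx_def a_def)
    qed
    then have "(\<integral>\<^sup>+y'. ennreal (f y * exp D) \<partial>?U) \<le> (\<integral>\<^sup>+y'. ennreal (f y') \<partial>?U)"
      by (rule nn_integral_mono_AE)
    then have "ennreal (f y * exp D) \<le> (\<integral>\<^sup>+y'. ennreal (f y') \<partial>?U)"
      by (simp add: U.emeasure_space_1[simplified])
    then have "ennreal m * ennreal (f y * exp D) \<le> ennreal m * (\<integral>\<^sup>+y'. ennreal (f y') \<partial>?U)"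
      by (rule mult_left_mono) simp
    also have "\<dots> \<le> J"
      using laplace_ge_uniform[OF l(2), of "1 / Kx" "\<lambda>y. ennreal (f y)" a] Kx by (simp add: m_def J_def)
    finally have le: "ennreal (m * (f y * exp D)) \<le> J" using m f0[of y] by (simp add: ennreal_mult')
    have "ennreal (f y) = ennreal (m * (f y * exp D)) * ennreal (exp (- D) / m)"
      using m f0[of y] by (subst ennreal_mult[symmetric]) (auto simp: exp_minus less_imp_le)
    also have "\<dots> \<le> J * ennreal (exp (- D) / m)" by (intro mult_right_mono le) simp
    finally show ?thesis by (simp add: D_def)
  qed
  define h where "h y = exp (l * \<bar>a\<bar> - (Kx + l) * \<bar>y - a\<bar>)" for y
  have [measurable]: "h \<in> borel_measurable borel" unfolding h_def by measurable
  define k1 where "k1 = Kx / l * exp (l / Kx - Q)"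
  have k1: "0 < k1" using Kx l by (simp add: k1_def)
  have "(\<integral>\<^sup>+y. indicator ?B (u(i := y)) * ennreal (f y) \<partial>coord l S i) \<le>
     (\<integral>\<^sup>+y. (J * ennreal k1) * ennreal (h y) \<partial>coord l S i)"
  proof (intro nn_integral_mono)
    fix y
    have "exp (- l * \<bar>a\<bar> - l / Kx) = inverse (exp (l * \<bar>a\<bar> + l / Kx))" by (simp add: exp_minus[symmetric])
    then have "exp (- (Q + (Kx + l) * \<bar>y - a\<bar>)) / m =
        Kx / l * (exp (- (Q + (Kx + l) * \<bar>y - a\<bar>)) * exp (l * \<bar>a\<bar> + l / Kx))"
      by (simp add: m_def divide_inverse)
    also have "\<dots> = k1 * h y"
      unfolding k1_def h_def mult.assoc exp_add[symmetric] by (simp add: algebra_simps)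
    finally have eq: "exp (- (Q + (Kx + l) * \<bar>y - a\<bar>)) / m = k1 * h y" .
    show "indicator ?B (u(i := y)) * ennreal (f y) \<le> (J * ennreal k1) * ennreal (h y)"
    proof (cases "u(i := y) \<in> ?B")
      case True
      have "ennreal (k1 * h y) = ennreal k1 * ennreal (h y)" using k1 by (intro ennreal_mult) (auto simp: h_def)
      then show ?thesis using point[OF True] True unfolding eq by (simp add: mult.assoc)
    qed simp
  qed
  also have "\<dots> = (J * ennreal k1) * (\<integral>\<^sup>+y. ennreal (h y) \<partial>coord l S i)"
    by (rule nn_integral_cmult) simp
  \<comment> \<open>The slab contributes at most l / |X| and the spike at most 1; the sum covers
    both cases.\<close>
  also have "(\<integral>\<^sup>+y. ennreal (h y) \<partial>coord l S i) \<le> ennreal (1 + l / Kx)"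
  proof (cases "i \<in> S")
    case True
    have "(\<integral>\<^sup>+y. ennreal (h y) \<partial>coord l S i) = (\<integral>\<^sup>+y. ennreal (l / 2 * exp (- l * \<bar>y\<bar>)) * ennreal (h y) \<partial>lborel)"
      using True by (simp add: coord_def nn_integral_laplace)
    also have "\<dots> \<le> (\<integral>\<^sup>+y. ennreal (l / 2) * ennreal (exp (- Kx * \<bar>y - a\<bar>)) \<partial>lborel)"
    proof (intro nn_integral_mono)
      fix y
      have "l * \<bar>a\<bar> \<le> l * (\<bar>y\<bar> + \<bar>y - a\<bar>)" using l by (intro mult_left_mono) auto
      then have "- l * \<bar>y\<bar> + (l * \<bar>a\<bar> - (Kx + l) * \<bar>y - a\<bar>) \<le> - Kx * \<bar>y - a\<bar>"
        by (simp add: algebra_simps)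
      then have "l / 2 * exp (- l * \<bar>y\<bar>) * h y \<le> l / 2 * exp (- Kx * \<bar>y - a\<bar>)"
        using l unfolding h_def mult.assoc exp_add[symmetric] by (intro mult_left_mono) auto
      then show "ennreal (l / 2 * exp (- l * \<bar>y\<bar>)) * ennreal (h y) \<le> ennreal (l / 2) * ennreal (exp (- Kx * \<bar>y - a\<bar>))"
        using l by (subst (1 2) ennreal_mult[symmetric]) (auto simp: h_def intro!: ennreal_leI)
    qed
    also have "\<dots> = ennreal (l / 2) * ennreal (2 / Kx)"
      by (subst nn_integral_cmult) (auto simp only: nn_integral_exp_abs[OF Kx], measurable)
    also have "\<dots> = ennreal (l / Kx)" using l Kx by (simp add: ennreal_mult[symmetric])
    also have "\<dots> \<le> ennreal (1 + l / Kx)" by (intro ennreal_leI) simp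
    finally show ?thesis .
  next
    case False
    have "(\<integral>\<^sup>+y. ennreal (h y) \<partial>coord l S i) = ennreal (h 0)"
      using False unfolding coord_def by (simp, subst nn_integral_return) auto
    also have "\<dots> \<le> ennreal (1 + l / Kx)"
    proof (rule ennreal_leI)
      have "h 0 \<le> 1" using Kx by (simp add: h_def algebra_simps)
      moreover have "0 \<le> l / Kx" using l Kx by simp
      ultimately show "h 0 \<le> 1 + l / Kx" by linarith
    qed
    finally show ?thesis .
  qed
  finally have "(\<integral>\<^sup>+y. indicator ?B (u(i := y)) * ennreal (f y) \<partial>coord l S i) \<le> (J * ennreal k1) * ennreal (1 + l / Kx)"
    by (simp add: mult_left_mono)
  also have "\<dots> = ennreal (k1 * (1 + l / Kx)) * J"
    using k1 l Kx by (subst ennreal_mult) (auto simp: mult_ac)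
  also have "k1 * (1 + l / Kx) = (Kx / l + 1) * exp (l / Kx - Q)"
    using l Kx by (simp add: k1_def field_simps)
  finally show ?thesis unfolding f_def J_def Q_def Kx_def .
qed

text \<open>The moved coordinate needs a density near \<open>\<beta>0 i\<close>, so the comparison
  integral lives on the model enlarged by i.\<close>

lemma nn_integral_model_peak_le:
  assumes i: "i < p" and K: "Xnorm n p X > 0" and c0: "0 < c0" "c0 \<le> 1"
    and col: "\<And>j. j < p \<Longrightarrow> c0 * Xnorm n p X \<le> colnorm n X j"
    and R: "R * mcoh n p X \<le> c0 / 4"
    and L: "1 \<le> ln (real p)" and C: "0 \<le> C"
    and l: "l \<le> 2 * lbar n p X" "l > 0"
    and M: "80 / c0\<^sup>2 \<le> M" "8 * (5 + C) / c0 \<le> M"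
    and noise: "noise_ok n p X (\<lambda>i. Y i - mat_vec p X \<beta>0 i)"
  shows "(\<integral>\<^sup>+\<beta>. indicator (peak_set p \<beta>0 R (M * sqrt (ln (real p)) / Xnorm n p X) i) \<beta> *
      ennreal (lik n p X Y \<beta>) \<partial>model p l S) \<le>
    ennreal ((Xnorm n p X / l + 1) * exp (l / Xnorm n p X - C * ln (real p))) *
      (\<integral>\<^sup>+\<beta>. ennreal (lik n p X Y \<beta>) \<partial>model p l (insert i S))"
proof -
  let ?B = "peak_set p \<beta>0 R (M * sqrt (ln (real p)) / Xnorm n p X) i"
  let ?I = "{..<p} - {i}"
  let ?e = "ennreal ((Xnorm n p X / l + 1) * exp (l / Xnorm n p X - C * ln (real p)))"
  have ins: "insert i ?I = {..<p}" using i by auto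
  have I: "finite ?I" "i \<notin> ?I" by auto
  interpret A: product_sigma_finite "coord l S" by (rule product_sigma_finite_coord[OF l(2)])
  interpret A': product_sigma_finite "coord l (insert i S)" by (rule product_sigma_finite_coord[OF l(2)])
  have sM: "sets (PiM J (coord l T)) = sets (PiM J (\<lambda>_. borel))" for J T by (intro sets_PiM_cong) auto
  note [measurable_cong] = sM
  have eqM: "PiM ?I (coord l (insert i S)) = PiM ?I (coord l S)"
    by (intro PiM_cong) (auto simp: coord_def)
  have m1: "(\<lambda>\<beta>. indicator ?B \<beta> * ennreal (lik n p X Y \<beta>)) \<in> borel_measurable (PiM (insert i ?I) (coord l S))"
    unfolding ins using measurable_indicator_peak_set[OF i] by measurable
  have m2: "(\<lambda>\<beta>. ennreal (lik n p X Y \<beta>)) \<in> borel_measurable (PiM (insert i ?I) (coord l (insert i S)))"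
    unfolding ins by measurable
  have m3: "(\<lambda>u. \<integral>\<^sup>+y. ennreal (lik n p X Y (u(i := y))) \<partial>laplace l) \<in> borel_measurable (PiM ?I (coord l S))"
  proof -
    interpret lap: sigma_finite_measure "laplace l" by (intro prob_space_imp_sigma_finite prob_space_laplace l)
    have "(\<lambda>z. ennreal (lik n p X Y ((fst z)(i := snd z)))) \<in> borel_measurable (PiM ?I (\<lambda>_. borel) \<Otimes>\<^sub>M borel)"
      using measurable_comp[OF measurable_add_dim[of i ?I "\<lambda>_. borel"], of "\<lambda>\<beta>. ennreal (lik n p X Y \<beta>)" borel]
      unfolding ins by (simp add: comp_def split_beta')
    then show ?thesis
      by (intro lap.borel_measurable_nn_integral) (simp add: split_beta')
  qed
  have "(\<integral>\<^sup>+\<beta>. indicator ?B \<beta> * ennreal (lik n p X Y \<beta>) \<partial>model p l S) =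
     (\<integral>\<^sup>+u. \<integral>\<^sup>+y. indicator ?B (u(i := y)) * ennreal (lik n p X Y (u(i := y))) \<partial>coord l S i \<partial>PiM ?I (coord l S))"
    unfolding model_def using A.product_nn_integral_insert[OF I m1] by (simp only: ins)
  also have "\<dots> \<le> (\<integral>\<^sup>+u. ?e * (\<integral>\<^sup>+y. ennreal (lik n p X Y (u(i := y))) \<partial>laplace l) \<partial>PiM ?I (coord l S))"
    by (intro nn_integral_mono nn_integral_coord_peak_le[OF i K c0 col R L C l M noise])
  also have "\<dots> = ?e * (\<integral>\<^sup>+u. \<integral>\<^sup>+y. ennreal (lik n p X Y (u(i := y))) \<partial>laplace l \<partial>PiM ?I (coord l S))"
    by (rule nn_integral_cmult[OF m3])
  also have "(\<integral>\<^sup>+u. \<integral>\<^sup>+y. ennreal (lik n p X Y (u(i := y))) \<partial>laplace l \<partial>PiM ?I (coord l S)) =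
     (\<integral>\<^sup>+\<beta>. ennreal (lik n p X Y \<beta>) \<partial>model p l (insert i S))"
  proof -
    have "coord l (insert i S) i = laplace l" by (simp add: coord_def)
    then show ?thesis
      unfolding model_def using A'.product_nn_integral_insert[OF I m2] by (simp only: ins eqM)
  qed
  finally show ?thesis .
qed

section \<open>Prior cost of moving one coordinate and the sup-norm risk\<close>

context size_prior
begin

text \<open>Raising the size by one costs at most p^(A3 + 1) in the size prior, and the uniform
  choice of the support costs a further factor p.\<close>

lemma weight_insert_le:
  assumes L: large and S: "S \<subseteq> {..<p}" and i: "i < p"
  shows "weight p \<pi> S \<le> (2 * real p powr (A3 + 2)) * weight p \<pi> (insert i S)"
proof (cases "i \<in> S")
  case True
  have "1 \<le> real p powr (A3 + 2)" using L A_pos by (intro ge_one_powr_ge_zero) (auto simp: large_size_def)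
  then have "1 * weight p \<pi> S \<le> (2 * real p powr (A3 + 2)) * weight p \<pi> S"
    by (intro mult_right_mono weight_nonneg) linarith
  then show ?thesis using True by (simp add: insert_absorb)
next
  case False
  have fS: "finite S" using S finite_subset by auto
  define s where "s = card S"
  have "card (insert i S) \<le> card {..<p}" using S i by (intro card_mono) auto
  then have s: "Suc s \<le> p" using False fS by (simp add: s_def)
  have p: "real p > 0" using L by (simp add: large_size_def)
  have ch: "real (p choose Suc s) \<le> real p * real (p choose s)"
  proof -
    have "Suc s * (p choose Suc s) = (p - s) * (p choose s)"
      by (metis binomial_absorb_comp binomial_absorption mult.commute)
    then have "(p choose Suc s) \<le> (p - s) * (p choose s)" by (metis le_add1 mult_Suc)
    also have "\<dots> \<le> p * (p choose s)" by (intro mult_right_mono) auto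
    finally show ?thesis by (metis of_nat_le_iff of_nat_mult)
  qed
  have c0: "real (p choose s) > 0" "real (p choose Suc s) > 0" using s by auto
  have "pmf \<pi> s \<le> (real p powr A3 / A1) * pmf \<pi> (Suc s)"
    using pmf_ratio_lower[of s "Suc s"] s by simp
  also have "\<dots> \<le> real p powr (A3 + 1) * pmf \<pi> (Suc s)"
  proof (intro mult_right_mono)
    have "real p powr A3 * (1 / A1) \<le> real p powr A3 * real p" using L by (intro mult_left_mono) (auto simp: large_size_def)
    then show "real p powr A3 / A1 \<le> real p powr (A3 + 1)" using p by (simp add: powr_add)
  qed simp
  finally have "pmf \<pi> s / real (p choose s) \<le> real p powr (A3 + 1) * pmf \<pi> (Suc s) / real (p choose s)"
    by (intro divide_right_mono) auto
  also have "\<dots> \<le> real p powr (A3 + 1) * pmf \<pi> (Suc s) * (real p / real (p choose Suc s))"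
  proof -
    have "1 / real (p choose s) \<le> real p / real (p choose Suc s)" using ch c0 by (simp add: field_simps)
    then have "real p powr (A3 + 1) * pmf \<pi> (Suc s) * (1 / real (p choose s)) \<le> real p powr (A3 + 1) * pmf \<pi> (Suc s) * (real p / real (p choose Suc s))"
      by (intro mult_left_mono) auto
    then show ?thesis by simp
  qed
  also have "\<dots> = real p powr (A3 + 2) * (pmf \<pi> (Suc s) / real (p choose Suc s))"
    using p by (simp add: powr_add powr_numeral power2_eq_square)
  also have "\<dots> \<le> (2 * real p powr (A3 + 2)) * (pmf \<pi> (Suc s) / real (p choose Suc s))"
    by (intro mult_right_mono) auto
  finally show ?thesis using False fS by (simp add: weight_def s_def)
qed

text \<open>Inserting i is two-to-one onto the supports that contain i.\<close>

lemma sum_Pow_insert_le: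
  fixes f :: "nat set \<Rightarrow> ennreal"
  assumes i: "i < p"
  shows "(\<Sum>S\<in>Pow {..<p}. f (insert i S)) \<le> 2 * (\<Sum>S\<in>Pow {..<p}. f S)"
proof -
  let ?A = "{S \<in> Pow {..<p}. i \<in> S}" and ?B = "{S \<in> Pow {..<p}. i \<notin> S}"
  have "(\<Sum>S\<in>Pow {..<p}. f (insert i S)) = (\<Sum>S\<in>?A. f (insert i S)) + (\<Sum>S\<in>?B. f (insert i S))"
  proof -
    have "Pow {..<p} = ?A \<union> ?B" by auto
    moreover have "?A \<inter> ?B = {}" by auto
    ultimately show ?thesis by (metis (no_types, lifting) finite_Pow_iff finite_Un finite_lessThan sum.union_disjoint)
  qed
  also have "(\<Sum>S\<in>?A. f (insert i S)) = (\<Sum>S\<in>?A. f S)" by (intro sum.cong) (auto simp: insert_absorb)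
  also have "(\<Sum>S\<in>?B. f (insert i S)) = (\<Sum>S\<in>?A. f S)"
    using i by (intro sum.reindex_bij_witness[of _ "\<lambda>S. S - {i}" "insert i"]) auto
  also have "(\<Sum>S\<in>?A. f S) + (\<Sum>S\<in>?A. f S) = 2 * (\<Sum>S\<in>?A. f S)" by (simp add: mult_2)
  also have "\<dots> \<le> 2 * (\<Sum>S\<in>Pow {..<p}. f S)" by (intro mult_left_mono sum_mono2) auto
  finally show ?thesis .
qed

lemma marginal_peak_le:
  assumes large: large and i: "i < p" and K: "Xnorm n p X > 0" and c0: "0 < c0" "c0 \<le> 1"
    and col: "\<And>j. j < p \<Longrightarrow> c0 * Xnorm n p X \<le> colnorm n X j"
    and R: "R * mcoh n p X \<le> c0 / 4"
    and L: "1 \<le> ln (real p)"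
    and l: "Xnorm n p X / real p \<le> l" "l \<le> 2 * lbar n p X" "l > 0"
    and M: "80 / c0\<^sup>2 \<le> M" "8 * (11 + A3) / c0 \<le> M"
    and noise: "noise_ok n p X (\<lambda>i. Y i - mat_vec p X \<beta>0 i)"
  shows "marginal n p X l \<pi> Y (peak_set p \<beta>0 R (M * sqrt (ln (real p)) / Xnorm n p X) i)
    \<le> ennreal (8 / (real p)\<^sup>2) * marginal n p X l \<pi> Y UNIV"
proof -
  let ?B = "peak_set p \<beta>0 R (M * sqrt (ln (real p)) / Xnorm n p X) i"
  \<comment> \<open>Chosen to beat the prior cost p^(A3 + 2), two further factors p from the
    coordinate integral, and still leave p^(-2) for the union over p coordinates.\<close>
  define C where "C = 6 + A3"
  have C: "0 \<le> C" "8 * (5 + C) / c0 \<le> M" using A_pos M by (simp_all add: C_def)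
  define e where "e = (Xnorm n p X / l + 1) * exp (l / Xnorm n p X - C * ln (real p))"
  define I where "I S = (\<integral>\<^sup>+\<beta>. ennreal (lik n p X Y \<beta>) \<partial>model p l S)" for S
  define \<nu> where "\<nu> = 2 * real p powr (A3 + 2)"
  have p: "real p > 1" "p \<ge> 2" using large by (auto simp: large_size_def)
  have e0: "0 \<le> e" using K l by (auto simp: e_def intro!: mult_nonneg_nonneg add_nonneg_nonneg)
  have \<nu>: "0 \<le> \<nu>" by (simp add: \<nu>_def)
  have "marginal n p X l \<pi> Y ?B = (\<Sum>S\<in>Pow {..<p}. ennreal (weight p \<pi> S) *
      (\<integral>\<^sup>+\<beta>. indicator ?B \<beta> * ennreal (lik n p X Y \<beta>) \<partial>model p l S))"
    unfolding marginal_def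
    by (intro nn_integral_prior[OF supp_\<pi> l(3)] borel_measurable_times_ennreal measurable_indicator_peak_set[OF i]) simp
  also have "\<dots> \<le> (\<Sum>S\<in>Pow {..<p}. ennreal (\<nu> * weight p \<pi> (insert i S)) * (ennreal e * I (insert i S)))"
    unfolding I_def e_def \<nu>_def
    using weight_insert_le[OF large _ i] nn_integral_model_peak_le[OF i K c0 col R L C(1) l(2,3) M(1) C(2) noise]
    by (intro sum_mono mult_mono ennreal_leI) auto
  also have "\<dots> = ennreal (\<nu> * e) * (\<Sum>S\<in>Pow {..<p}. ennreal (weight p \<pi> (insert i S)) * I (insert i S))"
    using \<nu> e0 weight_nonneg by (simp add: ennreal_mult sum_distrib_left mult_ac)
  also have "\<dots> \<le> ennreal (\<nu> * e) * (2 * (\<Sum>S\<in>Pow {..<p}. ennreal (weight p \<pi> S) * I S))"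
    using sum_Pow_insert_le[OF i, of "\<lambda>S. ennreal (weight p \<pi> S) * I S"] by (intro mult_left_mono) auto
  also have "(\<Sum>S\<in>Pow {..<p}. ennreal (weight p \<pi> S) * I S) = marginal n p X l \<pi> Y UNIV"
    unfolding marginal_UNIV I_def by (rule nn_integral_prior[OF supp_\<pi> l(3), symmetric]) measurable
  also have "ennreal (\<nu> * e) * (2 * marginal n p X l \<pi> Y UNIV) = ennreal (2 * (\<nu> * e)) * marginal n p X l \<pi> Y UNIV"
    using \<nu> e0 by (simp add: ennreal_mult mult_ac)
  also have "\<dots> \<le> ennreal (8 / (real p)\<^sup>2) * marginal n p X l \<pi> Y UNIV"
  proof (intro mult_right_mono ennreal_leI)
    have "e \<le> (2 * real p) * (real p * real p powr (- C))"
      unfolding e_def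
    proof (intro mult_mono)
      have "Xnorm n p X / l \<le> real p" using l K p by (simp add: divide_le_eq pos_divide_le_eq mult.commute)
      then show "Xnorm n p X / l + 1 \<le> 2 * real p" using p by linarith
      have "l / Xnorm n p X \<le> 4 * sqrt (ln (real p))"
        using l(2) K by (simp add: lbar_def divide_le_eq mult_ac)
      then have "exp (l / Xnorm n p X) \<le> exp (1 / 2 + 4 * sqrt (ln (real p)))" by simp
      also have "\<dots> \<le> real p powr (1 / 16)" using large by (simp add: large_size_def)
      also have "\<dots> \<le> real p powr 1" using p by (intro powr_mono) auto
      finally have "exp (l / Xnorm n p X) \<le> real p" using p by simp
      moreover have "exp (- (C * ln (real p))) = real p powr (- C)" using p by (simp add: powr_def)
      ultimately show "exp (l / Xnorm n p X - C * ln (real p)) \<le> real p * real p powr (- C)"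
        by (simp add: exp_diff exp_minus divide_inverse mult_right_mono)
    qed (use p in auto)
    then have "2 * (\<nu> * e) \<le> 2 * (\<nu> * ((2 * real p) * (real p * real p powr (- C))))"
      using \<nu> by (intro mult_left_mono) auto
    also have "\<dots> = 8 * (real p powr (A3 + 2) * real p powr 1 * real p powr 1 * real p powr (- C))"
      using p by (simp add: \<nu>_def)
    also have "\<dots> = 8 * real p powr (- 2)" unfolding powr_add[symmetric] by (simp add: C_def)
    also have "\<dots> = 8 / (real p)\<^sup>2" using p by (simp add: powr_minus_divide powr_numeral)
    finally show "2 * (\<nu> * e) \<le> 8 / (real p)\<^sup>2" .
  qed simp
  finally show ?thesis .
qed

text \<open>Outside the far set the error is sparse; if its sup norm is large, a largest coordinate
  places it in one of the p peak sets. Each of these carries at most 8 / p^2 of the posterior when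
  the noise bound holds.\<close>

lemma post_risk_sup:
  assumes large: large and X: "Xnorm n p X > 0" and S: "supp p \<beta>0 \<noteq> {}"
    and l: "Xnorm n p X / real p \<le> l" "l \<le> 2 * lbar n p X" "l > 0"
    and phi: "compat n p X (supp p \<beta>0) > 0"
    and c0: "0 < c0" "c0 \<le> psitil n p X l A4 (supp p \<beta>0)"
    and x: "l / lbar n p X \<le> lam_cut A4"
    and R: "psi_arg n p X l A4 (supp p \<beta>0) * mcoh n p X \<le> c0 / 4"
    and L: "1 \<le> ln (real p)"
    and M: "80 / c0\<^sup>2 \<le> M" "8 * (11 + A3) / c0 \<le> M"
  shows "post_risk n p X l \<pi> \<beta>0 {\<beta>. normInf p (\<lambda>i. \<beta> i - \<beta>0 i) > M * sqrt (ln (real p)) / Xnorm n p X}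
    \<le> noise_rate p + 8 / real p"
proof -
  define t where "t = M * sqrt (ln (real p)) / Xnorm n p X"
  define B where "B = {\<beta>. normInf p (\<lambda>i. \<beta> i - \<beta>0 i) > t}"
  define R' where "R' = psi_arg n p X l A4 (supp p \<beta>0)"
  let ?P = "peak_set p \<beta>0 R' t"
  have p: "p \<ge> 2" using large by (simp add: large_size_def)
  have sub: "supp p \<beta>0 \<subseteq> {..<p}" by (auto simp: supp_def)
  note arg = psi_arg_ge[OF X p sub S l(3)]
  have c01: "c0 \<le> 1" using c0 phitil_le_1[OF X arg(2)] by (simp add: psitil_def)
  have col: "c0 * Xnorm n p X \<le> colnorm n X j" if "j < p" for j
  proof -
    have "c0 * Xnorm n p X \<le> psitil n p X l A4 (supp p \<beta>0) * Xnorm n p X"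
      using c0 X by (intro mult_right_mono) auto
    also have "\<dots> \<le> colnorm n X j" unfolding psitil_def by (rule colnorm_ge_phitil[OF X arg(2) that])
    finally show ?thesis .
  qed
  have M0: "0 \<le> M" using M(1) by (rule order_trans[rotated]) simp
  have t0: "0 \<le> t" using M0 X L by (simp add: t_def)
  have cover: "B \<subseteq> far n X l \<beta>0 \<union> (\<Union>i<p. ?P i)"
  proof
    fix \<beta> assume \<beta>: "\<beta> \<in> B"
    define b where "b = (\<lambda>i. \<beta> i - \<beta>0 i)"
    show "\<beta> \<in> far n X l \<beta>0 \<union> (\<Union>i<p. ?P i)"
    proof (cases "\<beta> \<in> far n X l \<beta>0")
      case False
      have dim: "real (card (supp p b)) \<le> R'"
        using outside_far(3)[OF large X S l(2,3) phi False x] by (simp add: b_def R'_def)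
      have "normInf p b \<in> insert 0 ((\<lambda>i. \<bar>b i\<bar>) ` {..<p})"
        unfolding normInf_def by (rule Max_in) auto
      moreover have gt: "normInf p b > t" using \<beta> by (simp add: B_def b_def)
      ultimately obtain i where i: "i < p" "normInf p b = \<bar>b i\<bar>" using t0 by auto
      have "\<bar>b j\<bar> \<le> \<bar>b i\<bar>" if "j < p" for j
        unfolding i(2)[symmetric] normInf_def using that by (intro Max_ge) auto
      then have "\<beta> \<in> ?P i" using dim gt i unfolding peak_set_def b_def by auto
      then show ?thesis using i by auto
    qed simp
  qed
  obtain G :: "(nat \<Rightarrow> real) \<Rightarrow> ennreal" where
    G: "(\<integral>\<^sup>+Y. G Y \<partial>data_law n p X \<beta>0) \<le> ennreal (noise_rate p)"
    "\<And>Y. G Y < 1 \<Longrightarrow> noise_ok n p X (\<lambda>i. Y i - mat_vec p X \<beta>0 i)"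
    "\<And>Y. G Y < 1 \<Longrightarrow> marginal n p X l \<pi> Y (far n X l \<beta>0) \<le> G Y * marginal n p X l \<pi> Y UNIV"
    and Gm [measurable]: "G \<in> borel_measurable (data_law n p X \<beta>0)"
    using posterior_concentration[OF large X S l phi] by blast
  have "ennreal (posterior n p X l \<pi> Y B) \<le> G Y + ennreal (8 / real p)" for Y
  proof (cases "G Y < 1")
    case True
    let ?m = "marginal n p X l \<pi> Y UNIV"
    show ?thesis
    proof (rule posterior_le[OF l(3)])
      have "marginal n p X l \<pi> Y B \<le>
        (\<integral>\<^sup>+\<beta>. indicator (far n X l \<beta>0) \<beta> * ennreal (lik n p X Y \<beta>) +
           (\<Sum>i<p. indicator (?P i) \<beta> * ennreal (lik n p X Y \<beta>)) \<partial>prior p l \<pi>)"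
        unfolding marginal_def
      proof (intro nn_integral_mono)
        fix \<beta>
        have "(indicator B \<beta> :: ennreal) \<le> indicator (far n X l \<beta>0) \<beta> + (\<Sum>i<p. indicator (?P i) \<beta>)"
        proof (cases "\<beta> \<in> B \<and> \<beta> \<notin> far n X l \<beta>0")
          case True
          then obtain i where "i < p" "\<beta> \<in> ?P i" using cover by blast
          then have "(1::ennreal) \<le> (\<Sum>i<p. indicator (?P i) \<beta>)"
            using member_le_sum[of i "{..<p}" "\<lambda>i. indicator (?P i) \<beta> :: ennreal"] by simp
          then show ?thesis using True by simp
        next
          case False
          then show ?thesis by (auto simp: indicator_def)
        qed
        then have "indicator B \<beta> * ennreal (lik n p X Y \<beta>) \<le>
            (indicator (far n X l \<beta>0) \<beta> + (\<Sum>i<p. indicator (?P i) \<beta>)) * ennreal (lik n p X Y \<beta>)"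
          by (rule mult_right_mono) simp
        then show "indicator B \<beta> * ennreal (lik n p X Y \<beta>) \<le> indicator (far n X l \<beta>0) \<beta> * ennreal (lik n p X Y \<beta>) +
           (\<Sum>i<p. indicator (?P i) \<beta> * ennreal (lik n p X Y \<beta>))"
          by (simp add: distrib_right sum_distrib_right)
      qed
      also have "\<dots> = marginal n p X l \<pi> Y (far n X l \<beta>0) + (\<Sum>i<p. marginal n p X l \<pi> Y (?P i))"
      proof -
        have mP: "(\<lambda>\<beta>. indicator (?P i) \<beta> * ennreal (lik n p X Y \<beta>)) \<in> borel_measurable (prior p l \<pi>)" if "i < p" for i
          unfolding measurable_cong_sets[OF sets_prior refl]
          by (intro borel_measurable_times_ennreal measurable_indicator_peak_set[OF that]) simp
        have mF: "(\<lambda>\<beta>. indicator (far n X l \<beta>0) \<beta> * ennreal (lik n p X Y \<beta>)) \<in> borel_measurable (prior p l \<pi>)"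
          unfolding measurable_cong_sets[OF sets_prior refl]
          by (intro borel_measurable_times_ennreal measurable_indicator_far_set) simp
        have mS: "(\<lambda>\<beta>. \<Sum>i<p. indicator (?P i) \<beta> * ennreal (lik n p X Y \<beta>)) \<in> borel_measurable (prior p l \<pi>)"
          by (rule borel_measurable_sum) (rule mP, simp)
        show ?thesis unfolding marginal_def nn_integral_add[OF mF mS]
          by (subst nn_integral_sum) (rule mP, simp, rule refl)
      qed
      also have "\<dots> \<le> G Y * ?m + (\<Sum>i<p. ennreal (8 / (real p)\<^sup>2) * ?m)"
      proof (intro add_mono G(3)[OF True] sum_mono)
        fix i assume "i \<in> {..<p}"
        then have "i < p" by simp
        then show "marginal n p X l \<pi> Y (?P i) \<le> ennreal (8 / (real p)\<^sup>2) * ?m"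
          unfolding t_def R'_def
          by (rule marginal_peak_le[OF large _ X c0(1) c01 col R L l M G(2)[OF True]])
      qed
      also have "(\<Sum>i<p. ennreal (8 / (real p)\<^sup>2) * ?m) = ennreal (8 / real p) * ?m"
      proof -
        have "of_nat p * ennreal (8 / (real p)\<^sup>2) = ennreal (real p * (8 / (real p)\<^sup>2))"
          unfolding ennreal_of_nat_eq_real_of_nat by (rule ennreal_mult''[symmetric]) simp
        also have "real p * (8 / (real p)\<^sup>2) = 8 / real p" using p by (simp add: power2_eq_square)
        finally show ?thesis by (simp add: mult.assoc[symmetric])
      qed
      also have "G Y * ?m + ennreal (8 / real p) * ?m = (G Y + ennreal (8 / real p)) * ?m" by (simp add: distrib_right)
      finally show "marginal n p X l \<pi> Y B \<le> (G Y + ennreal (8 / real p)) * ?m" .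
    qed
  next
    case False
    have "ennreal (posterior n p X l \<pi> Y B) \<le> 1" using posterior_le_1[OF l(3)] by simp
    also have "1 \<le> G Y" using False by (simp add: not_less)
    also have "\<dots> \<le> G Y + ennreal (8 / real p)" by simp
    finally show ?thesis .
  qed
  moreover have "(\<integral>\<^sup>+Y. G Y + ennreal (8 / real p) \<partial>data_law n p X \<beta>0) \<le> ennreal (noise_rate p + 8 / real p)"
  proof -
    interpret prob_space "data_law n p X \<beta>0" by (rule prob_space_data_law)
    have "(\<integral>\<^sup>+Y. G Y + ennreal (8 / real p) \<partial>data_law n p X \<beta>0) = (\<integral>\<^sup>+Y. G Y \<partial>data_law n p X \<beta>0) + ennreal (8 / real p)"
      by (subst nn_integral_add) (simp_all add: emeasure_space_1)
    also have "\<dots> \<le> ennreal (noise_rate p) + ennreal (8 / real p)" by (intro add_right_mono G(1))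
    finally show ?thesis by (simp add: ennreal_plus noise_rate_nonneg)
  qed
  ultimately have "post_risk n p X l \<pi> \<beta>0 B \<le> noise_rate p + 8 / real p"
    by (rule post_risk_le) (simp add: noise_rate_nonneg)
  then show ?thesis by (simp add: B_def t_def)
qed

end

subsection \<open>Asymptotics\<close>

definition null_rate :: "real \<Rightarrow> real \<Rightarrow> nat \<Rightarrow> real" where
  "null_rate A2 A4 p = exp (1 / 2 + 4 * sqrt (ln (real p))) * (2 * A2 * real p powr (- A4))"

lemma null_rate_tendsto:
  assumes "A4 > 0"
  shows "null_rate A2 A4 \<longlonglongrightarrow> 0"
proof -
  have "(\<lambda>p. exp (1 / 2 + 4 * sqrt (ln (real p))) * real p powr (- A4)) \<longlonglongrightarrow> 0"
    using assms by real_asymp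
  from tendsto_mult_right[OF this, of "2 * A2"] show ?thesis
    by (simp add: null_rate_def[abs_def] mult_ac)
qed

text \<open>A real supremum is informative only once boundedness is known, so the majorant serves
  both as the bound and as that certificate.\<close>

lemma SUP_tendsto_0:
  fixes f :: "nat \<Rightarrow> 'b \<Rightarrow> real"
  assumes bound: "eventually (\<lambda>k. \<forall>\<beta>. 0 \<le> f k \<beta> \<and> f k \<beta> \<le> r k) sequentially" and r: "r \<longlonglongrightarrow> 0"
  shows "(\<lambda>k. SUP \<beta>. f k \<beta>) \<longlonglongrightarrow> 0"
proof (rule tendsto_sandwich[OF _ _ tendsto_const r])
  show "eventually (\<lambda>k. 0 \<le> (SUP \<beta>. f k \<beta>)) sequentially"
    using bound
  proof eventually_elim
    case (elim k)
    have "f k undefined \<le> (SUP \<beta>. f k \<beta>)"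
      using elim by (intro cSUP_upper bdd_aboveI2[where M = "r k"]) auto
    then show ?case using elim by (meson order_trans)
  qed
  show "eventually (\<lambda>k. (SUP \<beta>. f k \<beta>) \<le> r k) sequentially"
    using bound by eventually_elim (intro cSUP_least, auto)
qed

lemma supp_empty_norms:
  assumes "supp p \<beta>0 = {}" "\<forall>i<p. \<beta> i = 0"
  shows "norm2 n (\<lambda>i. mat_vec p X \<beta> i - mat_vec p X \<beta>0 i) = 0"
    "norm1 p (\<lambda>i. \<beta> i - \<beta>0 i) = 0" "norm2 p (\<lambda>i. \<beta> i - \<beta>0 i) = 0" "normInf p (\<lambda>i. \<beta> i - \<beta>0 i) = 0"
proof -
  have z: "\<beta> i = 0" "\<beta>0 i = 0" if "i < p" for i using assms that by (auto simp: supp_def)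
  then show "norm2 n (\<lambda>i. mat_vec p X \<beta> i - mat_vec p X \<beta>0 i) = 0"
    "norm1 p (\<lambda>i. \<beta> i - \<beta>0 i) = 0" "norm2 p (\<lambda>i. \<beta> i - \<beta>0 i) = 0"
    by (simp_all add: norm2_def norm1_def mat_vec_def)
  have "insert 0 ((\<lambda>i. \<bar>\<beta> i - \<beta>0 i\<bar>) ` {..<p}) = {0}" using z by auto
  then show "normInf p (\<lambda>i. \<beta> i - \<beta>0 i) = 0" unfolding normInf_def by (simp only: Max_singleton)
qed

lemma if_bound:
  fixes a r :: real
  shows "(c \<Longrightarrow> 0 \<le> a \<and> a \<le> r) \<Longrightarrow> 0 \<le> r \<Longrightarrow> 0 \<le> (if c then a else 0) \<and> (if c then a else 0) \<le> r"
  by simp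

theorem theorem2:
  fixes n p :: "nat \<Rightarrow> nat"
    and X :: "nat \<Rightarrow> nat \<Rightarrow> nat \<Rightarrow> real"
    and lam :: "nat \<Rightarrow> real"
    and \<pi> :: "nat \<Rightarrow> nat pmf"
    and A1 A2 A3 A4 :: real
  assumes n_lim: "filterlim n at_top sequentially"
    and p_lim: "filterlim p at_top sequentially"
    and lam_pos: "\<And>k. lam k > 0"
    and lam_lower: "\<And>k. Xnorm (n k) (p k) (X k) / real (p k) \<le> lam k"
    and lam_upper: "\<And>k. lam k \<le> 2 * lbar (n k) (p k) (X k)"
    and A_pos: "A1 > 0" "A2 > 0" "A3 > 0" "A4 > 0"
    and \<pi>_supp: "\<And>k. set_pmf (\<pi> k) \<subseteq> {0..p k}"
    and \<pi>_lower: "\<And>k s. 1 \<le> s \<Longrightarrow> s \<le> p k \<Longrightarrow>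
        A1 * real (p k) powr (- A3) * pmf (\<pi> k) (s - 1) \<le> pmf (\<pi> k) s"
    and \<pi>_upper: "\<And>k s. 1 \<le> s \<Longrightarrow> s \<le> p k \<Longrightarrow>
        pmf (\<pi> k) s \<le> A2 * real (p k) powr (- A4) * pmf (\<pi> k) (s - 1)"
  shows
   "(\<exists>M0. \<forall>M\<ge>M0. (\<lambda>k. SUP \<beta>0.
        if supp (p k) \<beta>0 = {} \<or>
           (compat (n k) (p k) (X k) (supp (p k) \<beta>0) > 0 \<and>
            psibar (n k) (p k) (X k) (lam k) A4 (supp (p k) \<beta>0) > 0)
        then post_risk (n k) (p k) (X k) (lam k) (\<pi> k) \<beta>0
          {\<beta>. norm2 (n k) (\<lambda>i. mat_vec (p k) (X k) \<beta> i - mat_vec (p k) (X k) \<beta>0 i) >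
               M / psibar (n k) (p k) (X k) (lam k) A4 (supp (p k) \<beta>0)
                 * sqrt (real (card (supp (p k) \<beta>0)) * ln (real (p k)))
                 / compat (n k) (p k) (X k) (supp (p k) \<beta>0)}
        else 0) \<longlonglongrightarrow> 0)
  \<and> (\<exists>M0. \<forall>M\<ge>M0. (\<lambda>k. SUP \<beta>0.
        if supp (p k) \<beta>0 = {} \<or>
           (compat (n k) (p k) (X k) (supp (p k) \<beta>0) > 0 \<and>
            psibar (n k) (p k) (X k) (lam k) A4 (supp (p k) \<beta>0) > 0)
        then post_risk (n k) (p k) (X k) (lam k) (\<pi> k) \<beta>0
          {\<beta>. norm1 (p k) (\<lambda>i. \<beta> i - \<beta>0 i) >
               M / (psibar (n k) (p k) (X k) (lam k) A4 (supp (p k) \<beta>0))^2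
                 * (real (card (supp (p k) \<beta>0)) * sqrt (ln (real (p k))))
                 / (Xnorm (n k) (p k) (X k) * (compat (n k) (p k) (X k) (supp (p k) \<beta>0))^2)}
        else 0) \<longlonglongrightarrow> 0)
  \<and> (\<exists>M0. \<forall>M\<ge>M0. (\<lambda>k. SUP \<beta>0.
        if supp (p k) \<beta>0 = {} \<or>
           (compat (n k) (p k) (X k) (supp (p k) \<beta>0) > 0 \<and>
            psitil (n k) (p k) (X k) (lam k) A4 (supp (p k) \<beta>0) > 0)
        then post_risk (n k) (p k) (X k) (lam k) (\<pi> k) \<beta>0
          {\<beta>. norm2 (p k) (\<lambda>i. \<beta> i - \<beta>0 i) >
               M / (psitil (n k) (p k) (X k) (lam k) A4 (supp (p k) \<beta>0))^2
                 * sqrt (real (card (supp (p k) \<beta>0)) * ln (real (p k)))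
                 / (Xnorm (n k) (p k) (X k) * compat (n k) (p k) (X k) (supp (p k) \<beta>0))}
        else 0) \<longlonglongrightarrow> 0)
  \<and> (\<forall>c0 d0 (sn :: nat \<Rightarrow> real). c0 > 0 \<longrightarrow> d0 < c0^2 / (1 + 2 / A4) / 8 \<longrightarrow>
      (\<lambda>k. lam k * sn k * sqrt (ln (real (p k))) / Xnorm (n k) (p k) (X k)) \<longlonglongrightarrow> 0 \<longrightarrow>
      (\<exists>M0. \<forall>M\<ge>M0. (\<lambda>k. SUP \<beta>0.
        if (supp (p k) \<beta>0 = {} \<or>
            (compat (n k) (p k) (X k) (supp (p k) \<beta>0) \<ge> c0 \<and>
             psitil (n k) (p k) (X k) (lam k) A4 (supp (p k) \<beta>0) \<ge> c0))
           \<and> real (card (supp (p k) \<beta>0)) \<le> sn k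
           \<and> real (card (supp (p k) \<beta>0)) * mcoh (n k) (p k) (X k) \<le> d0
        then post_risk (n k) (p k) (X k) (lam k) (\<pi> k) \<beta>0
          {\<beta>. normInf (p k) (\<lambda>i. \<beta> i - \<beta>0 i) >
               M * sqrt (ln (real (p k))) / Xnorm (n k) (p k) (X k)}
        else 0) \<longlonglongrightarrow> 0))"
proof -
  have prior: "size_prior A1 A2 A3 A4 (p k) (\<pi> k)" for k
    using A_pos \<pi>_supp[of k] \<pi>_lower[of _ k] \<pi>_upper[of _ k] by unfold_locales auto
  \<comment> \<open>A zero design would make \<open>lbar\<close> vanish and contradict positivity of
    \<open>lam\<close>.\<close>
  have X: "Xnorm (n k) (p k) (X k) > 0" for k
  proof (rule ccontr)
    assume "\<not> Xnorm (n k) (p k) (X k) > 0"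
    then have "Xnorm (n k) (p k) (X k) = 0" using Xnorm_nonneg[of "n k" "p k" "X k"] by linarith
    then show False using lam_pos[of k] lam_upper[of k] by (simp add: lbar_def)
  qed
  have ev: "eventually (\<lambda>k. large_size A1 A2 A4 (p k)) sequentially"
    by (rule eventually_compose_filterlim[OF eventually_large p_lim]) (use A_pos in auto)
  \<comment> \<open>One null sequence that dominates all cases, with empty and nonempty
    support.\<close>
  define r where "r k = noise_rate (p k) + 8 / real (p k) + null_rate A2 A4 (p k)" for k
  have r: "r \<longlonglongrightarrow> 0"
  proof -
    have "(\<lambda>p. noise_rate p + 8 / real p + null_rate A2 A4 p) \<longlonglongrightarrow> 0 + 0 + 0"
      using A_pos by (intro tendsto_add noise_rate_tendsto null_rate_tendsto lim_const_over_n) auto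
    from filterlim_compose[OF this p_lim] show ?thesis by (simp add: r_def[abs_def])
  qed
  have null0: "0 \<le> null_rate A2 A4 q" for q using A_pos by (simp add: null_rate_def)
  have r_ge: "noise_rate (p k) \<le> r k" "null_rate A2 A4 (p k) \<le> r k" "noise_rate (p k) + 8 / real (p k) \<le> r k" "0 \<le> r k" for k
    using null0[of "p k"] noise_rate_nonneg[of "p k"] by (auto simp: r_def)
  have null: "post_risk (n k) (p k) (X k) (lam k) (\<pi> k) \<beta>0 B \<le> r k"
    if "large_size A1 A2 A4 (p k)" "supp (p k) \<beta>0 = {}" "\<And>\<beta>. \<forall>i<p k. \<beta> i = 0 \<Longrightarrow> \<beta> \<notin> B" for k \<beta>0 B
  proof -
    interpret size_prior A1 A2 A3 A4 "p k" "\<pi> k" by (rule prior)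
    have "post_risk (n k) (p k) (X k) (lam k) (\<pi> k) \<beta>0 B \<le> null_rate A2 A4 (p k)"
      unfolding null_rate_def
      by (rule post_risk_null[OF that(1) X that(2) lam_lower lam_upper lam_pos]) (use that(3) in blast)
    then show ?thesis using r_ge(2)[of k] by linarith
  qed
  show ?thesis
  proof (intro conjI, goal_cases)
    case 1
    show ?case
    proof (intro exI[of _ "pred_const A3 A4"] allI impI, rule SUP_tendsto_0[OF _ r], goal_cases)
      case (1 M)
      then have M: "pred_const A3 A4 \<le> M" .
      from ev show ?case
      proof eventually_elim
        case (elim k)
        interpret size_prior A1 A2 A3 A4 "p k" "\<pi> k" by (rule prior)
        show ?case
        proof (intro allI if_bound r_ge(4), goal_cases)
          case (1 \<beta>0)
          show ?case
          proof (cases "supp (p k) \<beta>0 = {}")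
            case True
            then show ?thesis
              by (intro conjI post_risk_nonneg null[OF elim True]) (auto simp: supp_empty_norms)
          next
            case False
            with 1 have c: "compat (n k) (p k) (X k) (supp (p k) \<beta>0) > 0"
              and psi: "psibar (n k) (p k) (X k) (lam k) A4 (supp (p k) \<beta>0) > 0" by auto
            note sub = prediction_subset_far[OF elim X False lam_upper lam_pos c psi M]
            show ?thesis
              by (intro conjI post_risk_nonneg order_trans[OF post_risk_far[OF elim X False lam_lower lam_upper lam_pos c sub] r_ge(1)])
          qed
        qed
      qed
    qed
  next
    case 2
    show ?case
    proof (intro exI[of _ "max (l1_const A3 A4) (pred_const A3 A4 * sqrt (68 + 3 / A4))"] allI impI, rule SUP_tendsto_0[OF _ r], goal_cases)
      case (1 M)
      then have M: "l1_const A3 A4 \<le> M" "pred_const A3 A4 * sqrt (68 + 3 / A4) \<le> M" by auto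
      from ev show ?case
      proof eventually_elim
        case (elim k)
        interpret size_prior A1 A2 A3 A4 "p k" "\<pi> k" by (rule prior)
        show ?case
        proof (intro allI if_bound r_ge(4), goal_cases)
          case (1 \<beta>0)
          show ?case
          proof (cases "supp (p k) \<beta>0 = {}")
            case True
            then show ?thesis
              by (intro conjI post_risk_nonneg null[OF elim True]) (auto simp: supp_empty_norms)
          next
            case False
            with 1 have c: "compat (n k) (p k) (X k) (supp (p k) \<beta>0) > 0"
              and psi: "psibar (n k) (p k) (X k) (lam k) A4 (supp (p k) \<beta>0) > 0" by auto
            note sub = l1_subset_far[OF elim X False lam_upper lam_pos c psi M]
            show ?thesis
              by (intro conjI post_risk_nonneg order_trans[OF post_risk_far[OF elim X False lam_lower lam_upper lam_pos c sub] r_ge(1)])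
          qed
        qed
      qed
    qed
  next
    case 3
    show ?case
    proof (intro exI[of _ "max (pred_const A3 A4) (l2_const A3 A4)"] allI impI, rule SUP_tendsto_0[OF _ r], goal_cases)
      case (1 M)
      then have M: "pred_const A3 A4 \<le> M" "l2_const A3 A4 \<le> M" by auto
      from ev show ?case
      proof eventually_elim
        case (elim k)
        interpret size_prior A1 A2 A3 A4 "p k" "\<pi> k" by (rule prior)
        show ?case
        proof (intro allI if_bound r_ge(4), goal_cases)
          case (1 \<beta>0)
          show ?case
          proof (cases "supp (p k) \<beta>0 = {}")
            case True
            then show ?thesis
              by (intro conjI post_risk_nonneg null[OF elim True]) (auto simp: supp_empty_norms)
          next
            case False
            with 1 have c: "compat (n k) (p k) (X k) (supp (p k) \<beta>0) > 0"
              and psi: "psitil (n k) (p k) (X k) (lam k) A4 (supp (p k) \<beta>0) > 0" by auto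
            note sub = l2_subset_far[OF elim X False lam_upper lam_pos c psi M]
            show ?thesis
              by (intro conjI post_risk_nonneg order_trans[OF post_risk_far[OF elim X False lam_lower lam_upper lam_pos c sub] r_ge(1)])
          qed
        qed
      qed
    qed
  next
    case 4
    show ?case
    proof (intro allI impI, goal_cases)
      case (1 c0 d0 sn)
      then have c0: "c0 > 0" and d0: "d0 < c0\<^sup>2 / (1 + 2 / A4) / 8"
        and sn: "(\<lambda>k. lam k * sn k * sqrt (ln (real (p k))) / Xnorm (n k) (p k) (X k)) \<longlonglongrightarrow> 0" by blast+
      \<comment> \<open>The first entry puts x below the threshold, where the dimension bound holds.
        The second gives 33 x / c0^2 <= 1 / A4, so \<open>psi_arg\<close> is at most 2 (1 + 2 / A4)
        |S0|; this is the origin of the 2 / A4 in the condition on d0.\<close>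
      define \<epsilon> where "\<epsilon> = min (lam_cut A4) (c0\<^sup>2 / (33 * A4))"
      interpret P: size_prior A1 A2 A3 A4 "p 0" "\<pi> 0" by (rule prior)
      have \<epsilon>: "\<epsilon> > 0" using P.lam_cut_pos c0 A_pos by (simp add: \<epsilon>_def)
      have ev_sn: "eventually (\<lambda>k. lam k * sn k * sqrt (ln (real (p k))) / Xnorm (n k) (p k) (X k) < \<epsilon>) sequentially"
        using order_tendstoD(2)[OF sn \<epsilon>] .
      have "eventually (\<lambda>q. 1 \<le> ln (real q)) at_top" by real_asymp
      from eventually_compose_filterlim[OF this p_lim]
      have ev_ln: "eventually (\<lambda>k. 1 \<le> ln (real (p k))) sequentially" .
      show ?case
      proof (intro exI[of _ "max (80 / c0\<^sup>2) (8 * (11 + A3) / c0)"] allI impI, rule SUP_tendsto_0[OF _ r], goal_cases)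
        case (1 M)
        then have M: "80 / c0\<^sup>2 \<le> M" "8 * (11 + A3) / c0 \<le> M" by auto
        have M0: "0 \<le> M" using M(1) by (rule order_trans[rotated]) simp
        from ev ev_sn ev_ln show ?case
        proof eventually_elim
          case (elim k)
          interpret size_prior A1 A2 A3 A4 "p k" "\<pi> k" by (rule prior)
          let ?X = "Xnorm (n k) (p k) (X k)"
          show ?case
          proof (intro allI if_bound r_ge(4), goal_cases)
            case (1 \<beta>0)
            let ?S = "supp (p k) \<beta>0"
            show ?case
            proof (cases "?S = {}")
              case True
              have "0 \<le> M * sqrt (ln (real (p k))) / ?X" using M0 elim(3) X[of k] by simp
              then show ?thesis
                by (intro conjI post_risk_nonneg null[OF elim(1) True]) (auto simp: supp_empty_norms[OF True])
            next
              case False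
              with 1 have c: "compat (n k) (p k) (X k) ?S \<ge> c0" and psi: "c0 \<le> psitil (n k) (p k) (X k) (lam k) A4 ?S"
                and cs: "real (card ?S) \<le> sn k" "real (card ?S) * mcoh (n k) (p k) (X k) \<le> d0" by auto
              have sub: "?S \<subseteq> {..<p k}" by (auto simp: supp_def)
              have p2: "p k \<ge> 2" using elim(1) by (simp add: large_size_def)
              note arg = psi_arg_ge[OF X[of k] p2 sub False lam_pos[of k]]
              have c01: "c0 \<le> 1" using psi phitil_le_1[OF X[of k] arg(2)] unfolding psitil_def by linarith
              define x where "x = lam k / lbar (n k) (p k) (X k)"
              define L where "L = ln (real (p k))"
              have L: "1 \<le> L" using elim(3) by (simp add: L_def)
              \<comment> \<open>A nonempty support forces \<open>sn k\<close> >= 1, so the assumed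
                limit also controls the expression without \<open>sn k\<close>; x is that expression
                divided by 2 ln p.\<close>
              have x: "x \<le> \<epsilon>"
              proof -
                define u where "u = lam k * sqrt L / ?X"
                have u0: "0 \<le> u" using lam_pos[of k] X[of k] L by (simp add: u_def)
                have "1 * u \<le> sn k * u" using cs(1) arg(3) u0 by (intro mult_right_mono) auto
                also have "sn k * u = lam k * sn k * sqrt (ln (real (p k))) / ?X" by (simp add: u_def L_def)
                finally have "u \<le> \<epsilon>" using elim(2) by linarith
                moreover have "x = u / (2 * L)"
                proof -
                  have "sqrt L * sqrt L = L" "sqrt L > 0" using L by auto
                  then show ?thesis using X[of k] L by (simp add: x_def u_def lbar_def L_def[symmetric] field_simps)
                qed
                moreover have "u / (2 * L) \<le> u / 1" using u0 L by (intro divide_left_mono) auto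
                ultimately show ?thesis by simp
              qed
              have x0: "0 \<le> x" using lam_pos[of k] X[of k] L by (simp add: x_def lbar_def L_def)
              have R: "psi_arg (n k) (p k) (X k) (lam k) A4 ?S * mcoh (n k) (p k) (X k) \<le> c0 / 4"
              proof -
                have "33 / (compat (n k) (p k) (X k) ?S)\<^sup>2 * x \<le> 33 / c0\<^sup>2 * (c0\<^sup>2 / (33 * A4))"
                  using c c0 x x0 A_pos by (intro mult_mono divide_left_mono power_mono) (auto simp: \<epsilon>_def)
                also have "\<dots> = 1 / A4" using c0 by simp
                finally have "2 + 3 / A4 + 33 / (compat (n k) (p k) (X k) ?S)\<^sup>2 * x \<le> 2 * (1 + 2 / A4)" by simp
                then have "psi_arg (n k) (p k) (X k) (lam k) A4 ?S \<le> 2 * (1 + 2 / A4) * real (card ?S)"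
                  unfolding psi_arg_def x_def by (intro mult_right_mono) auto
                then have "psi_arg (n k) (p k) (X k) (lam k) A4 ?S * mcoh (n k) (p k) (X k) \<le>
                    2 * (1 + 2 / A4) * real (card ?S) * mcoh (n k) (p k) (X k)"
                  by (intro mult_right_mono mcoh_nonneg)
                also have "\<dots> = 2 * (1 + 2 / A4) * (real (card ?S) * mcoh (n k) (p k) (X k))" by simp
                also have "\<dots> \<le> 2 * (1 + 2 / A4) * (c0\<^sup>2 / (1 + 2 / A4) / 8)"
                  using cs(2) d0 A_pos by (intro mult_left_mono) auto
                also have "\<dots> = c0\<^sup>2 / 4"
                proof -
                  have "2 * e * (c / e / 8) = c / 4" if "e > 0" for e c :: real using that by simp
                  from this[of "1 + 2 / A4"] show ?thesis using A_pos by (simp add: add_pos_pos)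
                qed
                \<comment> \<open>c0 <= 1 because \<open>psitil\<close> never exceeds 1.\<close>
                also have "\<dots> \<le> c0 / 4" using c0 c01 by (simp add: power2_eq_square mult_left_le)
                finally show ?thesis .
              qed
              have "post_risk (n k) (p k) (X k) (lam k) (\<pi> k) \<beta>0
                  {\<beta>. normInf (p k) (\<lambda>i. \<beta> i - \<beta>0 i) > M * sqrt (ln (real (p k))) / ?X} \<le> noise_rate (p k) + 8 / real (p k)"
                using c c0 x unfolding x_def \<epsilon>_def
                by (intro post_risk_sup[OF elim(1) X False lam_lower lam_upper lam_pos _ c0 psi _ R elim(3) M]) auto
              then show ?thesis
                by (intro conjI post_risk_nonneg order_trans[OF _ r_ge(3)])
            qed
          qed
        qed
      qed
    qed
  qed
qed

end
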